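(* Let $(M^n,g,\nabla f,\lambda,\rho)$ be a compact gradient Ricci-Bourguignon almost soliton, i.e. $(M^n,g)$ is a compact $n$-dimensional Riemannian manifold, $f:M\to\mathbb{R}$ is a smooth function, $\lambda:M\to\mathbb{R}$ is a function, $\rho\in\mathbb{R}$ is a constant, and $\mathrm{Ric}+\nabla^2f=\lambda g+\rho Rg$. Then $$\int_M\Big|\nabla^2f-\frac{\Delta f}{n}g\Big|^2dv=\frac{n-2}{2n}\int_Mg(\nabla R,\nabla f)\,dv$$ and $$\int_M\Big|\mathrm{Ric}-\frac Rng\Big|^2dv=\frac{n-2}{2n}\int_Mg(\nabla R,\nabla f)\,dv.$$
   Context: Everything is smooth and manifolds are without boundary. $\mathrm{Ric}$ is the Ricci tensor, $R$ the scalar curvature of $g$, $\nabla^2f$ the Hessian of $f$ (so $\nabla^2f=\frac12\mathcal{L}_{\nabla f}g$), $\Delta f$ its trace with respect to $g$, $|\cdot|$ the tensor norm induced by $g$, and $dv$ the Riemannian volume measure. *)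

theory Defs
  imports "HOL-Analysis.Analysis"
begin

section \<open>Smooth functions on open subsets of Euclidean space\<close>

definition pderiv_coord :: "'n::finite \<Rightarrow> (real^'n \<Rightarrow> real) \<Rightarrow> real^'n \<Rightarrow> real" where
  "pderiv_coord i u x = frechet_derivative u (at x) (axis i 1)"

text \<open>Only used for open \<open>S\<close>, where differentiability on \<open>S\<close> is differentiability at each point.\<close>

primrec Ck_on :: "nat \<Rightarrow> (real^'n::finite) set \<Rightarrow> (real^'n \<Rightarrow> real) \<Rightarrow> bool" where
  "Ck_on 0 S u \<longleftrightarrow> continuous_on S u"
| "Ck_on (Suc k) S u \<longleftrightarrow> u differentiable_on S \<and> (\<forall>i. Ck_on k S (pderiv_coord i u))"

definition smooth_on :: "(real^'n::finite) set \<Rightarrow> (real^'n \<Rightarrow> real) \<Rightarrow> bool" where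
  "smooth_on S u \<longleftrightarrow> (\<forall>k. Ck_on k S u)"


section \<open>Smooth manifolds\<close>

text \<open>
  A manifold is a subset \<open>M\<close> of a second countable Hausdorff space (possibly the whole space),
  with its subspace topology, together with a smooth atlas. A chart consists of its domain and
  its coordinate map; the values of the coordinate map outside the domain are irrelevant.
  The dimension is \<open>CARD('n)\<close>.
\<close>

type_synonym ('a, 'n) chart = "'a set \<times> ('a \<Rightarrow> real^'n)"

abbreviation cdom :: "('a, 'n) chart \<Rightarrow> 'a set" where
  "cdom c \<equiv> fst c"

abbreviation coord :: "('a, 'n) chart \<Rightarrow> 'a \<Rightarrow> real^'n" where
  "coord c \<equiv> snd c"

definition param :: "('a, 'n) chart \<Rightarrow> real^'n \<Rightarrow> 'a" where
  "param c = the_inv_into (cdom c) (coord c)"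

definition is_chart :: "'a::topological_space set \<Rightarrow> ('a, 'n::finite) chart \<Rightarrow> bool" where
  "is_chart M c \<longleftrightarrow>
     openin (top_of_set M) (cdom c) \<and> open (coord c ` cdom c) \<and>
     homeomorphism (cdom c) (coord c ` cdom c) (coord c) (param c)"

definition smooth_manifold ::
    "'a::{t2_space,second_countable_topology} set \<Rightarrow> ('a, 'n::finite) chart set \<Rightarrow> bool" where
  "smooth_manifold M A \<longleftrightarrow>
     (\<forall>c\<in>A. is_chart M c) \<and>
     (\<Union>c\<in>A. cdom c) = M \<and>
     (\<forall>c\<in>A. \<forall>d\<in>A. \<forall>k. smooth_on (coord c ` (cdom c \<inter> cdom d)) (\<lambda>x. coord d (param c x) $ k))"

definition smooth_fun :: "('a, 'n::finite) chart set \<Rightarrow> ('a \<Rightarrow> real) \<Rightarrow> bool" where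
  "smooth_fun A u \<longleftrightarrow> (\<forall>c\<in>A. smooth_on (coord c ` cdom c) (\<lambda>x. u (param c x)))"

text \<open>The coordinate derivative \<open>\<partial>u/\<partial>x\<^sup>i\<close> at the point \<open>p\<close>, with respect to the chart \<open>c\<close>.\<close>

definition cderiv :: "('a, 'n::finite) chart \<Rightarrow> 'n \<Rightarrow> ('a \<Rightarrow> real) \<Rightarrow> 'a \<Rightarrow> real" where
  "cderiv c i u p = pderiv_coord i (\<lambda>x. u (param c x)) (coord c p)"


section \<open>Tensor fields and Riemannian metrics\<close>

text \<open>
  Vector fields and covariant 2-tensor fields are given by their components: \<open>T c p $ i $ j\<close> is
  the \<open>(i,j)\<close> component of the tensor \<open>T\<close> at \<open>p\<close> in the coordinate frame of \<open>c\<close>, meaningful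
  for \<open>p \<in> cdom c\<close>.
\<close>

type_synonym ('a, 'n) vector_field = "('a, 'n) chart \<Rightarrow> 'a \<Rightarrow> real^'n"
type_synonym ('a, 'n) tensor2 = "('a, 'n) chart \<Rightarrow> 'a \<Rightarrow> real^'n^'n"

definition covariant_tensor2 :: "('a, 'n::finite) chart set \<Rightarrow> ('a, 'n) tensor2 \<Rightarrow> bool" where
  "covariant_tensor2 A T \<longleftrightarrow>
     (\<forall>c\<in>A. \<forall>d\<in>A. \<forall>p \<in> cdom c \<inter> cdom d. \<forall>i j.
        T c p $ i $ j =
          (\<Sum>k\<in>UNIV. \<Sum>l\<in>UNIV.
             cderiv c i (\<lambda>q. coord d q $ k) p * cderiv c j (\<lambda>q. coord d q $ l) p * T d p $ k $ l))"

definition riemannian_metric :: "('a, 'n::finite) chart set \<Rightarrow> ('a, 'n) tensor2 \<Rightarrow> bool" where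
  "riemannian_metric A g \<longleftrightarrow>
     covariant_tensor2 A g \<and>
     (\<forall>c\<in>A. \<forall>i j. smooth_on (coord c ` cdom c) (\<lambda>x. g c (param c x) $ i $ j)) \<and>
     (\<forall>c\<in>A. \<forall>p\<in>cdom c. \<forall>i j. g c p $ i $ j = g c p $ j $ i) \<and>
     (\<forall>c\<in>A. \<forall>p\<in>cdom c. \<forall>v. v \<noteq> 0 \<longrightarrow> v \<bullet> (g c p *v v) > 0)"

definition ginv :: "('a, 'n::finite) tensor2 \<Rightarrow> ('a, 'n) tensor2" where
  "ginv g c p = matrix_inv (g c p)"

text \<open>
  Quantities that do not depend on the chart are evaluated in an arbitrary chart around the point.
\<close>

definition chart_at :: "('a, 'n) chart set \<Rightarrow> 'a \<Rightarrow> ('a, 'n) chart" where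
  "chart_at A p = (SOME c. c \<in> A \<and> p \<in> cdom c)"

definition metric_trace ::
    "('a, 'n::finite) chart set \<Rightarrow> ('a, 'n) tensor2 \<Rightarrow> ('a, 'n) tensor2 \<Rightarrow> 'a \<Rightarrow> real" where
  "metric_trace A g T p =
     (let c = chart_at A p in \<Sum>i\<in>UNIV. \<Sum>j\<in>UNIV. ginv g c p $ i $ j * T c p $ i $ j)"

text \<open>\<open>|T|\<^sup>2 = g\<^sup>i\<^sup>k g\<^sup>j\<^sup>l T\<^sub>i\<^sub>j T\<^sub>k\<^sub>l\<close>\<close>

definition tensor_norm ::
    "('a, 'n::finite) chart set \<Rightarrow> ('a, 'n) tensor2 \<Rightarrow> ('a, 'n) tensor2 \<Rightarrow> 'a \<Rightarrow> real" where
  "tensor_norm A g T p =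
     (let c = chart_at A p in
      sqrt (\<Sum>i\<in>UNIV. \<Sum>j\<in>UNIV. \<Sum>k\<in>UNIV. \<Sum>l\<in>UNIV.
              ginv g c p $ i $ k * ginv g c p $ j $ l * T c p $ i $ j * T c p $ k $ l))"

definition metric_inner ::
    "('a, 'n::finite) chart set \<Rightarrow> ('a, 'n) tensor2 \<Rightarrow>
     ('a, 'n) vector_field \<Rightarrow> ('a, 'n) vector_field \<Rightarrow> 'a \<Rightarrow> real" where
  "metric_inner A g X Y p = (let c = chart_at A p in X c p \<bullet> (g c p *v Y c p))"

definition grad :: "('a, 'n::finite) tensor2 \<Rightarrow> ('a \<Rightarrow> real) \<Rightarrow> ('a, 'n) vector_field" where
  "grad g u c p = (\<chi> i. \<Sum>j\<in>UNIV. ginv g c p $ i $ j * cderiv c j u p)"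


section \<open>Levi-Civita connection, Hessian and curvature\<close>

text \<open>\<open>christoffel g c k i j\<close> is \<open>\<Gamma>\<^sup>k\<^sub>i\<^sub>j\<close>.\<close>

definition christoffel ::
    "('a, 'n::finite) tensor2 \<Rightarrow> ('a, 'n) chart \<Rightarrow> 'n \<Rightarrow> 'n \<Rightarrow> 'n \<Rightarrow> 'a \<Rightarrow> real" where
  "christoffel g c k i j p =
     1 / 2 * (\<Sum>l\<in>UNIV. ginv g c p $ k $ l *
       (cderiv c i (\<lambda>q. g c q $ j $ l) p + cderiv c j (\<lambda>q. g c q $ i $ l) p
        - cderiv c l (\<lambda>q. g c q $ i $ j) p))"

definition hessian :: "('a, 'n::finite) tensor2 \<Rightarrow> ('a \<Rightarrow> real) \<Rightarrow> ('a, 'n) tensor2" where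
  "hessian g u c p =
     (\<chi> i j. cderiv c i (cderiv c j u) p - (\<Sum>k\<in>UNIV. christoffel g c k i j p * cderiv c k u p))"

definition laplacian ::
    "('a, 'n::finite) chart set \<Rightarrow> ('a, 'n) tensor2 \<Rightarrow> ('a \<Rightarrow> real) \<Rightarrow> 'a \<Rightarrow> real" where
  "laplacian A g u = metric_trace A g (hessian g u)"

text \<open>
  Sign convention: \<open>R(\<partial>\<^sub>i, \<partial>\<^sub>j) \<partial>\<^sub>k = \<Sum>l. riemann g c l k i j \<partial>\<^sub>l\<close>, where
  \<open>R(X,Y)Z = \<nabla>\<^sub>X\<nabla>\<^sub>Y Z - \<nabla>\<^sub>Y\<nabla>\<^sub>X Z - \<nabla>\<^bsub>[X,Y]\<^esub> Z\<close>, and \<open>Ric(Y,Z)\<close> is the trace of \<open>X \<mapsto> R(X,Y)Z\<close>; round spheres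
  have positive Ricci curvature.
\<close>

definition riemann ::
    "('a, 'n::finite) tensor2 \<Rightarrow> ('a, 'n) chart \<Rightarrow> 'n \<Rightarrow> 'n \<Rightarrow> 'n \<Rightarrow> 'n \<Rightarrow> 'a \<Rightarrow> real" where
  "riemann g c l k i j p =
     cderiv c i (christoffel g c l j k) p - cderiv c j (christoffel g c l i k) p
     + (\<Sum>m\<in>UNIV. christoffel g c l i m p * christoffel g c m j k p
                 - christoffel g c l j m p * christoffel g c m i k p)"

definition ricci :: "('a, 'n::finite) tensor2 \<Rightarrow> ('a, 'n) tensor2" where
  "ricci g c p = (\<chi> j k. \<Sum>i\<in>UNIV. riemann g c i k i j p)"

definition scalar_curvature ::
    "('a, 'n::finite) chart set \<Rightarrow> ('a, 'n) tensor2 \<Rightarrow> 'a \<Rightarrow> real" where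
  "scalar_curvature A g = metric_trace A g (ricci g)"


section \<open>Riemannian volume measure\<close>

text \<open>
  The unique Borel measure on \<open>M\<close> that is \<open>sqrt (det (g\<^sub>i\<^sub>j)) dx\<^sup>1 \<dots> dx\<^sup>n\<close> in every chart.
\<close>

definition is_volume_measure ::
    "'a::topological_space set \<Rightarrow> ('a, 'n::finite) chart set \<Rightarrow> ('a, 'n) tensor2 \<Rightarrow>
     'a measure \<Rightarrow> bool" where
  "is_volume_measure M A g \<mu> \<longleftrightarrow>
     sets \<mu> = sets (restrict_space borel M) \<and>
     (\<forall>c\<in>A. \<forall>B\<in>sets \<mu>. B \<subseteq> cdom c \<longrightarrow>
        emeasure \<mu> B =
          (\<integral>\<^sup>+x\<in>coord c ` B. ennreal (sqrt (det (g c (param c x)))) \<partial>lborel))"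

definition volume_measure ::
    "'a::topological_space set \<Rightarrow> ('a, 'n::finite) chart set \<Rightarrow> ('a, 'n) tensor2 \<Rightarrow> 'a measure" where
  "volume_measure M A g = (THE \<mu>. is_volume_measure M A g \<mu>)"


section \<open>Gradient Ricci--Bourguignon almost solitons\<close>

text \<open>
  The soliton equation is an equality of tensor fields, hence of components in every chart.
  Smoothness of \<open>lam\<close> is not required; it follows by taking the trace of the equation.
\<close>

definition gradient_RB_almost_soliton ::
    "'a::{t2_space,second_countable_topology} set \<Rightarrow> ('a, 'n::finite) chart set \<Rightarrow>
     ('a, 'n) tensor2 \<Rightarrow> ('a \<Rightarrow> real) \<Rightarrow> ('a \<Rightarrow> real) \<Rightarrow> real \<Rightarrow> bool" where
  "gradient_RB_almost_soliton M A g f lam \<rho> \<longleftrightarrow>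
     smooth_manifold M A \<and> riemannian_metric A g \<and> smooth_fun A f \<and>
     (\<forall>c\<in>A. \<forall>p\<in>cdom c.
        ricci g c p + hessian g f c p = lam p *\<^sub>R g c p + (\<rho> * scalar_curvature A g p) *\<^sub>R g c p)"

end

(*
With T = Ric - (R/n) g the contracted second Bianchi identity gives
div T = (1/2 - 1/n) dR, and the soliton equation says that T is minus the trace-free Hessian of f.
Hence div (T(grad f)) = (1/2 - 1/n) g(grad R, grad f) - |T|^2, which integrates to zero.
All identities are checked in the coordinates of a single chart, where the connection is a family of
matrices; a C^1 partition of unity reduces the divergence theorem to compactly supported functions
on R^n.
*)
theory Submission
  imports Defs
begin

section \<open>Partial derivatives\<close>

text \<open>Multiplying by \<open>sqrt (det G)\<close> turns the covariant divergence of
  \<open>V = T(grad f)\<close> into a sum of ordinary partial derivatives, and each of these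
  integrates to zero once the support is compact. Cutting off by a function \<open>u\<close> costs
  the term \<open>du(V)\<close>; over a partition of unity these terms add up to the derivative of
  the constant 1. Only first derivatives of the cutoffs occur, so C^1 bumps suffice. Three obstacles
  shape the rest. \<open>volume_measure\<close> is a definite description, so existence and
  uniqueness must be proved, which rests on the change of variables formula for chart transitions.
  \<open>tensor_norm\<close> is a square root, so recovering |T|^2 requires the quadratic form to be
  nonnegative, hence a factorization of positive definite matrices. Scalars are evaluated in a
  chosen chart, so each local formula needs chart independence; for the curvature this is obtained
  indirectly, since the soliton equation expresses Ric through the metric and the Hessian, whose
  transformation laws are simpler.\<close>

abbreviation pd :: "'n::finite \<Rightarrow> (real^'n \<Rightarrow> real) \<Rightarrow> real^'n \<Rightarrow> real" where
  "pd \<equiv> pderiv_coord"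

lemma pd_eqI:
  assumes "(u has_derivative D) (at x)"
  shows "pd i u x = D (axis i 1)"
  using frechet_derivative_at[OF assms] by (simp add: pderiv_coord_def)

lemma has_derivative_pd:
  assumes "u differentiable (at x)"
  shows "(u has_derivative (\<lambda>h. \<Sum>i\<in>UNIV. h $ i * pd i u x)) (at x)"
proof -
  let ?D = "frechet_derivative u (at x)"
  have D: "(u has_derivative ?D) (at x)"
    using assms frechet_derivative_works by blast
  then interpret bounded_linear ?D by (rule has_derivative_bounded_linear)
  have "?D h = (\<Sum>i\<in>UNIV. h $ i * pd i u x)" for h
  proof -
    have "h = (\<Sum>i\<in>UNIV. h $ i *\<^sub>R axis i 1)"
      using basis_expansion[of h] by (simp add: scalar_mult_eq_scaleR)
    then have "?D h = ?D (\<Sum>i\<in>UNIV. h $ i *\<^sub>R axis i 1)" by simp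
    also have "\<dots> = (\<Sum>i\<in>UNIV. h $ i * pd i u x)"
      by (simp add: sum scale pderiv_coord_def)
    finally show ?thesis .
  qed
  then have "?D = (\<lambda>h. \<Sum>i\<in>UNIV. h $ i * pd i u x)" by (rule ext)
  with D show ?thesis by simp
qed

lemma has_derivative_cong_open:
  assumes "open S" "x \<in> S" "\<And>y. y \<in> S \<Longrightarrow> u y = v y"
  shows "(u has_derivative D) (at x) \<longleftrightarrow> (v has_derivative D) (at x)"
  using has_derivative_transform_within_open[of u D x UNIV S v]
    has_derivative_transform_within_open[of v D x UNIV S u] assms by metis

text \<open>The means of differentiating an identity that is known only on an open set, such as a
  chart image.\<close>

lemma pd_cong:
  assumes "open S" "x \<in> S" "\<And>y. y \<in> S \<Longrightarrow> u y = v y"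
  shows "pd i u x = pd i v x"
  by (simp add: pderiv_coord_def frechet_derivative_def has_derivative_cong_open[OF assms])

lemma differentiable_cong_open:
  assumes "open S" "x \<in> S" "\<And>y. y \<in> S \<Longrightarrow> u y = v y"
  shows "u differentiable (at x) \<longleftrightarrow> v differentiable (at x)"
  by (simp add: differentiable_def has_derivative_cong_open[OF assms])

lemma pd_const [simp]: "pd i (\<lambda>_. c) x = 0"
  by (simp add: pderiv_coord_def)

lemma pd_add:
  assumes "u differentiable (at x)" "v differentiable (at x)"
  shows "pd i (\<lambda>y. u y + v y) x = pd i u x + pd i v x"
  by (rule pd_eqI[THEN trans])
    (use assms in \<open>auto intro!: derivative_eq_intros simp: frechet_derivative_works pderiv_coord_def\<close>)

lemma pd_diff:
  assumes "u differentiable (at x)" "v differentiable (at x)"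
  shows "pd i (\<lambda>y. u y - v y) x = pd i u x - pd i v x"
  by (rule pd_eqI[THEN trans])
    (use assms in \<open>auto intro!: derivative_eq_intros simp: frechet_derivative_works pderiv_coord_def\<close>)

lemma pd_mult:
  assumes "u differentiable (at x)" "v differentiable (at x)"
  shows "pd i (\<lambda>y. u y * v y) x = pd i u x * v x + u x * pd i v x"
  by (rule pd_eqI[THEN trans])
    (use assms in \<open>auto intro!: derivative_eq_intros simp: frechet_derivative_works pderiv_coord_def\<close>)

lemma pd_cmult:
  assumes "u differentiable (at x)"
  shows "pd i (\<lambda>y. c * u y) x = c * pd i u x"
  using pd_mult[of "\<lambda>_. c" x u i] assms by simp

lemma pd_sum:
  assumes "\<And>a. a \<in> I \<Longrightarrow> u a differentiable (at x)"
  shows "pd i (\<lambda>y. \<Sum>a\<in>I. u a y) x = (\<Sum>a\<in>I. pd i (u a) x)"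
  by (rule pd_eqI[THEN trans])
    (use assms in \<open>auto intro!: derivative_eq_intros simp: frechet_derivative_works pderiv_coord_def\<close>)

text \<open>The outer functions in question are \<open>inverse\<close>, \<open>sqrt\<close> and the
  squared positive part.\<close>

lemma pd_real_compose:
  assumes "u differentiable (at x)" "(\<phi> has_real_derivative d) (at (u x))"
  shows "pd i (\<lambda>y. \<phi> (u y)) x = d * pd i u x"
    and "(\<lambda>y. \<phi> (u y)) differentiable (at x)"
proof -
  have "((\<lambda>y. \<phi> (u y)) has_derivative (\<lambda>h. d * frechet_derivative u (at x) h)) (at x)"
    using has_derivative_compose[of u "frechet_derivative u (at x)" x UNIV \<phi> "(*) d"] assms
    by (auto simp: frechet_derivative_works has_field_derivative_def)
  then show "pd i (\<lambda>y. \<phi> (u y)) x = d * pd i u x"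
    and "(\<lambda>y. \<phi> (u y)) differentiable (at x)"
    by (auto simp: differentiable_def pderiv_coord_def dest: pd_eqI)
qed

lemma has_derivative_vec_components:
  fixes \<phi> :: "real^'n \<Rightarrow> real^'m"
  assumes "\<And>k. (\<lambda>y. \<phi> y $ k) differentiable (at x)"
  shows "(\<phi> has_derivative (\<lambda>h. (\<chi> k i. pd i (\<lambda>y. \<phi> y $ k) x) *v h)) (at x)"
proof (subst has_derivative_componentwise_within, intro ballI)
  fix b :: "real^'m" assume "b \<in> Basis"
  then obtain k where b: "b = axis k 1" by (auto simp: Basis_vec_def)
  have "((\<lambda>y. \<phi> y $ k) has_derivative (\<lambda>h. \<Sum>i\<in>UNIV. h $ i * pd i (\<lambda>y. \<phi> y $ k) x)) (at x)"
    by (rule has_derivative_pd[OF assms])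
  then show "((\<lambda>y. \<phi> y \<bullet> b) has_derivative
      (\<lambda>h. ((\<chi> k i. pd i (\<lambda>y. \<phi> y $ k) x) *v h) \<bullet> b)) (at x)"
    by (simp add: b inner_axis matrix_vector_mult_def mult.commute)
qed

lemma pd_chain:
  fixes \<phi> :: "real^'n \<Rightarrow> real^'m"
  assumes \<phi>: "\<And>k. (\<lambda>y. \<phi> y $ k) differentiable (at x)" and u: "u differentiable (at (\<phi> x))"
  shows "pd i (\<lambda>y. u (\<phi> y)) x =
      (\<Sum>k\<in>UNIV. pd i (\<lambda>y. \<phi> y $ k) x * pd k u (\<phi> x))"
    and "(\<lambda>y. u (\<phi> y)) differentiable (at x)"
proof -
  have D: "((\<lambda>y. u (\<phi> y)) has_derivative (\<lambda>h. \<Sum>k\<in>UNIV.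
      ((\<chi> k i. pd i (\<lambda>y. \<phi> y $ k) x) *v h) $ k * pd k u (\<phi> x))) (at x)"
    using has_derivative_compose[OF has_derivative_vec_components[OF \<phi>]
        has_derivative_pd[OF u]] .
  show "pd i (\<lambda>y. u (\<phi> y)) x =
      (\<Sum>k\<in>UNIV. pd i (\<lambda>y. \<phi> y $ k) x * pd k u (\<phi> x))"
    by (subst pd_eqI[OF D])
      (simp add: matrix_vector_mult_basis column_def)
  show "(\<lambda>y. u (\<phi> y)) differentiable (at x)"
    using D differentiable_def by blast
qed

text \<open>Makes the one-variable mean value theorem available for partial derivatives.\<close>

lemma has_real_derivative_along_axis:
  assumes "u differentiable (at (y + s *\<^sub>R axis i 1))"
  shows "((\<lambda>t. u (y + t *\<^sub>R axis i 1)) has_real_derivative pd i u (y + s *\<^sub>R axis i 1)) (at s)"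
proof -
  let ?D = "frechet_derivative u (at (y + s *\<^sub>R axis i 1))"
  have D: "(u has_derivative ?D) (at (y + s *\<^sub>R axis i 1))"
    using assms frechet_derivative_works by blast
  have "((\<lambda>t. y + t *\<^sub>R axis i (1::real)) has_derivative (\<lambda>h. h *\<^sub>R axis i 1)) (at s)"
    by (auto intro!: derivative_eq_intros)
  from has_derivative_compose[OF this D]
  have "((\<lambda>t. u (y + t *\<^sub>R axis i 1)) has_derivative (\<lambda>h. ?D (h *\<^sub>R axis i 1))) (at s)" .
  moreover have "?D (h *\<^sub>R axis i 1) = pd i u (y + s *\<^sub>R axis i 1) * h" for h
    using has_derivative_bounded_linear[OF D]
    by (simp add: linear_simps pderiv_coord_def)
  ultimately show ?thesis
    by (simp add: has_field_derivative_def)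
qed


section \<open>Functions of class \<open>C\<^sup>k\<close>\<close>

lemma Ck_on_cong:
  assumes "open S" "\<And>x. x \<in> S \<Longrightarrow> u x = v x"
  shows "Ck_on k S u \<longleftrightarrow> Ck_on k S v"
  using assms(2)
proof (induction k arbitrary: u v)
  case 0
  then show ?case by (simp cong: continuous_on_cong)
next
  case (Suc k)
  have "u differentiable_on S \<longleftrightarrow> v differentiable_on S"
    using differentiable_cong_open[OF assms(1) _ Suc.prems]
    by (simp add: differentiable_on_eq_differentiable_at[OF assms(1)])
  moreover have "Ck_on k S (pd i u) \<longleftrightarrow> Ck_on k S (pd i v)" for i
    by (rule Suc.IH) (rule pd_cong[OF assms(1) _ Suc.prems])
  ultimately show ?case by simp
qed

text \<open>Continuity is demanded of the derivatives of top order only; at lower orders it comes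
  from differentiability.\<close>

lemma Ck_on_Suc_imp: "Ck_on (Suc k) S u \<Longrightarrow> Ck_on k S u"
proof (induction k arbitrary: u)
  case 0
  then show ?case by (simp add: differentiable_imp_continuous_on)
qed auto

lemma Ck_on_mono: "Ck_on k S u \<Longrightarrow> l \<le> k \<Longrightarrow> Ck_on l S u"
  by (induction k) (auto simp: le_Suc_eq intro: Ck_on_Suc_imp simp del: Ck_on.simps(2))

lemma Ck_on_continuous_on: "Ck_on k S u \<Longrightarrow> continuous_on S u"
  using Ck_on_mono[of k S u 0] by simp

lemma Ck_on_differentiable:
  "Ck_on (Suc k) S u \<Longrightarrow> open S \<Longrightarrow> x \<in> S \<Longrightarrow> u differentiable (at x)"
  by (simp add: differentiable_on_eq_differentiable_at)

lemma Ck_on_pd: "Ck_on (Suc k) S u \<Longrightarrow> Ck_on k S (pd i u)"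
  by simp

lemma Ck_on_const [simp]: "Ck_on k S (\<lambda>_. c)"
proof (induction k arbitrary: c)
  case (Suc k)
  have "pd i (\<lambda>_. c) = (\<lambda>_. 0)" for i :: 'a by auto
  with Suc show ?case by simp
qed simp

lemma Ck_on_add:
  assumes "open S" "Ck_on k S u" "Ck_on k S v"
  shows "Ck_on k S (\<lambda>x. u x + v x)"
  using assms(2,3)
proof (induction k arbitrary: u v)
  case 0
  then show ?case by (auto intro: continuous_on_add)
next
  case (Suc k)
  have "Ck_on k S (pd i (\<lambda>x. u x + v x))" for i
    by (subst Ck_on_cong[OF assms(1), where v = "\<lambda>x. pd i u x + pd i v x"])
      (use Suc Ck_on_differentiable[OF _ assms(1)] in \<open>auto intro!: pd_add simp del: Ck_on.simps
        intro: Ck_on_pd\<close>)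
  with Suc.prems show ?case by (auto intro: differentiable_on_add)
qed

lemma Ck_on_mult:
  assumes "open S" "Ck_on k S u" "Ck_on k S v"
  shows "Ck_on k S (\<lambda>x. u x * v x)"
  using assms(2,3)
proof (induction k arbitrary: u v)
  case 0
  then show ?case by (auto intro: continuous_on_mult)
next
  case (Suc k)
  have "Ck_on k S (pd i (\<lambda>x. u x * v x))" for i
    by (subst Ck_on_cong[OF assms(1), where v = "\<lambda>x. pd i u x * v x + u x * pd i v x"])
      (use Suc Ck_on_differentiable[OF _ assms(1)] in \<open>auto intro!: pd_mult Ck_on_add[OF assms(1)] Suc.IH 
        simp del: Ck_on.simps intro: Ck_on_pd Ck_on_Suc_imp\<close>)
  with Suc.prems show ?case by (auto intro: differentiable_on_mult)
qed

lemma Ck_on_diff: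
  assumes "open S" "Ck_on k S u" "Ck_on k S v"
  shows "Ck_on k S (\<lambda>x. u x - v x)"
  using Ck_on_add[OF assms(1,2) Ck_on_mult[OF assms(1) Ck_on_const[of k S "-1"] assms(3)]] by simp

lemma Ck_on_sum:
  assumes "open S" "\<And>a. a \<in> I \<Longrightarrow> Ck_on k S (u a)"
  shows "Ck_on k S (\<lambda>x. \<Sum>a\<in>I. u a x)"
  using assms(2)
  by (induction I rule: infinite_finite_induct) (auto intro: Ck_on_add[OF assms(1)])

lemma Ck_on_prod:
  assumes "open S" "\<And>a. a \<in> I \<Longrightarrow> Ck_on k S (u a)"
  shows "Ck_on k S (\<lambda>x. \<Prod>a\<in>I. u a x)"
  using assms(2)
  by (induction I rule: infinite_finite_induct) (auto intro: Ck_on_mult[OF assms(1)])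

text \<open>The derivative \<open>- (1/u)^2 * du\<close> contains \<open>1/u\<close> again but is
  needed at one order less, which closes the induction.\<close>

lemma Ck_on_inverse:
  assumes "open S" "Ck_on k S u" "\<And>x. x \<in> S \<Longrightarrow> u x \<noteq> 0"
  shows "Ck_on k S (\<lambda>x. inverse (u x))"
  using assms(2)
proof (induction k)
  case 0
  then show ?case using assms(3) by (auto intro: continuous_on_inverse)
next
  case (Suc k)
  have D: "((inverse :: real \<Rightarrow> real) has_real_derivative - (inverse (u x) * inverse (u x))) (at (u x))"
    if "x \<in> S" for x
    using DERIV_inverse[OF assms(3)[OF that], of UNIV] by (simp add: power2_eq_square numeral_2_eq_2)
  have "Ck_on k S (\<lambda>x. (0 - inverse (u x) * inverse (u x)) * pd i u x)" for i
    using Ck_on_pd[OF Suc.prems] Suc.IH[OF Ck_on_Suc_imp[OF Suc.prems]]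
    by (intro Ck_on_mult[OF assms(1)] Ck_on_diff[OF assms(1)]) simp_all
  then have "Ck_on k S (pd i (\<lambda>x. inverse (u x)))" for i
    by (subst Ck_on_cong[OF assms(1) pd_real_compose(1)
          [OF Ck_on_differentiable[OF Suc.prems assms(1)] D]]) simp_all
  moreover have "(\<lambda>x. inverse (u x)) differentiable_on S"
    using pd_real_compose(2)[OF Ck_on_differentiable[OF Suc.prems assms(1)] D]
    by (auto simp: differentiable_on_eq_differentiable_at[OF assms(1)])
  ultimately show ?case by simp
qed

lemma Ck_on_sqrt:
  assumes "open S" "Ck_on k S u" "\<And>x. x \<in> S \<Longrightarrow> u x > 0"
  shows "Ck_on k S (\<lambda>x. sqrt (u x))"
  using assms(2)
proof (induction k)
  case 0
  then show ?case by (auto intro: continuous_on_real_sqrt)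
next
  case (Suc k)
  have D: "(sqrt has_real_derivative inverse (sqrt (u x)) * (1 / 2)) (at (u x))"
    if "x \<in> S" for x
    using DERIV_real_sqrt[OF assms(3)[OF that]] by (simp add: field_simps)
  have "Ck_on k S (\<lambda>x. inverse (sqrt (u x)))"
    using Suc.IH[OF Ck_on_Suc_imp[OF Suc.prems]] assms(3)
    by (intro Ck_on_inverse[OF assms(1)]) (auto dest: order_less_imp_not_eq2)
  then have "Ck_on k S (\<lambda>x. inverse (sqrt (u x)) * (1 / 2) * pd i u x)" for i
    using Ck_on_pd[OF Suc.prems] by (intro Ck_on_mult[OF assms(1)]) simp_all
  then have "Ck_on k S (pd i (\<lambda>x. sqrt (u x)))" for i
    by (subst Ck_on_cong[OF assms(1) pd_real_compose(1)
          [OF Ck_on_differentiable[OF Suc.prems assms(1)] D]])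
  moreover have "(\<lambda>x. sqrt (u x)) differentiable_on S"
    using pd_real_compose(2)[OF Ck_on_differentiable[OF Suc.prems assms(1)] D]
    by (auto simp: differentiable_on_eq_differentiable_at[OF assms(1)])
  ultimately show ?case by simp
qed

text \<open>Serves to read a bump function of one chart in the coordinates of another.\<close>

lemma C1_on_compose:
  fixes \<phi> :: "real^'n \<Rightarrow> real^'m"
  assumes "open S" "open T" "Ck_on 1 T u" "\<And>k. Ck_on 1 S (\<lambda>x. \<phi> x $ k)" "\<And>x. x \<in> S \<Longrightarrow> \<phi> x \<in> T"
  shows "Ck_on 1 S (\<lambda>x. u (\<phi> x))"
proof -
  have d: "(\<lambda>x. \<phi> x $ k) differentiable (at x)" if "x \<in> S" for x k
    using assms(4)[of k] Ck_on_differentiable[of 0 S _ x] that assms(1) by (simp del: Ck_on.simps)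
  have du: "u differentiable (at (\<phi> x))" if "x \<in> S" for x
    using assms(3,5) Ck_on_differentiable[of 0 T u "\<phi> x"] that assms(2) by (simp del: Ck_on.simps)
  have c\<phi>: "continuous_on S \<phi>"
    using assms(4) Ck_on_continuous_on continuous_on_vec_lambda[of S "\<lambda>k x. \<phi> x $ k"] by fastforce
  have "continuous_on S (pd i (\<lambda>x. u (\<phi> x)))" for i
  proof -
    have "continuous_on S (\<lambda>x. pd k u (\<phi> x))" for k
      using assms(3,5) by (auto intro: continuous_on_compose2[OF _ c\<phi>])
    moreover have "continuous_on S (pd i (\<lambda>y. \<phi> y $ k))" for k
      using assms(4)[of k] by simp
    ultimately have "continuous_on S (\<lambda>x. \<Sum>k\<in>UNIV. pd i (\<lambda>y. \<phi> y $ k) x * pd k u (\<phi> x))"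
      by (intro continuous_intros) auto
    then show ?thesis
      using pd_chain(1)[OF d du] by (simp cong: continuous_on_cong)
  qed
  then show ?thesis
    using pd_chain(2)[OF d du] by (auto simp: differentiable_on_eq_differentiable_at[OF assms(1)])
qed

section \<open>Symmetry of second partial derivatives\<close>

text \<open>The mean value theorem is applied along axis \<open>i\<close> to the increment in
  direction \<open>j\<close>, and then along axis \<open>j\<close> to the partial derivative
  \<open>pd i u\<close>. The second difference on the left is symmetric in \<open>i\<close> and
  \<open>j\<close>, the right-hand side is not.\<close>

lemma second_difference_mean_value:
  assumes "open S" "Ck_on 2 S u" "h > 0" "cball x (2 * h) \<subseteq> S"
  shows "\<exists>\<xi>\<in>cball x (2 * h). u (x + h *\<^sub>R axis i 1 + h *\<^sub>R axis j 1) - u (x + h *\<^sub>R axis i 1)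
      - u (x + h *\<^sub>R axis j 1) + u x = h * h * pd j (pd i u) \<xi>"
proof -
  have C: "Ck_on (Suc (Suc 0)) S u" using assms(2) by (simp add: numeral_2_eq_2)
  have inb: "x + s *\<^sub>R axis i 1 + t *\<^sub>R axis j 1 \<in> cball x (2 * h)" if "0 \<le> s" "s \<le> h" "0 \<le> t" "t \<le> h" for s t
  proof -
    have "norm (s *\<^sub>R axis i (1::real) + t *\<^sub>R axis j 1) \<le> norm (s *\<^sub>R axis i (1::real)) + norm (t *\<^sub>R axis j (1::real))"
      by (rule norm_triangle_ineq)
    also have "\<dots> \<le> 2 * h" using that by (simp add: norm_axis_1)
    finally show ?thesis
      by (metis add.assoc dist_add_cancel dist_0_norm mem_cball add.right_neutral)
  qed
  have d0: "u differentiable (at y)" if "y \<in> S" for y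
    using Ck_on_differentiable[OF C assms(1) that] .
  have d1: "pd i u differentiable (at y)" if "y \<in> S" for y
    using Ck_on_differentiable[OF Ck_on_pd[OF C] assms(1) that] .
  define \<phi> where "\<phi> s = u ((x + h *\<^sub>R axis j 1) + s *\<^sub>R axis i 1) - u (x + s *\<^sub>R axis i 1)" for s
  have "\<exists>z. 0 < z \<and> z < h \<and> \<phi> h - \<phi> 0 = (h - 0) *
      (pd i u ((x + h *\<^sub>R axis j 1) + z *\<^sub>R axis i 1) - pd i u (x + z *\<^sub>R axis i 1))"
  proof (rule MVT2)
    fix z assume z: "0 \<le> z" "z \<le> h"
    have "(x + h *\<^sub>R axis j 1) + z *\<^sub>R axis i 1 \<in> S" "x + z *\<^sub>R axis i 1 \<in> S"
      using inb[of z h] inb[of z 0] z assms(3,4) by (auto simp: algebra_simps)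
    then show "(\<phi> has_real_derivative pd i u ((x + h *\<^sub>R axis j 1) + z *\<^sub>R axis i 1)
        - pd i u (x + z *\<^sub>R axis i 1)) (at z)"
      unfolding \<phi>_def by (intro DERIV_diff has_real_derivative_along_axis d0)
  qed (use assms(3) in auto)
  then obtain z where z: "0 < z" "z < h" "\<phi> h - \<phi> 0 = h *
      (pd i u ((x + h *\<^sub>R axis j 1) + z *\<^sub>R axis i 1) - pd i u (x + z *\<^sub>R axis i 1))"
    by auto
  define \<psi> where "\<psi> t = pd i u ((x + z *\<^sub>R axis i 1) + t *\<^sub>R axis j 1)" for t
  have "\<exists>w. 0 < w \<and> w < h \<and> \<psi> h - \<psi> 0 = (h - 0) *
      (pd j (pd i u) ((x + z *\<^sub>R axis i 1) + w *\<^sub>R axis j 1))"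
  proof (rule MVT2)
    fix t assume t: "0 \<le> t" "t \<le> h"
    have "(x + z *\<^sub>R axis i 1) + t *\<^sub>R axis j 1 \<in> S"
      using inb[of z t] t z assms(4) by auto
    then show "(\<psi> has_real_derivative
        pd j (pd i u) ((x + z *\<^sub>R axis i 1) + t *\<^sub>R axis j 1)) (at t)"
      unfolding \<psi>_def by (intro has_real_derivative_along_axis d1)
  qed (use assms(3) in auto)
  then obtain w where w: "0 < w" "w < h" "\<psi> h - \<psi> 0 = h *
      (pd j (pd i u) ((x + z *\<^sub>R axis i 1) + w *\<^sub>R axis j 1))"
    by auto
  have "\<phi> h - \<phi> 0 = h * (\<psi> h - \<psi> 0)"
    using z(3) by (simp add: \<psi>_def algebra_simps)
  then show ?thesis
    using w z inb[of z w] by (intro bexI[of _ "(x + z *\<^sub>R axis i 1) + w *\<^sub>R axis j 1"])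
      (auto simp: \<phi>_def algebra_simps)
qed

text \<open>One and the same second difference, evaluated in the two orders, yields nearby points
  \<open>\<eta>\<close> and \<open>\<xi>\<close> with \<open>a \<eta> = b \<xi>\<close>. Continuity
  of both derivatives then forbids a gap between \<open>a x\<close> and \<open>b x\<close>.\<close>

lemma pd_commute:
  assumes "open S" "Ck_on 2 S u" "x \<in> S"
  shows "pd i (pd j u) x = pd j (pd i u) x"
proof (rule ccontr)
  define a where "a = pd i (pd j u)"
  define b where "b = pd j (pd i u)"
  assume "\<not> ?thesis"
  then have ab: "a x \<noteq> b x" by (simp add: a_def b_def)
  have C: "Ck_on (Suc (Suc 0)) S u" using assms(2) by (simp add: numeral_2_eq_2)
  have "isCont a x" "isCont b x"
    using C assms(1,3) unfolding a_def b_def by (auto simp: continuous_on_eq_continuous_at)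
  then obtain d1 d2 where d: "d1 > 0" "\<And>y. dist y x < d1 \<Longrightarrow> dist (a y) (a x) < dist (a x) (b x) / 2"
      "d2 > 0" "\<And>y. dist y x < d2 \<Longrightarrow> dist (b y) (b x) < dist (a x) (b x) / 2"
    using ab unfolding continuous_at_eps_delta
    by (metis half_gt_zero zero_less_dist_iff)
  obtain e where e: "e > 0" "cball x e \<subseteq> S"
    using assms(1,3) open_contains_cball by blast
  \<comment> \<open>A quarter of the minimum, so that the closed ball of radius \<open>2 * h\<close>
    lies inside both continuity neighbourhoods with strict inequality.\<close>
  define h where "h = Min {d1, d2, e} / 4"
  have h: "h > 0" "2 * h < d1" "2 * h < d2" "2 * h \<le> e"
    using d(1,3) e(1) by (auto simp: h_def min_def)
  have sub: "cball x (2 * h) \<subseteq> S"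
    using e(2) h(4) by (meson order_trans subset_cball)
  obtain \<xi> where \<xi>: "\<xi> \<in> cball x (2 * h)" "u (x + h *\<^sub>R axis i 1 + h *\<^sub>R axis j 1) - u (x + h *\<^sub>R axis i 1)
      - u (x + h *\<^sub>R axis j 1) + u x = h * h * b \<xi>"
    using second_difference_mean_value[OF assms(1,2) h(1) sub, of i j] unfolding b_def by auto
  obtain \<eta> where \<eta>: "\<eta> \<in> cball x (2 * h)" "u (x + h *\<^sub>R axis j 1 + h *\<^sub>R axis i 1) - u (x + h *\<^sub>R axis j 1)
      - u (x + h *\<^sub>R axis i 1) + u x = h * h * a \<eta>"
    using second_difference_mean_value[OF assms(1,2) h(1) sub, of j i] unfolding a_def by auto
  have "h * h * a \<eta> = h * h * b \<xi>"
    using \<xi>(2) \<eta>(2) by (simp only: ac_simps add_diff_eq)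
  then have "a \<eta> = b \<xi>" using h(1) by auto
  moreover have "dist (a \<eta>) (a x) < dist (a x) (b x) / 2" "dist (b \<xi>) (b x) < dist (a x) (b x) / 2"
    using d \<xi>(1) \<eta>(1) h by (auto simp: dist_commute)
  ultimately show False
    using dist_triangle_half_r[of "a \<eta>" "a x" "dist (a x) (b x)" "b x"] by simp
qed

section \<open>Smooth functions and matrices\<close>

lemma smooth_on_cong:
  assumes "open S" "\<And>x. x \<in> S \<Longrightarrow> u x = v x"
  shows "smooth_on S u \<longleftrightarrow> smooth_on S v"
  using Ck_on_cong[OF assms] by (simp add: smooth_on_def)

lemma smooth_on_Ck_on: "smooth_on S u \<Longrightarrow> Ck_on k S u"
  by (simp add: smooth_on_def)

lemma smooth_on_const [simp]: "smooth_on S (\<lambda>_. c)"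
  by (simp add: smooth_on_def)

lemma smooth_on_add: "open S \<Longrightarrow> smooth_on S u \<Longrightarrow> smooth_on S v \<Longrightarrow> smooth_on S (\<lambda>x. u x + v x)"
  by (simp add: smooth_on_def Ck_on_add)

lemma smooth_on_diff: "open S \<Longrightarrow> smooth_on S u \<Longrightarrow> smooth_on S v \<Longrightarrow> smooth_on S (\<lambda>x. u x - v x)"
  by (simp add: smooth_on_def Ck_on_diff)

lemma smooth_on_mult: "open S \<Longrightarrow> smooth_on S u \<Longrightarrow> smooth_on S v \<Longrightarrow> smooth_on S (\<lambda>x. u x * v x)"
  by (simp add: smooth_on_def Ck_on_mult)

lemma smooth_on_sum:
  "open S \<Longrightarrow> (\<And>a. a \<in> I \<Longrightarrow> smooth_on S (u a)) \<Longrightarrow> smooth_on S (\<lambda>x. \<Sum>a\<in>I. u a x)"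
  by (simp add: smooth_on_def Ck_on_sum)

lemma smooth_on_prod:
  "open S \<Longrightarrow> (\<And>a. a \<in> I \<Longrightarrow> smooth_on S (u a)) \<Longrightarrow> smooth_on S (\<lambda>x. \<Prod>a\<in>I. u a x)"
  by (simp add: smooth_on_def Ck_on_prod)

lemma smooth_on_pd: "smooth_on S u \<Longrightarrow> smooth_on S (pd i u)"
  unfolding smooth_on_def using Ck_on_pd by blast

lemma smooth_on_differentiable: "smooth_on S u \<Longrightarrow> open S \<Longrightarrow> x \<in> S \<Longrightarrow> u differentiable (at x)"
  using Ck_on_differentiable smooth_on_Ck_on by blast

lemma smooth_on_continuous_on: "smooth_on S u \<Longrightarrow> continuous_on S u"
  using Ck_on_continuous_on smooth_on_Ck_on by blast

lemma smooth_on_divide: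
  "open S \<Longrightarrow> smooth_on S u \<Longrightarrow> smooth_on S v \<Longrightarrow> (\<And>x. x \<in> S \<Longrightarrow> v x \<noteq> 0) \<Longrightarrow> smooth_on S (\<lambda>x. u x / v x)"
  by (simp add: smooth_on_def Ck_on_mult Ck_on_inverse divide_inverse)

section \<open>Matrix algebra and matrix-valued functions\<close>

lemma matrix_add_rdistrib: "(A + B) ** C = A ** C + B ** (C :: 'a::semiring_1^'n^'m)"
  by (simp add: matrix_matrix_mult_def vec_eq_iff sum.distrib distrib_right)

lemma matrix_diff_ldistrib: "A ** (B - C) = A ** B - A ** (C :: 'a::ring_1^'n^'m)"
  by (simp add: matrix_matrix_mult_def vec_eq_iff sum_subtractf right_diff_distrib)

lemma matrix_diff_rdistrib: "(A - B) ** C = A ** C - B ** (C :: 'a::ring_1^'n^'m)"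
  by (simp add: matrix_matrix_mult_def vec_eq_iff sum_subtractf left_diff_distrib)

lemma matrix_minus_left: "(- A) ** C = - (A ** (C :: 'a::ring_1^'n^'m))"
  by (simp add: matrix_matrix_mult_def vec_eq_iff sum_negf)

lemma matrix_minus_right: "A ** (- C) = - (A ** (C :: 'a::ring_1^'n^'m))"
  by (simp add: matrix_matrix_mult_def vec_eq_iff sum_negf)

lemma matrix_zero_left: "0 ** C = (0 :: 'a::semiring_1^'n^'m)"
  by (simp add: matrix_matrix_mult_def vec_eq_iff)

lemma matrix_zero_right: "A ** 0 = (0 :: 'a::semiring_1^'n^'m)"
  by (simp add: matrix_matrix_mult_def vec_eq_iff)

text \<open>Products become nested to the right, so identities in the noncommutative matrix ring are
  decided by \<open>simp\<close>.\<close>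

lemmas matrix_ring_simps = matrix_add_ldistrib matrix_add_rdistrib matrix_diff_ldistrib
  matrix_diff_rdistrib matrix_minus_left matrix_minus_right matrix_zero_left matrix_zero_right
  matrix_mul_assoc[symmetric]

lemma transpose_add: "transpose (A + B) = transpose A + transpose B"
  by (simp add: transpose_def vec_eq_iff)

lemma transpose_diff: "transpose (A - B) = transpose A - transpose B"
  by (simp add: transpose_def vec_eq_iff)

lemma transpose_minus: "transpose (- A) = - transpose A"
  by (simp add: transpose_def vec_eq_iff)

lemma transpose_nth: "transpose A $ i $ j = A $ j $ i"
  by (simp add: transpose_def)

lemma matrix_mult_nth: "(A ** B) $ i $ j = (\<Sum>k\<in>UNIV. A $ i $ k * B $ k $ j)"
  by (simp add: matrix_matrix_mult_def)

text \<open>Treating connection and curvature as whole matrices turns their identities into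
  noncommutative algebra with a derivation.\<close>

definition mderiv :: "'n::finite \<Rightarrow> (real^'n \<Rightarrow> real^'a^'b) \<Rightarrow> real^'n \<Rightarrow> real^'a^'b" where
  "mderiv k F x = (\<chi> i j. pd k (\<lambda>y. F y $ i $ j) x)"

definition msmooth_on :: "(real^'n::finite) set \<Rightarrow> (real^'n \<Rightarrow> real^'a^'b) \<Rightarrow> bool" where
  "msmooth_on S F \<longleftrightarrow> (\<forall>i j. smooth_on S (\<lambda>y. F y $ i $ j))"

lemma mderiv_nth: "mderiv k F x $ i $ j = pd k (\<lambda>y. F y $ i $ j) x"
  by (simp add: mderiv_def)

lemma mderiv_cong:
  assumes "open S" "x \<in> S" "\<And>y. y \<in> S \<Longrightarrow> F y = H y"
  shows "mderiv k F x = mderiv k H x"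
  unfolding mderiv_def using assms by (intro Cart_lambda_cong pd_cong) auto

lemma mderiv_const [simp]: "mderiv k (\<lambda>_. A) x = 0"
  by (simp add: mderiv_def vec_eq_iff)

context
  fixes S :: "(real^'n::finite) set"
  assumes S: "open S"
begin

lemma msmooth_on_differentiable:
  "msmooth_on S F \<Longrightarrow> x \<in> S \<Longrightarrow> (\<lambda>y. F y $ i $ j) differentiable (at x)"
  unfolding msmooth_on_def using smooth_on_differentiable[OF _ S] by blast

lemma msmooth_on_add: "msmooth_on S F \<Longrightarrow> msmooth_on S H \<Longrightarrow> msmooth_on S (\<lambda>y. F y + H y)"
  by (simp add: msmooth_on_def smooth_on_add S)

lemma msmooth_on_diff: "msmooth_on S F \<Longrightarrow> msmooth_on S H \<Longrightarrow> msmooth_on S (\<lambda>y. F y - H y)"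
  by (simp add: msmooth_on_def smooth_on_diff S)

lemma msmooth_on_mult: "msmooth_on S F \<Longrightarrow> msmooth_on S H \<Longrightarrow> msmooth_on S (\<lambda>y. F y ** H y)"
  unfolding msmooth_on_def matrix_mult_nth by (intro allI smooth_on_sum smooth_on_mult S) auto

lemma msmooth_on_transpose: "msmooth_on S F \<Longrightarrow> msmooth_on S (\<lambda>y. transpose (F y))"
  by (simp add: msmooth_on_def transpose_nth)

lemma msmooth_on_mderiv: "msmooth_on S F \<Longrightarrow> msmooth_on S (mderiv k F)"
  by (simp add: msmooth_on_def mderiv_nth smooth_on_pd)

lemma mderiv_add:
  "msmooth_on S F \<Longrightarrow> msmooth_on S H \<Longrightarrow> x \<in> S \<Longrightarrow>
    mderiv k (\<lambda>y. F y + H y) x = mderiv k F x + mderiv k H x"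
  by (simp add: vec_eq_iff mderiv_nth pd_add msmooth_on_differentiable)

lemma mderiv_diff:
  "msmooth_on S F \<Longrightarrow> msmooth_on S H \<Longrightarrow> x \<in> S \<Longrightarrow>
    mderiv k (\<lambda>y. F y - H y) x = mderiv k F x - mderiv k H x"
  by (simp add: vec_eq_iff mderiv_nth pd_diff msmooth_on_differentiable)

lemma mderiv_mult:
  "msmooth_on S F \<Longrightarrow> msmooth_on S H \<Longrightarrow> x \<in> S \<Longrightarrow>
    mderiv k (\<lambda>y. F y ** H y) x = mderiv k F x ** H x + F x ** mderiv k H x"
  by (simp add: vec_eq_iff mderiv_nth matrix_mult_nth pd_sum pd_mult
      msmooth_on_differentiable sum.distrib)

lemma mderiv_transpose: "mderiv k (\<lambda>y. transpose (F y)) x = transpose (mderiv k F x)"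
  by (simp add: vec_eq_iff mderiv_nth transpose_nth)

lemma mderiv_commute:
  assumes "msmooth_on S F" "x \<in> S"
  shows "mderiv i (mderiv j F) x = mderiv j (mderiv i F) x"
proof -
  have "pd i (pd j (\<lambda>y. F y $ a $ b)) x = pd j (pd i (\<lambda>y. F y $ a $ b)) x" for a b
    using assms by (intro pd_commute[OF S]) (auto simp: msmooth_on_def intro: smooth_on_Ck_on)
  then show ?thesis by (simp add: vec_eq_iff mderiv_nth)
qed

lemma smooth_on_det: "msmooth_on S (F :: _ \<Rightarrow> real^'m^'m) \<Longrightarrow> smooth_on S (\<lambda>y. det (F y))"
  unfolding det_def msmooth_on_def
  by (intro smooth_on_sum smooth_on_mult smooth_on_prod S smooth_on_const) blast

end

section \<open>Inverse matrices and the derivative of a determinant\<close>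

lemma matrix_inv_eqI:
  fixes A :: "real^'n^'n"
  assumes "A ** B = mat 1"
  shows "matrix_inv A = B"
proof -
  have "A ** matrix_inv A = mat 1 \<and> matrix_inv A ** A = mat 1"
    unfolding matrix_inv_def by (rule someI[of _ B]) (use assms matrix_left_right_inverse in blast)
  then have "matrix_inv A = matrix_inv A ** (A ** B)" "matrix_inv A ** A = mat 1" using assms by auto
  then show ?thesis by (simp add: matrix_mul_assoc)
qed

lemma matrix_inv_mult:
  fixes A :: "real^'n^'n"
  assumes "invertible A"
  shows "A ** matrix_inv A = mat 1" "matrix_inv A ** A = mat 1"
  using assms matrix_inv_eqI matrix_left_right_inverse unfolding invertible_def by metis+

text \<open>Cramer's rule for the columns of the identity matrix. As quotients of determinants, the
  entries of the inverse are visibly smooth.\<close>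

lemma matrix_inv_nth:
  fixes A :: "real^'n^'n"
  assumes "invertible A"
  shows "matrix_inv A $ k $ l = det (\<chi> i j. if j = k then (if i = l then 1 else 0) else A $ i $ j) / det A"
proof -
  have "A *v column l (matrix_inv A) = axis l 1"
    using matrix_inv_mult(1)[OF assms]
    by (simp add: vec_eq_iff matrix_vector_mult_def matrix_mult_nth column_def axis_def mat_def)
  then have "column l (matrix_inv A) = (\<chi> k. det(\<chi> i j. if j=k then axis l 1 $i else A$i$j) / det A)"
    using cramer[of A] assms invertible_det_nz by blast
  then show ?thesis by (simp add: vec_eq_iff column_def axis_def cong: if_cong)
qed

lemma msmooth_on_matrix_inv:
  fixes F :: "real^'k::finite \<Rightarrow> real^'n^'n"
  assumes S: "open S" and F: "msmooth_on S F" and inv: "\<And>x. x \<in> S \<Longrightarrow> invertible (F x)"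
  shows "msmooth_on S (\<lambda>x. matrix_inv (F x))"
  unfolding msmooth_on_def
proof (intro allI)
  fix k l
  have "msmooth_on S (\<lambda>x. \<chi> i j. if j = k then (if i = l then 1 else 0) else F x $ i $ j)"
  proof -
    have "smooth_on S (\<lambda>x. if j = k then (if i = l then 1 else 0) else F x $ i $ j)" for i j
      using F by (cases "j = k"; cases "i = l") (auto simp: msmooth_on_def)
    then show ?thesis by (simp add: msmooth_on_def)
  qed
  then have "smooth_on S (\<lambda>x. det (\<chi> i j. if j = k then (if i = l then 1 else 0) else F x $ i $ j) / det (F x))"
    using inv by (intro smooth_on_divide S smooth_on_det F) (auto simp: invertible_det_nz)
  then show "smooth_on S (\<lambda>x. matrix_inv (F x) $ k $ l)"
    by (subst smooth_on_cong[OF S matrix_inv_nth[OF inv]])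
qed

lemma det_replace_row:
  fixes A :: "real^'n^'n"
  shows "det (\<chi> a. if a = i then A $ l else A $ a) = (if l = i then det A else 0)"
proof (cases "l = i")
  case True
  then have "(\<chi> a. if a = i then A $ l else A $ a) = A" by (simp add: vec_eq_iff)
  with True show ?thesis by simp
next
  case False
  then show ?thesis using det_identical_rows[of i l "\<chi> a. if a = i then A $ l else A $ a"]
    by (simp add: row_def)
qed

text \<open>Jacobi's formula. The Leibniz expansion yields a sum of determinants with one row
  differentiated. Since the derivative is \<open>B ** F x\<close>, that row is a combination of the
  rows of \<open>F x\<close>; repeated rows kill everything except the diagonal coefficient of
  \<open>B\<close>.\<close>

lemma pd_det:
  fixes F :: "real^'k::finite \<Rightarrow> real^'n^'n"
  assumes diff: "\<And>i j. (\<lambda>y. F y $ i $ j) differentiable (at x)" and inv: "invertible (F x)"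
  shows "pd k (\<lambda>y. det (F y)) x = det (F x) * trace (mderiv k F x ** matrix_inv (F x))"
proof -
  let ?D = "\<lambda>i j. frechet_derivative (\<lambda>y. F y $ i $ j) (at x)"
  define B where "B = mderiv k F x ** matrix_inv (F x)"
  have B: "B ** F x = mderiv k F x"
    by (simp add: B_def matrix_mul_assoc[symmetric] matrix_inv_mult[OF inv])
  have D: "((\<lambda>y. F y $ i $ j) has_derivative ?D i j) (at x)" for i j
    using diff frechet_derivative_works by blast
  have "((\<lambda>y. det (F y)) has_derivative (\<lambda>h. \<Sum>p | p permutes (UNIV::'n set). of_int (sign p) *
      (\<Sum>i\<in>UNIV. ?D i (p i) h * (\<Prod>j\<in>UNIV - {i}. F x $ j $ p j)))) (at x)"
    unfolding det_def by (intro derivative_intros D)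
  then have "pd k (\<lambda>y. det (F y)) x = (\<Sum>p | p permutes (UNIV::'n set). of_int (sign p) *
      (\<Sum>i\<in>UNIV. mderiv k F x $ i $ p i * (\<Prod>j\<in>UNIV - {i}. F x $ j $ p j)))"
    by (subst pd_eqI, assumption) (simp add: mderiv_nth pderiv_coord_def)
  also have "\<dots> = (\<Sum>i\<in>UNIV. \<Sum>p | p permutes (UNIV::'n set). of_int (sign p) *
      (mderiv k F x $ i $ p i * (\<Prod>j\<in>UNIV - {i}. F x $ j $ p j)))"
    unfolding sum_distrib_left by (rule sum.swap)
  also have "\<dots> = (\<Sum>i\<in>UNIV. det (\<chi> a. if a = i then mderiv k F x $ i else F x $ a))"
  proof (rule sum.cong[OF refl])
    fix i :: 'n
    have "(\<Prod>j\<in>UNIV. (\<chi> a. if a = i then mderiv k F x $ i else F x $ a) $ j $ p j) =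
        mderiv k F x $ i $ p i * (\<Prod>j\<in>UNIV - {i}. F x $ j $ p j)" for p
    proof -
      have "(\<Prod>j\<in>UNIV - {i}. (\<chi> a. if a = i then mderiv k F x $ i else F x $ a) $ j $ p j) =
          (\<Prod>j\<in>UNIV - {i}. F x $ j $ p j)"
        by (rule prod.cong) auto
      then show ?thesis by (subst prod.remove[of _ i]) simp_all
    qed
    then show "(\<Sum>p | p permutes (UNIV::'n set). of_int (sign p) *
      (mderiv k F x $ i $ p i * (\<Prod>j\<in>UNIV - {i}. F x $ j $ p j))) =
      det (\<chi> a. if a = i then mderiv k F x $ i else F x $ a)"
      unfolding det_def by presburger
  qed
  also have "\<dots> = (\<Sum>i\<in>UNIV. B $ i $ i * det (F x))"
  proof (rule sum.cong[OF refl])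
    fix i :: 'n
    have "mderiv k F x $ i = (\<Sum>l\<in>UNIV. B $ i $ l *s F x $ l)"
      unfolding B[symmetric] by (simp add: vec_eq_iff matrix_mult_nth)
    then have "det (\<chi> a. if a = i then mderiv k F x $ i else F x $ a) =
        (\<Sum>l\<in>UNIV. B $ i $ l * det (\<chi> a. if a = i then F x $ l else F x $ a))"
      using det_linear_row_sum[of UNIV i "\<lambda>_ l. B $ i $ l *s F x $ l" "\<lambda>a. F x $ a"]
      by (simp add: det_row_mul cong: if_cong)
    also have "\<dots> = B $ i $ i * det (F x)"
      by (simp add: det_replace_row if_distrib cong: if_cong)
    finally show "det (\<chi> a. if a = i then mderiv k F x $ i else F x $ a) = B $ i $ i * det (F x)" .
  qed
  finally show ?thesis
    by (simp add: B_def[symmetric] trace_def sum_distrib_left mult.commute)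
qed


section \<open>Positive definite matrices\<close>

definition posdef :: "real^'n^'n \<Rightarrow> bool" where
  "posdef A \<longleftrightarrow> transpose A = A \<and> (\<forall>v. v \<noteq> 0 \<longrightarrow> v \<bullet> (A *v v) > 0)"

lemma posdef_invertible:
  assumes "posdef A"
  shows "invertible A"
proof -
  have "\<forall>v. A *v v = 0 \<longrightarrow> v = 0"
    using assms unfolding posdef_def by fastforce
  then show ?thesis
    using matrix_left_invertible_ker invertible_left_inverse by blast
qed

lemma posdef_symmetric: "posdef A \<Longrightarrow> A $ i $ j = A $ j $ i"
  unfolding posdef_def by (metis transpose_nth)

lemma transpose_matrix_inv:
  fixes A :: "real^'n^'n"
  assumes "invertible A"
  shows "transpose (matrix_inv A) = matrix_inv (transpose A)"
  using matrix_inv_eqI[of "transpose A" "transpose (matrix_inv A)"] matrix_inv_mult(2)[OF assms]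
  by (metis matrix_transpose_mul transpose_mat)

lemma posdef_matrix_inv:
  assumes "posdef A"
  shows "posdef (matrix_inv A)"
proof -
  note inv = posdef_invertible[OF assms]
  have sym: "transpose A = A" using assms by (simp add: posdef_def)
  have sym': "transpose (matrix_inv A) = matrix_inv A"
    using transpose_matrix_inv[OF inv] sym by simp
  have "v \<bullet> (matrix_inv A *v v) > 0" if "v \<noteq> 0" for v
  proof -
    define w where "w = matrix_inv A *v v"
    have v: "v = A *v w"
      by (simp add: w_def matrix_vector_mul_assoc matrix_inv_mult[OF inv])
    then have "w \<noteq> 0" using that by auto
    then have "w \<bullet> (A *v w) > 0" using assms by (simp add: posdef_def)
    moreover have "v \<bullet> (matrix_inv A *v v) = w \<bullet> (A *v w)"
      using v w_def by (metis inner_commute)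
    ultimately show ?thesis by simp
  qed
  with sym' show ?thesis by (simp add: posdef_def)
qed

text \<open>The segment from the identity to \<open>A\<close> consists of positive definite, hence
  invertible, matrices, so the determinant cannot pass through zero on the way from 1.\<close>

lemma posdef_det_pos:
  fixes A :: "real^'n^'n"
  assumes "posdef A"
  shows "det A > 0"
proof (rule ccontr)
  assume "\<not> det A > 0"
  let ?B = "\<lambda>t::real. (1 - t) *\<^sub>R mat 1 + t *\<^sub>R A"
  have pd: "posdef (?B t)" if "0 \<le> t" "t \<le> 1" for t
  proof -
    have "v \<bullet> (?B t *v v) > 0" if v: "v \<noteq> 0" for v
    proof -
      have "v \<bullet> (?B t *v v) = (1 - t) * (v \<bullet> v) + t * (v \<bullet> (A *v v))"
        by (simp add: matrix_vector_mult_add_rdistrib inner_right_distrib scaleR_matrix_vector_assoc[symmetric])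
      moreover have "v \<bullet> v > 0" "v \<bullet> (A *v v) > 0" using v assms by (auto simp: posdef_def)
      moreover have "t > 0 \<or> 1 - t > 0" by linarith
      ultimately show ?thesis using \<open>0 \<le> t\<close> \<open>t \<le> 1\<close>
        by (metis add_nonneg_pos add_pos_nonneg diff_ge_0_iff_ge mult_nonneg_nonneg mult_pos_pos order_less_imp_le)
    qed
    moreover have "transpose (?B t) = ?B t"
      using assms by (simp add: posdef_def transpose_add transpose_scalar)
    ultimately show ?thesis by (simp add: posdef_def)
  qed
  have "continuous_on {0..1} (\<lambda>t. det (?B t))"
    unfolding det_def by (intro continuous_intros)
  moreover have "det (?B 1) \<le> 0" "0 \<le> det (?B 0)" using \<open>\<not> det A > 0\<close> by auto
  ultimately obtain t where "0 \<le> t" "t \<le> 1" "det (?B t) = 0"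
    using IVT2'[of "\<lambda>t. det (?B t)" 1 0 0] by auto
  then show False using posdef_invertible[OF pd] invertible_det_nz by blast
qed

lemma symmetric_quadratic_sum_remove:
  fixes a :: "'n \<Rightarrow> 'n \<Rightarrow> real"
  assumes "finite I" "p \<notin> I" "\<And>i. a i p = a p i"
  shows "(\<Sum>i\<in>insert p I. \<Sum>j\<in>insert p I. a i j * v i * v j) =
      a p p * v p * v p + 2 * v p * (\<Sum>i\<in>I. a p i * v i) + (\<Sum>i\<in>I. \<Sum>j\<in>I. a i j * v i * v j)"
proof -
  have "(\<Sum>i\<in>insert p I. \<Sum>j\<in>insert p I. a i j * v i * v j) = a p p * v p * v p
      + (\<Sum>j\<in>I. a p j * v p * v j) + ((\<Sum>i\<in>I. a i p * v i * v p) + (\<Sum>i\<in>I. \<Sum>j\<in>I. a i j * v i * v j))"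
    using assms(1,2) by (simp add: sum.distrib)
  moreover have "(\<Sum>j\<in>I. a p j * v p * v j) = v p * (\<Sum>i\<in>I. a p i * v i)"
    unfolding sum_distrib_left by (intro sum.cong refl) simp
  moreover have "(\<Sum>i\<in>I. a i p * v i * v p) = v p * (\<Sum>i\<in>I. a p i * v i)"
    unfolding sum_distrib_left by (intro sum.cong refl) (simp add: assms(3))
  ultimately show ?thesis by simp
qed

text \<open>Cholesky factorization by completing the square in one variable after another. Forms are
  indexed by a finite set instead of a type because the induction removes an index.\<close>

lemma positive_form_sum_of_squares:
  fixes a :: "'n \<Rightarrow> 'n \<Rightarrow> real"
  assumes "finite I" "\<And>i j. a i j = a j i"
    and "\<And>v. \<exists>i\<in>I. v i \<noteq> 0 \<Longrightarrow> (\<Sum>i\<in>I. \<Sum>j\<in>I. a i j * v i * v j) > 0"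
  shows "\<exists>(b :: 'n \<Rightarrow> 'n \<Rightarrow> real). \<forall>i\<in>I. \<forall>j\<in>I. a i j = (\<Sum>p\<in>I. b p i * b p j)"
  using assms
proof (induction I arbitrary: a rule: finite_induct)
  case empty
  then show ?case by simp
next
  case (insert p I)
  note rem = symmetric_quadratic_sum_remove[of I p a, OF insert.hyps(1,2) insert.prems(1)]
  have app: "a p p > 0"
  proof -
    have "(\<Sum>i\<in>I. a p i * (if i = p then 1 else 0)) = 0"
      "(\<Sum>i\<in>I. \<Sum>j\<in>I. a i j * (if i = p then 1 else 0) * (if j = p then 1 else 0)) = 0"
      using insert.hyps(2) by (auto intro!: sum.neutral)
    then show ?thesis
      using insert.prems(2)[of "\<lambda>i. if i = p then 1 else 0"] rem[of "\<lambda>i. if i = p then 1 else 0"] by simp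
  qed
  \<comment> \<open>\<open>b\<close> is the first row of the Cholesky factor; \<open>a'\<close>
    below is the Schur complement of the entry \<open>a p p\<close>.\<close>
  define b where "b i = a p i / sqrt (a p p)" for i
  have bb: "b i * b j = a p i * a p j / a p p" for i j
    using app by (simp add: b_def)
  define a' where "a' i j = a i j - b i * b j" for i j
  have "\<exists>c :: 'n \<Rightarrow> 'n \<Rightarrow> real. \<forall>i\<in>I. \<forall>j\<in>I. a' i j = (\<Sum>q\<in>I. c q i * c q j)"
  proof (rule insert.IH)
    show "a' i j = a' j i" for i j
      using insert.prems(1)[of i j] by (simp add: a'_def mult.commute)
    fix v :: "'n \<Rightarrow> real" assume v: "\<exists>i\<in>I. v i \<noteq> 0"
    define s where "s = (\<Sum>i\<in>I. a p i * v i)"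
    \<comment> \<open>The value at \<open>p\<close> minimises the form in that variable, and the
      minimum is the form of the Schur complement at \<open>v\<close>. This transfers positivity
      from \<open>a\<close> to \<open>a'\<close>.\<close>
    define w where "w = v(p := - s / a p p)"
    have wv: "w i = v i" if "i \<in> I" for i using that insert.hyps(2) by (auto simp: w_def)
    have "(\<Sum>i\<in>I. \<Sum>j\<in>I. a' i j * v i * v j) =
        (\<Sum>i\<in>I. \<Sum>j\<in>I. a i j * v i * v j) - (\<Sum>i\<in>I. \<Sum>j\<in>I. (a p i * v i) * (a p j * v j)) / a p p"
      unfolding a'_def bb sum_divide_distrib sum_subtractf[symmetric]
      by (intro sum.cong refl) (simp add: algebra_simps)
    also have "\<dots> = (\<Sum>i\<in>I. \<Sum>j\<in>I. a i j * v i * v j) - s * s / a p p"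
      by (simp add: s_def sum_product)
    also have "\<dots> = (\<Sum>i\<in>insert p I. \<Sum>j\<in>insert p I. a i j * w i * w j)"
      using app wv by (simp add: rem s_def[symmetric] w_def[THEN fun_cong, of p] cong: sum.cong)
    also have "\<dots> > 0"
      using v wv by (intro insert.prems(2)) auto
    finally show "(\<Sum>i\<in>I. \<Sum>j\<in>I. a' i j * v i * v j) > 0" .
  qed
  then obtain c where c: "\<And>i j. i \<in> I \<Longrightarrow> j \<in> I \<Longrightarrow> a' i j = (\<Sum>q\<in>I. c q i * c q j)" by blast
  \<comment> \<open>The zero at \<open>i = p\<close> is the triangular shape of the factor: only the
    row \<open>b\<close> involves the variable \<open>p\<close>.\<close>
  define d where "d q i = (if q = p then b i else if i = p then 0 else c q i)" for q i
  have dp: "(\<Sum>q\<in>I. d q i * d q j) = (if i = p \<or> j = p then 0 else (\<Sum>q\<in>I. c q i * c q j))" for i j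
    using insert.hyps(2) by (auto simp: d_def intro!: sum.neutral sum.cong)
  have "a i j = (\<Sum>q\<in>insert p I. d q i * d q j)" if "i \<in> insert p I" "j \<in> insert p I" for i j
  proof -
    have "(\<Sum>q\<in>insert p I. d q i * d q j) = b i * b j + (\<Sum>q\<in>I. d q i * d q j)"
      using insert.hyps by (simp add: d_def)
    also have "\<dots> = a i j"
    proof (cases "i = p \<or> j = p")
      case True
      then show ?thesis using app insert.prems(1)[of i p] by (auto simp: dp bb)
    next
      case False
      then show ?thesis using that c[of i j] by (simp add: dp a'_def)
    qed
    finally show ?thesis by simp
  qed
  then show ?case by blast
qed

lemma posdef_factorization:
  fixes A :: "real^'n^'n"
  assumes "posdef A"
  obtains B :: "real^'n^'n" where "A = transpose B ** B"
proof -
  have "\<exists>b :: 'n \<Rightarrow> 'n \<Rightarrow> real. \<forall>i\<in>UNIV. \<forall>j\<in>UNIV. A $ i $ j = (\<Sum>p\<in>UNIV. b p i * b p j)"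
  proof (rule positive_form_sum_of_squares[of UNIV "\<lambda>i j. A $ i $ j"])
    fix v :: "'n \<Rightarrow> real" assume "\<exists>i\<in>UNIV. v i \<noteq> 0"
    then have "(\<chi> i. v i) \<noteq> 0" by (simp add: vec_eq_iff)
    then have "(\<chi> i. v i) \<bullet> (A *v (\<chi> i. v i)) > 0" using assms by (simp add: posdef_def)
    then show "(\<Sum>i\<in>UNIV. \<Sum>j\<in>UNIV. A $ i $ j * v i * v j) > 0"
      by (simp add: inner_vec_def matrix_vector_mult_def sum_distrib_left ac_simps)
  qed (use posdef_symmetric[OF assms] in auto)
  then obtain b :: "'n \<Rightarrow> 'n \<Rightarrow> real" where "\<And>i j. A $ i $ j = (\<Sum>p\<in>UNIV. b p i * b p j)" by auto
  then have "A = transpose (\<chi> p i. b p i) ** (\<chi> p i. b p i)"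
    by (simp add: vec_eq_iff matrix_mult_nth transpose_nth)
  then show thesis by (rule that)
qed

text \<open>For \<open>H = g^{-1}\<close> this is |T|^2 without indices: the two factors
  \<open>H\<close> raise the two indices of one copy of \<open>T\<close>.\<close>

definition frob2 :: "real^'n^'n \<Rightarrow> real^'n^'n \<Rightarrow> real" where
  "frob2 H T = trace (transpose T ** H ** T ** H)"

lemma frob2_sum:
  fixes H T :: "real^'n^'n"
  assumes "transpose H = H"
  shows "frob2 H T = (\<Sum>i\<in>UNIV. \<Sum>j\<in>UNIV. \<Sum>k\<in>UNIV. \<Sum>l\<in>UNIV. H $ i $ k * H $ j $ l * T $ i $ j * T $ k $ l)"
proof -
  have H: "H $ i $ j = H $ j $ i" for i j using assms by (metis transpose_nth)
  have "frob2 H T = (\<Sum>j\<in>UNIV. \<Sum>i\<in>UNIV. \<Sum>k\<in>UNIV. \<Sum>l\<in>UNIV. T $ i $ j * (H $ i $ k * (T $ k $ l * H $ l $ j)))"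
    by (simp add: frob2_def trace_def matrix_mul_assoc[symmetric] matrix_mult_nth[of "transpose T"]
      matrix_mult_nth[of H] matrix_mult_nth[of T] transpose_nth sum_distrib_left)
  also have "\<dots> = (\<Sum>i\<in>UNIV. \<Sum>j\<in>UNIV. \<Sum>k\<in>UNIV. \<Sum>l\<in>UNIV. T $ i $ j * (H $ i $ k * (T $ k $ l * H $ l $ j)))"
    by (rule sum.swap)
  also have "\<dots> = (\<Sum>i\<in>UNIV. \<Sum>j\<in>UNIV. \<Sum>k\<in>UNIV. \<Sum>l\<in>UNIV. H $ i $ k * H $ j $ l * T $ i $ j * T $ k $ l)"
    by (intro sum.cong refl) (simp add: H[of _ j for j] mult.commute mult.left_commute)
  finally show ?thesis .
qed

text \<open>Factor \<open>H = B^t B\<close>, which amounts to passing to an orthonormal frame. By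
  cyclicity of the trace the value is the sum of the squared entries of \<open>B T B^t\<close>.
  Without this sign the square of \<open>tensor_norm\<close> could not be identified with
  \<open>frob2\<close>.\<close>

lemma frob2_nonneg:
  fixes H T :: "real^'n^'n"
  assumes "posdef H"
  shows "frob2 H T \<ge> 0"
proof -
  obtain B :: "real^'n^'n" where B: "H = transpose B ** B"
    using posdef_factorization[OF assms] by blast
  let ?E = "B ** T ** transpose B"
  have "frob2 H T = trace ((transpose T ** transpose B ** B ** T ** transpose B) ** B)"
    by (simp add: frob2_def B matrix_mul_assoc)
  also have "\<dots> = trace (B ** (transpose T ** transpose B ** B ** T ** transpose B))"
    by (rule trace_mul_sym)
  also have "\<dots> = trace (transpose ?E ** ?E)"
    by (simp add: matrix_transpose_mul matrix_mul_assoc)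
  also have "\<dots> = (\<Sum>i\<in>UNIV. \<Sum>k\<in>UNIV. ?E $ k $ i * ?E $ k $ i)"
    by (simp add: trace_def matrix_mult_nth[of "transpose ?E"] transpose_nth)
  also have "\<dots> \<ge> 0" by (intro sum_nonneg) auto
  finally show ?thesis .
qed

section \<open>Riemannian geometry in coordinates\<close>

definition dvec :: "(real^'n::finite \<Rightarrow> real) \<Rightarrow> real^'n \<Rightarrow> real^'n" where
  "dvec u x = (\<chi> i. pd i u x)"

text \<open>\<open>lchris G k x\<close> is the connection matrix \<open>(\<Gamma>\<^sup>l\<^sub>k\<^sub>m)\<close> with row index \<open>l\<close> and column index \<open>m\<close>.\<close>

definition lchris :: "(real^'n::finite \<Rightarrow> real^'n^'n) \<Rightarrow> 'n \<Rightarrow> real^'n \<Rightarrow> real^'n^'n" where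
  "lchris G k x = (\<chi> l m. 1 / 2 * (\<Sum>a\<in>UNIV. matrix_inv (G x) $ l $ a *
     (pd k (\<lambda>y. G y $ m $ a) x + pd m (\<lambda>y. G y $ k $ a) x
      - pd a (\<lambda>y. G y $ k $ m) x)))"

text \<open>The curvature form \<open>d\<Gamma> + \<Gamma> \<and> \<Gamma>\<close> of the connection
  matrices, evaluated on the coordinate fields \<open>i\<close> and \<open>j\<close>.\<close>

definition lriem :: "(real^'n::finite \<Rightarrow> real^'n^'n) \<Rightarrow> 'n \<Rightarrow> 'n \<Rightarrow> real^'n \<Rightarrow> real^'n^'n" where
  "lriem G i j x = mderiv i (lchris G j) x - mderiv j (lchris G i) x
     + lchris G i x ** lchris G j x - lchris G j x ** lchris G i x"

definition lric :: "(real^'n::finite \<Rightarrow> real^'n^'n) \<Rightarrow> real^'n \<Rightarrow> real^'n^'n" where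
  "lric G x = (\<chi> j k. \<Sum>i\<in>UNIV. lriem G i j x $ i $ k)"

definition lscal :: "(real^'n::finite \<Rightarrow> real^'n^'n) \<Rightarrow> real^'n \<Rightarrow> real" where
  "lscal G x = (\<Sum>i\<in>UNIV. \<Sum>j\<in>UNIV. matrix_inv (G x) $ i $ j * lric G x $ i $ j)"

definition lhess :: "(real^'n::finite \<Rightarrow> real^'n^'n) \<Rightarrow> (real^'n \<Rightarrow> real) \<Rightarrow> real^'n \<Rightarrow> real^'n^'n" where
  "lhess G F x = (\<chi> i j. pd i (pd j F) x
     - (\<Sum>k\<in>UNIV. lchris G i x $ k $ j * pd k F x))"

lemma antisymmetric_sum_eq_0:
  fixes f :: "'a::finite \<Rightarrow> 'a \<Rightarrow> real"
  assumes "\<And>i j. f i j = - f j i"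
  shows "(\<Sum>i\<in>UNIV. \<Sum>j\<in>UNIV. f i j) = 0"
proof -
  have "(\<Sum>i\<in>UNIV. \<Sum>j\<in>UNIV. f i j) = (\<Sum>j\<in>UNIV. \<Sum>i\<in>UNIV. f i j)" by (rule sum.swap)
  also have "\<dots> = (\<Sum>j\<in>UNIV. \<Sum>i\<in>UNIV. - f j i)"
    by (intro sum.cong refl assms)
  also have "\<dots> = - (\<Sum>j\<in>UNIV. \<Sum>i\<in>UNIV. f j i)"
    by (simp add: sum_negf)
  finally show ?thesis by simp
qed

text \<open>The stage for all curvature computations: the coordinate expression of a metric in one
  chart.\<close>

locale local_metric =
  fixes U :: "(real^'n::finite) set" and G :: "real^'n \<Rightarrow> real^'n^'n"
  assumes open_U: "open U" and G_smooth: "msmooth_on U G" and G_posdef: "\<And>x. x \<in> U \<Longrightarrow> posdef (G x)"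
begin

abbreviation "Gi \<equiv> \<lambda>x. matrix_inv (G x)"
abbreviation "\<Gamma> \<equiv> lchris G"
abbreviation "Rm \<equiv> lriem G"

lemmas ms_intros = msmooth_on_add[OF open_U] msmooth_on_diff[OF open_U] msmooth_on_mult[OF open_U]
  msmooth_on_transpose[OF open_U] msmooth_on_mderiv[OF open_U]

lemmas md_simps = mderiv_add[OF open_U] mderiv_diff[OF open_U] mderiv_mult[OF open_U]
  mderiv_transpose[OF open_U]

lemma G_inverse:
  assumes "x \<in> U"
  shows "G x ** Gi x = mat 1" "Gi x ** G x = mat 1"
  using matrix_inv_mult[OF posdef_invertible[OF G_posdef[OF assms]]] .

lemma Gi_smooth: "msmooth_on U Gi"
  by (intro msmooth_on_matrix_inv open_U G_smooth posdef_invertible G_posdef)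

lemma Gi_posdef: "x \<in> U \<Longrightarrow> posdef (Gi x)"
  by (intro posdef_matrix_inv G_posdef)

lemma Gi_transpose: "x \<in> U \<Longrightarrow> transpose (Gi x) = Gi x"
  using Gi_posdef by (auto simp: posdef_def)

lemma G_transpose: "x \<in> U \<Longrightarrow> transpose (G x) = G x"
  using G_posdef by (auto simp: posdef_def)

lemma pderiv_G_symmetric: "x \<in> U \<Longrightarrow> pd k (\<lambda>y. G y $ i $ j) x = pd k (\<lambda>y. G y $ j $ i) x"
  by (rule pd_cong[OF open_U]) (auto intro: posdef_symmetric G_posdef)

lemma chris_smooth: "msmooth_on U (\<Gamma> k)"
  unfolding msmooth_on_def lchris_def vec_lambda_beta
  using Gi_smooth G_smooth
  by (intro allI smooth_on_mult smooth_on_sum smooth_on_add smooth_on_diff smooth_on_pd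
      smooth_on_const open_U) (auto simp: msmooth_on_def)

lemma Rm_smooth: "msmooth_on U (Rm i j)"
  unfolding lriem_def by (intro ms_intros chris_smooth)

text \<open>Torsion-freeness: exchanging the lower indices exchanges two summands of the Koszul
  formula.\<close>

lemma chris_symmetric:
  assumes "x \<in> U"
  shows "\<Gamma> k x $ l $ m = \<Gamma> m x $ l $ k"
  unfolding lchris_def
  by (simp add: pderiv_G_symmetric[OF assms, of _ k m] add.commute)

text \<open>With the upper index lowered the inverse metric disappears; both metric compatibility
  and the transformation law under coordinate changes start from this form.\<close>

lemma chris_lowered:
  assumes "x \<in> U"
  shows "(G x ** \<Gamma> k x) $ a $ b = 1 / 2 * (pd k (\<lambda>y. G y $ b $ a) x
     + pd b (\<lambda>y. G y $ k $ a) x - pd a (\<lambda>y. G y $ k $ b) x)"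
proof -
  define E where "E = (\<chi> c b. 1 / 2 * (pd k (\<lambda>y. G y $ b $ c) x
     + pd b (\<lambda>y. G y $ k $ c) x - pd c (\<lambda>y. G y $ k $ b) x))"
  have "\<Gamma> k x = Gi x ** E"
    by (simp add: lchris_def E_def vec_eq_iff matrix_mult_nth sum_distrib_left algebra_simps)
  then have "G x ** \<Gamma> k x = E"
    by (simp add: matrix_mul_assoc G_inverse[OF assms])
  then show ?thesis by (simp add: E_def)
qed

text \<open>Metric compatibility, \<open>\<nabla>g = 0\<close>, as a matrix equation. In the sum of
  two lowered Christoffel symbols all derivatives but the wanted one cancel.\<close>

lemma mderiv_G:
  assumes "x \<in> U"
  shows "mderiv k G x = transpose (\<Gamma> k x) ** G x + G x ** \<Gamma> k x"
proof -
  have "transpose (\<Gamma> k x) ** G x = transpose (G x ** \<Gamma> k x)"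
    by (simp add: matrix_transpose_mul G_transpose[OF assms])
  moreover have "mderiv k G x $ a $ b = (G x ** \<Gamma> k x) $ b $ a + (G x ** \<Gamma> k x) $ a $ b" for a b
    unfolding chris_lowered[OF assms] mderiv_nth
    using pderiv_G_symmetric[OF assms, of k a b] by (simp add: field_simps)
  ultimately show ?thesis
    by (simp add: vec_eq_iff transpose_nth)
qed

text \<open>Differentiating \<open>G G^{-1} = 1\<close> turns \<open>\<nabla>g = 0\<close> into
  \<open>\<nabla>g^{-1} = 0\<close>; both indices are now upper, hence the opposite sign.\<close>

lemma mderiv_Gi:
  assumes "x \<in> U"
  shows "mderiv k Gi x = - (\<Gamma> k x ** Gi x + Gi x ** transpose (\<Gamma> k x))"
proof -
  note inv = G_inverse[OF assms]
  have "mderiv k G x ** Gi x + G x ** mderiv k Gi x = mderiv k (\<lambda>y. G y ** Gi y) x"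
    by (simp add: md_simps G_smooth Gi_smooth assms)
  also have "\<dots> = mderiv k (\<lambda>y. mat 1) x"
    by (rule mderiv_cong[OF open_U assms]) (rule G_inverse)
  finally have "Gi x ** (mderiv k G x ** Gi x + G x ** mderiv k Gi x) = 0"
    by (simp add: matrix_zero_right)
  then have "mderiv k Gi x = - (Gi x ** mderiv k G x ** Gi x)"
    by (simp add: matrix_add_ldistrib matrix_mul_assoc inv add_eq_0_iff)
  also have "Gi x ** mderiv k G x ** Gi x = Gi x ** transpose (\<Gamma> k x) ** (G x ** Gi x) + (Gi x ** G x) ** \<Gamma> k x ** Gi x"
    by (simp add: mderiv_G[OF assms] matrix_ring_simps)
  finally show ?thesis by (simp add: inv add.commute)
qed

lemma mderiv_minus:
  assumes "msmooth_on U F" "x \<in> U"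
  shows "mderiv k (\<lambda>y. - F y) x = - mderiv k F x"
proof -
  have "msmooth_on U (\<lambda>y. 0)" by (simp add: msmooth_on_def)
  then show ?thesis using mderiv_diff[OF open_U _ assms(1), of "\<lambda>y. 0" x k] assms(2) by simp
qed

section \<open>Symmetries of the curvature and the second Bianchi identity\<close>

text \<open>The covariant exterior derivative of the curvature form vanishes; each bracket carries
  commutator terms for the endomorphism indices. Mixed second derivatives of the connection cancel
  in pairs, and the remaining products cancel by matrix algebra.\<close>

lemma bianchi_endomorphism:
  assumes "x \<in> U"
  shows "(mderiv k (Rm i j) x + \<Gamma> k x ** Rm i j x - Rm i j x ** \<Gamma> k x)
    + (mderiv i (Rm j k) x + \<Gamma> i x ** Rm j k x - Rm j k x ** \<Gamma> i x)
    + (mderiv j (Rm k i) x + \<Gamma> j x ** Rm k i x - Rm k i x ** \<Gamma> j x) = 0"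
proof -
  have D: "mderiv k (Rm i j) x = mderiv k (mderiv i (\<Gamma> j)) x - mderiv k (mderiv j (\<Gamma> i)) x
      + (mderiv k (\<Gamma> i) x ** \<Gamma> j x + \<Gamma> i x ** mderiv k (\<Gamma> j) x)
      - (mderiv k (\<Gamma> j) x ** \<Gamma> i x + \<Gamma> j x ** mderiv k (\<Gamma> i) x)" for i j k
    unfolding lriem_def by (simp add: md_simps ms_intros chris_smooth assms)
  note comm = mderiv_commute[OF open_U chris_smooth assms]
  show ?thesis
    unfolding D unfolding lriem_def comm[of k i] comm[of k j] comm[of j i]
    by (simp add: matrix_ring_simps)
qed

lemma Rm_antisymmetric: "Rm i j x = - Rm j i x"
  by (simp add: lriem_def)

text \<open>\<open>Q\<^sup>l\<^sup>m\<^sub>i\<^sub>j\<close> is the curvature with one index raised.\<close>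

definition Q :: "'n \<Rightarrow> 'n \<Rightarrow> real^'n \<Rightarrow> real^'n^'n" where
  "Q i j x = Rm i j x ** Gi x"

lemma Q_smooth: "msmooth_on U (Q i j)"
  unfolding Q_def by (intro ms_intros Rm_smooth Gi_smooth)

lemma Q_swap: "Q i j x = - Q j i x"
  using Rm_antisymmetric[of i j x] by (simp add: Q_def matrix_minus_left)

text \<open>Skewness is the commutation of second derivatives of the inverse metric.\<close>

lemma Q_transpose:
  assumes "x \<in> U"
  shows "transpose (Q i j x) = - Q i j x"
proof -
  have dd: "mderiv i (mderiv j Gi) x = - ((mderiv i (\<Gamma> j) x ** Gi x + \<Gamma> j x ** mderiv i Gi x)
      + (mderiv i Gi x ** transpose (\<Gamma> j x) + Gi x ** transpose (mderiv i (\<Gamma> j) x)))" for i j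
  proof -
    have "mderiv i (mderiv j Gi) x = mderiv i (\<lambda>y. - (\<Gamma> j y ** Gi y + Gi y ** transpose (\<Gamma> j y))) x"
      by (rule mderiv_cong[OF open_U assms]) (rule mderiv_Gi)
    also have "\<dots> = - mderiv i (\<lambda>y. \<Gamma> j y ** Gi y + Gi y ** transpose (\<Gamma> j y)) x"
      by (intro mderiv_minus ms_intros chris_smooth Gi_smooth assms)
    also have "mderiv i (\<lambda>y. \<Gamma> j y ** Gi y + Gi y ** transpose (\<Gamma> j y)) x
      = (mderiv i (\<Gamma> j) x ** Gi x + \<Gamma> j x ** mderiv i Gi x)
      + (mderiv i Gi x ** transpose (\<Gamma> j x) + Gi x ** transpose (mderiv i (\<Gamma> j) x))"
      by (simp add: md_simps ms_intros chris_smooth Gi_smooth assms)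
    finally show ?thesis .
  qed
  have tr: "transpose (Q i j x) = Gi x ** transpose (Rm i j x)"
    by (simp add: Q_def matrix_transpose_mul Gi_transpose[OF assms])
  \<comment> \<open>Products with \<open>Gi\<close> between two connection matrices are symmetric in
    \<open>i\<close> and \<open>j\<close> and drop out. The others complete the derivatives of
    \<open>\<Gamma>\<close> to the curvature.\<close>
  have "mderiv i (mderiv j Gi) x - mderiv j (mderiv i Gi) x = - (Q i j x + transpose (Q i j x))"
    unfolding tr unfolding dd Q_def lriem_def mderiv_Gi[OF assms]
    by (simp add: matrix_ring_simps transpose_add transpose_diff matrix_transpose_mul)
  then have "- (Q i j x + transpose (Q i j x)) = 0"
    using mderiv_commute[OF open_U Gi_smooth assms, of i j] by (metis diff_self)
  then have "Q i j x + transpose (Q i j x) = 0"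
    by (simp only: neg_equal_0_iff_equal)
  then show ?thesis by (simp add: add_eq_0_iff)
qed

text \<open>The covariant exterior derivative applied to \<open>Q\<close>: both matrix indices are
  upper, so each contributes a positive connection term, the second one through the
  transpose.\<close>

definition DQ :: "'n \<Rightarrow> 'n \<Rightarrow> 'n \<Rightarrow> real^'n \<Rightarrow> real^'n^'n" where
  "DQ k i j x = mderiv k (Q i j) x + \<Gamma> k x ** Q i j x + Q i j x ** transpose (\<Gamma> k x)"

lemma DQ_swap:
  assumes "x \<in> U"
  shows "DQ k i j x = - DQ k j i x"
proof -
  have "mderiv k (Q i j) x = - mderiv k (Q j i) x"
    by (rule trans[OF mderiv_cong[OF open_U assms Q_swap] mderiv_minus[OF Q_smooth assms]])
  then show ?thesis
    using Q_swap[of i j x] by (simp add: DQ_def matrix_minus_left matrix_minus_right)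
qed

lemma DQ_transpose:
  assumes "x \<in> U"
  shows "transpose (DQ k i j x) = - DQ k i j x"
proof -
  have "transpose (mderiv k (Q i j) x) = mderiv k (\<lambda>y. - Q i j y) x"
    unfolding mderiv_transpose[OF open_U, symmetric]
    by (rule mderiv_cong[OF open_U assms]) (rule Q_transpose)
  then show ?thesis
    by (simp add: DQ_def mderiv_minus[OF Q_smooth assms] transpose_add matrix_transpose_mul
        Q_transpose[OF assms] matrix_minus_left matrix_minus_right)
qed

text \<open>Because the inverse metric is parallel, \<open>DQ\<close> is the covariant derivative of
  the curvature endomorphism times \<open>Gi\<close>, and the second Bianchi identity carries
  over.\<close>

lemma DQ_cyclic:
  assumes "x \<in> U"
  shows "DQ k i j x + DQ i j k x + DQ j k i x = 0"
proof -
  have "DQ k i j x = (mderiv k (Rm i j) x + \<Gamma> k x ** Rm i j x - Rm i j x ** \<Gamma> k x) ** Gi x" for i j k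
    unfolding DQ_def Q_def
    by (simp add: md_simps Rm_smooth Gi_smooth assms mderiv_Gi matrix_ring_simps)
  then show ?thesis
    using bianchi_endomorphism[OF assms, of k i j]
    by (simp add: matrix_add_rdistrib[symmetric] matrix_zero_left)
qed

section \<open>The contracted second Bianchi identity\<close>

text \<open>The Ricci tensor with its second index raised: rows are lower, columns upper indices.
  Contractions of \<open>Q\<close> then become plain sums.\<close>

definition P :: "real^'n \<Rightarrow> real^'n^'n" where
  "P x = lric G x ** Gi x"

lemma ric_smooth: "msmooth_on U (lric G)"
  using Rm_smooth unfolding msmooth_on_def lric_def vec_lambda_beta
  by (intro allI smooth_on_sum open_U) auto

lemma P_smooth: "msmooth_on U P"
  unfolding P_def by (intro ms_intros ric_smooth Gi_smooth)

lemma P_nth: "P x $ j $ k = (\<Sum>i\<in>UNIV. Q i j x $ i $ k)"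
  unfolding P_def lric_def Q_def matrix_mult_nth vec_lambda_beta sum_distrib_right
  by (rule sum.swap)

lemma scal_eq_trace_P:
  assumes "x \<in> U"
  shows "lscal G x = (\<Sum>j\<in>UNIV. P x $ j $ j)"
  unfolding lscal_def P_def matrix_mult_nth
  using posdef_symmetric[OF Gi_posdef[OF assms]] by (simp add: mult.commute)

lemma scal_smooth: "smooth_on U (lscal G)"
  unfolding lscal_def using Gi_smooth ric_smooth
  by (intro smooth_on_sum smooth_on_mult open_U) (auto simp: msmooth_on_def)

lemma pderiv_P:
  assumes "x \<in> U"
  shows "pd l (\<lambda>y. P y $ j $ k) x = (\<Sum>i\<in>UNIV. mderiv l (Q i j) x $ i $ k)"
  by (simp add: P_nth pd_sum msmooth_on_differentiable[OF open_U Q_smooth assms] mderiv_nth)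

lemma pderiv_scal:
  assumes "x \<in> U"
  shows "pd k (lscal G) x = (\<Sum>j\<in>UNIV. \<Sum>i\<in>UNIV. mderiv k (Q i j) x $ i $ j)"
proof -
  have "pd k (lscal G) x = pd k (\<lambda>y. \<Sum>j\<in>UNIV. P y $ j $ j) x"
    by (rule pd_cong[OF open_U assms]) (rule scal_eq_trace_P)
  then show ?thesis
    by (simp add: pd_sum msmooth_on_differentiable[OF open_U P_smooth assms] pderiv_P[OF assms])
qed

text \<open>Both index pairs of \<open>DQ_cyclic\<close> are contracted. One cyclic term gives the
  derivative of the scalar curvature, the other two agree and give the divergence of
  \<open>P\<close>. The \<open>\<Gamma>\<close>-sums on the right are the connection terms of that
  divergence, for the upper and for the lower index.\<close>

lemma contracted_bianchi:
  assumes x: "x \<in> U"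
  shows "1 / 2 * pd k (lscal G) x =
    (\<Sum>j\<in>UNIV. pd j (\<lambda>y. P y $ k $ j) x)
    + (\<Sum>j\<in>UNIV. \<Sum>a\<in>UNIV. \<Gamma> j x $ j $ a * P x $ k $ a)
    - (\<Sum>i\<in>UNIV. \<Sum>a\<in>UNIV. \<Gamma> k x $ i $ a * P x $ i $ a)"
proof -
  \<comment> \<open>Skewness in each of the two index pairs makes \<open>Q\<close> invariant under
    swapping both at once.\<close>
  have Qs: "Q i j x $ a $ b = Q j i x $ b $ a" for i j a b
    using Q_transpose[OF x, of i j] Q_swap[of i j x]
    by (metis add.inverse_inverse transpose_nth)
  have Qt: "Q i j x $ a $ b = - Q i j x $ b $ a" for i j a b
    using Q_transpose[OF x, of i j] by (metis transpose_nth vector_uminus_component)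
  have Ds: "DQ l i j x $ a $ b = DQ l j i x $ b $ a" for l i j a b
    using DQ_transpose[OF x, of l i j] DQ_swap[OF x, of l i j]
    by (metis add.inverse_inverse transpose_nth)
  have cyc: "DQ k i j x $ a $ b + DQ i j k x $ a $ b + DQ j k i x $ a $ b = 0" for i j a b
    using DQ_cyclic[OF x, of k i j] by (metis vector_add_component zero_index)
  have neg: "DQ j k i x $ a $ b = - DQ j i k x $ a $ b" for i j a b
    using DQ_swap[OF x, of j k i] by simp
  \<comment> \<open>After exchanging the summation indices, the double swap identifies two of the
    three contracted cyclic terms.\<close>
  have "(\<Sum>i\<in>UNIV. \<Sum>j\<in>UNIV. DQ i j k x $ i $ j) = (\<Sum>j\<in>UNIV. \<Sum>i\<in>UNIV. DQ i j k x $ i $ j)"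
    by (rule sum.swap)
  also have "\<dots> = (\<Sum>i\<in>UNIV. \<Sum>j\<in>UNIV. DQ j k i x $ i $ j)"
    using Ds by (intro sum.cong refl) metis
  finally have "(\<Sum>i\<in>UNIV. \<Sum>j\<in>UNIV. DQ k i j x $ i $ j) = 2 * (\<Sum>i\<in>UNIV. \<Sum>j\<in>UNIV. DQ j i k x $ i $ j)"
  proof -
    assume "(\<Sum>i\<in>UNIV. \<Sum>j\<in>UNIV. DQ i j k x $ i $ j) = (\<Sum>i\<in>UNIV. \<Sum>j\<in>UNIV. DQ j k i x $ i $ j)"
    moreover have "(\<Sum>i\<in>UNIV. \<Sum>j\<in>UNIV. DQ k i j x $ i $ j) + (\<Sum>i\<in>UNIV. \<Sum>j\<in>UNIV. DQ i j k x $ i $ j)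
        + (\<Sum>i\<in>UNIV. \<Sum>j\<in>UNIV. DQ j k i x $ i $ j) = 0"
      unfolding sum.distrib[symmetric] cyc by simp
    moreover have "(\<Sum>i\<in>UNIV. \<Sum>j\<in>UNIV. DQ j k i x $ i $ j) = - (\<Sum>i\<in>UNIV. \<Sum>j\<in>UNIV. DQ j i k x $ i $ j)"
      by (simp add: neg sum_negf)
    ultimately show ?thesis by simp
  qed
  moreover have "(\<Sum>i\<in>UNIV. \<Sum>j\<in>UNIV. DQ k i j x $ i $ j) = pd k (lscal G) x
      + 2 * (\<Sum>i\<in>UNIV. \<Sum>a\<in>UNIV. \<Gamma> k x $ i $ a * P x $ i $ a)"
  proof -
    have 1: "(\<Sum>i\<in>UNIV. \<Sum>j\<in>UNIV. mderiv k (Q i j) x $ i $ j) = pd k (lscal G) x"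
      unfolding pderiv_scal[OF x] by (rule sum.swap)
    have "(\<Sum>j\<in>UNIV. (\<Gamma> k x ** Q i j x) $ i $ j) = (\<Sum>a\<in>UNIV. \<Gamma> k x $ i $ a * P x $ i $ a)" for i
    proof -
      have "(\<Sum>j\<in>UNIV. (\<Gamma> k x ** Q i j x) $ i $ j) = (\<Sum>a\<in>UNIV. \<Sum>j\<in>UNIV. \<Gamma> k x $ i $ a * Q i j x $ a $ j)"
        unfolding matrix_mult_nth by (rule sum.swap)
      also have "\<dots> = (\<Sum>a\<in>UNIV. \<Gamma> k x $ i $ a * P x $ i $ a)"
        unfolding P_nth sum_distrib_left using Qs by (intro sum.cong refl) metis
      finally show ?thesis .
    qed
    then have 2: "(\<Sum>i\<in>UNIV. \<Sum>j\<in>UNIV. (\<Gamma> k x ** Q i j x) $ i $ j) = (\<Sum>i\<in>UNIV. \<Sum>a\<in>UNIV. \<Gamma> k x $ i $ a * P x $ i $ a)"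
      by simp
    have "(\<Sum>i\<in>UNIV. (Q i j x ** transpose (\<Gamma> k x)) $ i $ j) = (\<Sum>a\<in>UNIV. \<Gamma> k x $ j $ a * P x $ j $ a)" for j
    proof -
      have "(\<Sum>i\<in>UNIV. (Q i j x ** transpose (\<Gamma> k x)) $ i $ j) = (\<Sum>a\<in>UNIV. \<Sum>i\<in>UNIV. Q i j x $ i $ a * \<Gamma> k x $ j $ a)"
        unfolding matrix_mult_nth transpose_nth by (rule sum.swap)
      then show ?thesis
        unfolding P_nth sum_distrib_left by (simp add: mult.commute)
    qed
    then have 3: "(\<Sum>i\<in>UNIV. \<Sum>j\<in>UNIV. (Q i j x ** transpose (\<Gamma> k x)) $ i $ j) = (\<Sum>i\<in>UNIV. \<Sum>a\<in>UNIV. \<Gamma> k x $ i $ a * P x $ i $ a)"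
      by (subst sum.swap) simp
    show ?thesis
      unfolding DQ_def vector_add_component sum.distrib 1 2 3 by simp
  qed
  moreover have "(\<Sum>i\<in>UNIV. \<Sum>j\<in>UNIV. DQ j i k x $ i $ j) = (\<Sum>j\<in>UNIV. pd j (\<lambda>y. P y $ k $ j) x)
    + (\<Sum>j\<in>UNIV. \<Sum>a\<in>UNIV. \<Gamma> j x $ j $ a * P x $ k $ a)"
  proof -
    have 1: "(\<Sum>i\<in>UNIV. \<Sum>j\<in>UNIV. mderiv j (Q i k) x $ i $ j) = (\<Sum>j\<in>UNIV. pd j (\<lambda>y. P y $ k $ j) x)"
      unfolding pderiv_P[OF x] by (rule sum.swap)
    \<comment> \<open>By torsion-freeness the connection factor is symmetric in \<open>j\<close> and
      \<open>a\<close>, whereas \<open>Q\<close> is skew in them.\<close>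
    have "(\<Sum>j\<in>UNIV. \<Sum>a\<in>UNIV. \<Gamma> j x $ i $ a * Q i k x $ a $ j) = 0" for i
    proof (rule antisymmetric_sum_eq_0)
      fix j a
      show "\<Gamma> j x $ i $ a * Q i k x $ a $ j = - (\<Gamma> a x $ i $ j * Q i k x $ j $ a)"
        unfolding Qt[of i k a j] chris_symmetric[OF x, of j i a] by simp
    qed
    then have 2: "(\<Sum>i\<in>UNIV. \<Sum>j\<in>UNIV. (\<Gamma> j x ** Q i k x) $ i $ j) = 0"
      unfolding matrix_mult_nth by simp
    have "(\<Sum>i\<in>UNIV. (Q i k x ** transpose (\<Gamma> j x)) $ i $ j) = (\<Sum>a\<in>UNIV. \<Gamma> j x $ j $ a * P x $ k $ a)" for j
    proof -
      have "(\<Sum>i\<in>UNIV. (Q i k x ** transpose (\<Gamma> j x)) $ i $ j) = (\<Sum>a\<in>UNIV. \<Sum>i\<in>UNIV. Q i k x $ i $ a * \<Gamma> j x $ j $ a)"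
        unfolding matrix_mult_nth transpose_nth by (rule sum.swap)
      then show ?thesis
        unfolding P_nth sum_distrib_left by (simp add: mult.commute)
    qed
    then have 3: "(\<Sum>i\<in>UNIV. \<Sum>j\<in>UNIV. (Q i k x ** transpose (\<Gamma> j x)) $ i $ j) = (\<Sum>j\<in>UNIV. \<Sum>a\<in>UNIV. \<Gamma> j x $ j $ a * P x $ k $ a)"
      by (subst sum.swap) simp
    show ?thesis
      unfolding DQ_def vector_add_component sum.distrib 1 2 3 by simp
  qed
  ultimately show ?thesis by simp
qed

lemma hess_symmetric:
  assumes F: "smooth_on U F" and x: "x \<in> U"
  shows "transpose (lhess G F x) = lhess G F x"
proof -
  have "lhess G F x $ j $ i = lhess G F x $ i $ j" for i j
    unfolding lhess_def vec_lambda_beta chris_symmetric[OF x, of j _ i]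
      pd_commute[OF open_U smooth_on_Ck_on[OF F] x, of j i] ..
  then show ?thesis by (simp add: vec_eq_iff transpose_nth)
qed

text \<open>Jacobi's formula combined with \<open>\<nabla>g = 0\<close>: half the trace of
  \<open>g^{-1} dg\<close> is the trace of the connection. So the weight \<open>sqrt (det G)\<close>
  absorbs the connection term of a divergence.\<close>

lemma pderiv_sqrt_det:
  assumes x: "x \<in> U"
  shows "pd j (\<lambda>y. sqrt (det (G y))) x = sqrt (det (G x)) * (\<Sum>a\<in>UNIV. \<Gamma> a x $ a $ j)"
proof -
  note inv = G_inverse[OF x]
  have pos: "det (G x) > 0" by (rule posdef_det_pos[OF G_posdef[OF x]])
  have "trace (mderiv j G x ** Gi x) = trace (transpose (\<Gamma> j x) ** (G x ** Gi x)) + trace ((G x ** \<Gamma> j x) ** Gi x)"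
    by (simp add: mderiv_G[OF x] matrix_ring_simps trace_add)
  also have "trace ((G x ** \<Gamma> j x) ** Gi x) = trace ((Gi x ** G x) ** \<Gamma> j x)"
    by (subst trace_mul_sym) (simp add: matrix_mul_assoc)
  also have "trace (transpose (\<Gamma> j x) ** (G x ** Gi x)) + trace ((Gi x ** G x) ** \<Gamma> j x) = 2 * (\<Sum>a\<in>UNIV. \<Gamma> j x $ a $ a)"
    by (simp add: inv trace_def transpose_nth)
  also have "(\<Sum>a\<in>UNIV. \<Gamma> j x $ a $ a) = (\<Sum>a\<in>UNIV. \<Gamma> a x $ a $ j)"
    by (intro sum.cong refl chris_symmetric[OF x])
  finally have tr: "trace (mderiv j G x ** Gi x) = 2 * (\<Sum>a\<in>UNIV. \<Gamma> a x $ a $ j)" .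
  have "pd j (\<lambda>y. sqrt (det (G y))) x = (inverse (sqrt (det (G x))) / 2) * pd j (\<lambda>y. det (G y)) x"
    by (rule pd_real_compose(1))
      (use DERIV_real_sqrt[OF pos] smooth_on_differentiable[OF smooth_on_det[OF open_U G_smooth] open_U x] in simp_all)
  also have "pd j (\<lambda>y. det (G y)) x = det (G x) * (2 * (\<Sum>a\<in>UNIV. \<Gamma> a x $ a $ j))"
    unfolding tr[symmetric]
    by (intro pd_det msmooth_on_differentiable[OF open_U G_smooth x] posdef_invertible G_posdef x)
  also have "(inverse (sqrt (det (G x))) / 2) * \<dots> = (det (G x) / sqrt (det (G x))) * (\<Sum>a\<in>UNIV. \<Gamma> a x $ a $ j)"
    using pos by (simp add: field_simps)
  finally show ?thesis using pos by (simp add: real_div_sqrt)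
qed

lemma sqrt_det_smooth: "smooth_on U (\<lambda>y. sqrt (det (G y)))"
  unfolding smooth_on_def
  by (intro allI Ck_on_sqrt open_U smooth_on_Ck_on[OF smooth_on_det[OF open_U G_smooth]] posdef_det_pos G_posdef)


text \<open>The covariant derivative of the gradient is the Hessian with one index raised; the
  connection term has been moved to the right.\<close>

lemma pderiv_grad:
  assumes F: "smooth_on U F" and x: "x \<in> U"
  shows "pd j (\<lambda>y. (Gi y *v dvec F y) $ k) x =
    (Gi x ** lhess G F x) $ k $ j - (\<Sum>m\<in>UNIV. \<Gamma> j x $ k $ m * (Gi x *v dvec F x) $ m)"
proof -
  have dF: "pd a F differentiable (at x)" for a
    by (rule smooth_on_differentiable[OF smooth_on_pd[OF F] open_U x])
  have "pd j (\<lambda>y. (Gi y *v dvec F y) $ k) x =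
      (\<Sum>a\<in>UNIV. mderiv j Gi x $ k $ a * pd a F x)
      + (\<Sum>a\<in>UNIV. Gi x $ k $ a * pd j (pd a F) x)"
    by (simp add: matrix_vector_mult_def dvec_def pd_sum pd_mult dF
        msmooth_on_differentiable[OF open_U Gi_smooth x] mderiv_nth sum.distrib)
  also have "(\<Sum>a\<in>UNIV. mderiv j Gi x $ k $ a * pd a F x) = (mderiv j Gi x *v dvec F x) $ k"
    by (simp add: matrix_vector_mult_def dvec_def)
  also have "mderiv j Gi x *v dvec F x = - (\<Gamma> j x *v (Gi x *v dvec F x)) - Gi x *v (transpose (\<Gamma> j x) *v dvec F x)"
    unfolding mderiv_Gi[OF x] matrix_vector_mul_assoc
    by (simp only: vec_eq_iff) (simp add: matrix_vector_mult_def sum_negf sum.distrib algebra_simps sum_subtractf)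
  also have "(- (\<Gamma> j x *v (Gi x *v dvec F x)) - Gi x *v (transpose (\<Gamma> j x) *v dvec F x)) $ k
      + (\<Sum>a\<in>UNIV. Gi x $ k $ a * pd j (pd a F) x)
     = (Gi x ** transpose (lhess G F x)) $ k $ j - (\<Sum>m\<in>UNIV. \<Gamma> j x $ k $ m * (Gi x *v dvec F x) $ m)"
  proof -
    have "(Gi x *v (transpose (\<Gamma> j x) *v dvec F x)) $ k =
        (\<Sum>a\<in>UNIV. Gi x $ k $ a * (\<Sum>m\<in>UNIV. \<Gamma> j x $ m $ a * pd m F x))"
      by (simp add: matrix_vector_mult_def transpose_def dvec_def)
    moreover have "(Gi x ** transpose (lhess G F x)) $ k $ j = (\<Sum>a\<in>UNIV. Gi x $ k $ a * pd j (pd a F) x)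
        - (\<Sum>a\<in>UNIV. Gi x $ k $ a * (\<Sum>m\<in>UNIV. \<Gamma> j x $ m $ a * pd m F x))"
      by (simp add: matrix_mult_nth transpose_nth lhess_def right_diff_distrib sum_subtractf)
    moreover have "(\<Gamma> j x *v (Gi x *v dvec F x)) $ k = (\<Sum>m\<in>UNIV. \<Gamma> j x $ k $ m * (Gi x *v dvec F x) $ m)"
      by (simp add: matrix_vector_mult_def[of "\<Gamma> j x"])
    ultimately show ?thesis by simp
  qed
  finally show ?thesis by (simp add: hess_symmetric[OF F x])
qed

section \<open>The divergence of the trace-free Ricci tensor applied to the gradient\<close>

definition T :: "real^'n \<Rightarrow> real^'n^'n" where
  "T x = lric G x - (lscal G x / real CARD('n)) *\<^sub>R G x"

definition N :: "real^'n \<Rightarrow> real^'n^'n" where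
  "N x = T x ** Gi x"

lemma N_nth:
  assumes "x \<in> U"
  shows "N x $ i $ j = P x $ i $ j - lscal G x / real CARD('n) * (if i = j then 1 else 0)"
proof -
  have "N x = P x - (lscal G x / real CARD('n)) *\<^sub>R (G x ** Gi x)"
    by (simp add: N_def T_def P_def matrix_diff_rdistrib scalar_matrix_assoc)
  then show ?thesis by (simp add: G_inverse[OF assms] mat_def)
qed

lemma trace_N:
  assumes "x \<in> U"
  shows "trace (N x) = 0"
  by (simp add: trace_def N_nth[OF assms] sum_subtractf scal_eq_trace_P[OF assms])

lemma T_smooth: "msmooth_on U T"
  unfolding T_def msmooth_on_def using ric_smooth G_smooth
  by (auto simp: msmooth_on_def intro!: smooth_on_diff smooth_on_mult smooth_on_divide scal_smooth open_U)

lemma N_smooth: "msmooth_on U N"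
  unfolding N_def by (intro ms_intros T_smooth Gi_smooth)

text \<open>The summand 1/2 is the contracted Bianchi identity, and -1/n comes from the divergence
  of \<open>(R/n)\<close> times the identity, whose connection terms are equal on the two sides. The
  connection term of the lower index \<open>k\<close> stands on the right.\<close>

lemma divergence_N:
  assumes x: "x \<in> U"
  shows "(\<Sum>j\<in>UNIV. pd j (\<lambda>y. N y $ k $ j) x) + (\<Sum>j\<in>UNIV. (\<Sum>a\<in>UNIV. \<Gamma> a x $ a $ j) * N x $ k $ j)
    = (1 / 2 - 1 / real CARD('n)) * pd k (lscal G) x + (\<Sum>i\<in>UNIV. \<Sum>a\<in>UNIV. \<Gamma> k x $ i $ a * N x $ i $ a)"
proof -
  let ?n = "real CARD('n)"
  have dR: "lscal G differentiable (at x)"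
    by (rule smooth_on_differentiable[OF scal_smooth open_U x])
  have "pd j (\<lambda>y. N y $ k $ j) x = pd j (\<lambda>y. P y $ k $ j) x
      - (if k = j then pd k (lscal G) x / ?n else 0)" for j
  proof -
    have "pd j (\<lambda>y. N y $ k $ j) x
        = pd j (\<lambda>y. P y $ k $ j - ((if k = j then 1 else 0) / ?n) * lscal G y) x"
      by (rule pd_cong[OF open_U x]) (simp add: N_nth)
    also have "\<dots> = pd j (\<lambda>y. P y $ k $ j) x
        - pd j (\<lambda>y. ((if k = j then 1 else 0) / ?n) * lscal G y) x"
      by (intro pd_diff msmooth_on_differentiable[OF open_U P_smooth x]
          smooth_on_differentiable[OF smooth_on_mult[OF open_U smooth_on_const scal_smooth] open_U x])
    also have "pd j (\<lambda>y. ((if k = j then 1 else 0) / ?n) * lscal G y) x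
        = (if k = j then 1 else 0) / ?n * pd j (lscal G) x"
      by (rule pd_cmult[OF dR])
    finally show ?thesis by simp
  qed
  then have 1: "(\<Sum>j\<in>UNIV. pd j (\<lambda>y. N y $ k $ j) x) =
      (\<Sum>j\<in>UNIV. pd j (\<lambda>y. P y $ k $ j) x) - pd k (lscal G) x / ?n"
    by (simp add: sum_subtractf)
  have "(\<Sum>j\<in>UNIV. (\<Sum>a\<in>UNIV. \<Gamma> a x $ a $ j) * P x $ k $ j) = (\<Sum>j\<in>UNIV. \<Sum>a\<in>UNIV. \<Gamma> j x $ j $ a * P x $ k $ a)"
    unfolding sum_distrib_right by (rule sum.swap)
  then have 2: "(\<Sum>j\<in>UNIV. (\<Sum>a\<in>UNIV. \<Gamma> a x $ a $ j) * N x $ k $ j) =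
      (\<Sum>j\<in>UNIV. \<Sum>a\<in>UNIV. \<Gamma> j x $ j $ a * P x $ k $ a) - (\<Sum>a\<in>UNIV. \<Gamma> a x $ a $ k) * (lscal G x / ?n)"
    by (simp add: N_nth[OF x] right_diff_distrib sum_subtractf if_distrib[of "\<lambda>u. _ * u"] cong: if_cong)
  have "(\<Sum>i\<in>UNIV. \<Gamma> k x $ i $ i) = (\<Sum>a\<in>UNIV. \<Gamma> a x $ a $ k)"
    by (intro sum.cong refl chris_symmetric[OF x])
  then have 3: "(\<Sum>i\<in>UNIV. \<Sum>a\<in>UNIV. \<Gamma> k x $ i $ a * N x $ i $ a) =
      (\<Sum>i\<in>UNIV. \<Sum>a\<in>UNIV. \<Gamma> k x $ i $ a * P x $ i $ a) - (\<Sum>a\<in>UNIV. \<Gamma> a x $ a $ k) * (lscal G x / ?n)"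
    by (simp add: N_nth[OF x] right_diff_distrib sum_subtractf if_distrib[of "\<lambda>u. _ * u"]
        sum_distrib_right[symmetric] sum_divide_distrib[symmetric] cong: if_cong)
  show ?thesis
    unfolding 1 2 3 using contracted_bianchi[OF x, of k]
    by (simp add: left_diff_distrib add_divide_distrib diff_divide_distrib)
qed

text \<open>The vector field dual to the 1-form \<open>T(grad f, .)\<close>: the last inverse forms
  the gradient, the first raises the remaining index.\<close>

definition V :: "(real^'n \<Rightarrow> real) \<Rightarrow> real^'n \<Rightarrow> real^'n" where
  "V F x = (Gi x ** T x ** Gi x) *v dvec F x"

lemma V_smooth:
  assumes "smooth_on U F"
  shows "smooth_on U (\<lambda>y. V F y $ j)"
proof -
  have "msmooth_on U (\<lambda>x. Gi x ** T x ** Gi x)"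
    by (intro ms_intros Gi_smooth T_smooth)
  then show ?thesis
    unfolding V_def matrix_vector_mult_def dvec_def vec_lambda_beta using assms
    by (intro smooth_on_sum smooth_on_mult smooth_on_pd open_U) (auto simp: msmooth_on_def)
qed

context
  fixes F h :: "real^'n \<Rightarrow> real"
  assumes F: "smooth_on U F"
    and soliton: "\<And>x. x \<in> U \<Longrightarrow> lric G x + lhess G F x = h x *\<^sub>R G x"
begin

text \<open>Symmetry of the Ricci tensor is read off from the soliton equation, whose other terms
  are symmetric; this bypasses the pair symmetry of the curvature tensor.\<close>

lemma T_symmetric:
  assumes "x \<in> U"
  shows "transpose (T x) = T x"
proof -
  have "lric G x = h x *\<^sub>R G x - lhess G F x"
    using soliton[OF assms] by (simp add: eq_diff_eq)
  then show ?thesis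
    by (simp add: T_def transpose_diff transpose_scalar G_transpose[OF assms] hess_symmetric[OF F assms])
qed

lemma V_nth:
  assumes "x \<in> U"
  shows "V F x $ j = (\<Sum>k\<in>UNIV. (Gi x *v dvec F x) $ k * N x $ k $ j)"
proof -
  have "transpose (N x) = Gi x ** T x"
    by (simp add: N_def matrix_transpose_mul T_symmetric Gi_transpose assms)
  then have "V F x = transpose (N x) *v (Gi x *v dvec F x)"
    by (simp add: V_def matrix_vector_mul_assoc)
  then show ?thesis
    by (simp add: matrix_vector_mult_def[of "transpose (N x)"] transpose_nth mult.commute
        del: transpose_matrix_vector)
qed

text \<open>The Leibniz rule \<open>div (T(grad f)) = (div T)(grad f) + <T, Hess f>\<close>. The
  connection terms of the gradient and of the lower index of \<open>N\<close> cancel each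
  other.\<close>

lemma divergence_V:
  assumes x: "x \<in> U"
  shows "(\<Sum>j\<in>UNIV. pd j (\<lambda>y. V F y $ j) x) + (\<Sum>j\<in>UNIV. (\<Sum>a\<in>UNIV. \<Gamma> a x $ a $ j) * V F x $ j)
    = (1 / 2 - 1 / real CARD('n)) * (dvec (lscal G) x \<bullet> (Gi x *v dvec F x)) - frob2 (Gi x) (T x)"
proof -
  define W where "W y = Gi y *v dvec F y" for y
  have W_smooth: "smooth_on U (\<lambda>y. W y $ k)" for k
    unfolding W_def matrix_vector_mult_def dvec_def vec_lambda_beta using F Gi_smooth
    by (intro smooth_on_sum smooth_on_mult smooth_on_pd open_U) (auto simp: msmooth_on_def)
  have dV: "pd j (\<lambda>y. V F y $ j) x =
      (\<Sum>k\<in>UNIV. pd j (\<lambda>y. W y $ k) x * N x $ k $ j) + (\<Sum>k\<in>UNIV. W x $ k * pd j (\<lambda>y. N y $ k $ j) x)" for j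
  proof -
    have "pd j (\<lambda>y. V F y $ j) x = pd j (\<lambda>y. \<Sum>k\<in>UNIV. W y $ k * N y $ k $ j) x"
      by (rule pd_cong[OF open_U x]) (simp add: V_nth W_def)
    then show ?thesis
      by (simp add: pd_sum pd_mult sum.distrib
          msmooth_on_differentiable[OF open_U N_smooth x] smooth_on_differentiable[OF W_smooth open_U x])
  qed
  \<comment> \<open>Torsion-freeness brings the connection term of the gradient into the shape that
    occurs in \<open>divergence_N\<close>, with the opposite sign.\<close>
  have 1: "(\<Sum>j\<in>UNIV. \<Sum>k\<in>UNIV. pd j (\<lambda>y. W y $ k) x * N x $ k $ j) =
      (\<Sum>j\<in>UNIV. \<Sum>k\<in>UNIV. (Gi x ** lhess G F x) $ k $ j * N x $ k $ j)
      - (\<Sum>k\<in>UNIV. W x $ k * (\<Sum>i\<in>UNIV. \<Sum>a\<in>UNIV. \<Gamma> k x $ i $ a * N x $ i $ a))"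
  proof -
    have "(\<Sum>j\<in>UNIV. \<Sum>k\<in>UNIV. (\<Sum>m\<in>UNIV. \<Gamma> j x $ k $ m * W x $ m) * N x $ k $ j)
      = (\<Sum>j\<in>UNIV. \<Sum>k\<in>UNIV. \<Sum>m\<in>UNIV. W x $ m * (\<Gamma> m x $ k $ j * N x $ k $ j))"
      unfolding sum_distrib_right
      by (intro sum.cong refl) (simp add: chris_symmetric[OF x, of j m for j m])
    also have "\<dots> = (\<Sum>k\<in>UNIV. \<Sum>j\<in>UNIV. \<Sum>m\<in>UNIV. W x $ m * (\<Gamma> m x $ k $ j * N x $ k $ j))"
      by (rule sum.swap)
    also have "\<dots> = (\<Sum>k\<in>UNIV. \<Sum>m\<in>UNIV. \<Sum>j\<in>UNIV. W x $ m * (\<Gamma> m x $ k $ j * N x $ k $ j))"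
      by (intro sum.cong refl sum.swap)
    also have "\<dots> = (\<Sum>m\<in>UNIV. \<Sum>k\<in>UNIV. \<Sum>j\<in>UNIV. W x $ m * (\<Gamma> m x $ k $ j * N x $ k $ j))"
      by (rule sum.swap)
    also have "\<dots> = (\<Sum>k\<in>UNIV. W x $ k * (\<Sum>i\<in>UNIV. \<Sum>a\<in>UNIV. \<Gamma> k x $ i $ a * N x $ i $ a))"
      by (simp add: sum_distrib_left)
    finally show ?thesis
      by (simp add: W_def pderiv_grad[OF F x] left_diff_distrib sum_subtractf)
  qed
  have 2: "(\<Sum>j\<in>UNIV. \<Sum>k\<in>UNIV. W x $ k * pd j (\<lambda>y. N y $ k $ j) x) =
      (\<Sum>k\<in>UNIV. W x $ k * (\<Sum>j\<in>UNIV. pd j (\<lambda>y. N y $ k $ j) x))"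
    unfolding sum_distrib_left by (rule sum.swap)
  have "(\<Sum>j\<in>UNIV. (\<Sum>a\<in>UNIV. \<Gamma> a x $ a $ j) * V F x $ j) =
      (\<Sum>j\<in>UNIV. \<Sum>k\<in>UNIV. W x $ k * ((\<Sum>a\<in>UNIV. \<Gamma> a x $ a $ j) * N x $ k $ j))"
    unfolding V_nth[OF x] W_def[symmetric] sum_distrib_left
    by (intro sum.cong refl) (simp add: ac_simps)
  also have "\<dots> = (\<Sum>k\<in>UNIV. W x $ k * (\<Sum>j\<in>UNIV. (\<Sum>a\<in>UNIV. \<Gamma> a x $ a $ j) * N x $ k $ j))"
    unfolding sum_distrib_left[of "W x $ _"] by (rule sum.swap)
  finally have 3: "(\<Sum>j\<in>UNIV. (\<Sum>a\<in>UNIV. \<Gamma> a x $ a $ j) * V F x $ j) =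
      (\<Sum>k\<in>UNIV. W x $ k * (\<Sum>j\<in>UNIV. (\<Sum>a\<in>UNIV. \<Gamma> a x $ a $ j) * N x $ k $ j))" .
  have 4: "(\<Sum>k\<in>UNIV. W x $ k * (\<Sum>j\<in>UNIV. pd j (\<lambda>y. N y $ k $ j) x))
      + (\<Sum>k\<in>UNIV. W x $ k * (\<Sum>j\<in>UNIV. (\<Sum>a\<in>UNIV. \<Gamma> a x $ a $ j) * N x $ k $ j))
      = (1 / 2 - 1 / real CARD('n)) * (dvec (lscal G) x \<bullet> W x)
        + (\<Sum>k\<in>UNIV. W x $ k * (\<Sum>i\<in>UNIV. \<Sum>a\<in>UNIV. \<Gamma> k x $ i $ a * N x $ i $ a))"
  proof -
    have "(\<Sum>k\<in>UNIV. W x $ k * (\<Sum>j\<in>UNIV. pd j (\<lambda>y. N y $ k $ j) x))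
      + (\<Sum>k\<in>UNIV. W x $ k * (\<Sum>j\<in>UNIV. (\<Sum>a\<in>UNIV. \<Gamma> a x $ a $ j) * N x $ k $ j))
      = (\<Sum>k\<in>UNIV. W x $ k * ((1 / 2 - 1 / real CARD('n)) * pd k (lscal G) x
          + (\<Sum>i\<in>UNIV. \<Sum>a\<in>UNIV. \<Gamma> k x $ i $ a * N x $ i $ a)))"
      unfolding divergence_N[OF x, symmetric] distrib_left by (rule sum.distrib[symmetric])
    also have "\<dots> = (\<Sum>k\<in>UNIV. (1 / 2 - 1 / real CARD('n)) * (pd k (lscal G) x * W x $ k))
        + (\<Sum>k\<in>UNIV. W x $ k * (\<Sum>i\<in>UNIV. \<Sum>a\<in>UNIV. \<Gamma> k x $ i $ a * N x $ i $ a))"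
      unfolding sum.distrib[symmetric] by (intro sum.cong refl) (simp add: distrib_left ac_simps)
    finally show ?thesis
      unfolding sum_distrib_left[symmetric] by (simp add: inner_vec_def dvec_def)
  qed
  \<comment> \<open>With this \<open>c\<close> the soliton equation reads
    \<open>Hess f = c g - T\<close>. The multiple of the metric pairs with \<open>N\<close> to
    \<open>c\<close> times its trace, which is zero, so only -|T|^2 survives.\<close>
  define c where "c = h x - lscal G x / real CARD('n)"
  have H: "lhess G F x = c *\<^sub>R G x - T x"
    using soliton[OF x] by (simp add: T_def c_def scaleR_left_diff_distrib) (simp add: algebra_simps)
  have "(\<Sum>j\<in>UNIV. \<Sum>k\<in>UNIV. (Gi x ** lhess G F x) $ k $ j * N x $ k $ j) = trace (transpose (Gi x ** lhess G F x) ** N x)"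
    unfolding trace_def matrix_mult_nth[of "transpose _"] transpose_nth ..
  also have "\<dots> = trace (lhess G F x ** Gi x ** N x)"
    by (simp add: matrix_transpose_mul Gi_transpose[OF x] hess_symmetric[OF F x])
  also have "\<dots> = c * trace (G x ** Gi x ** N x) - trace (T x ** Gi x ** N x)"
    unfolding H by (simp add: matrix_diff_rdistrib trace_sub scalar_matrix_assoc[symmetric] trace_def sum_distrib_left sum_subtractf)
  also have "\<dots> = - frob2 (Gi x) (T x)"
    by (simp add: G_inverse[OF x] trace_N[OF x] frob2_def T_symmetric[OF x])
      (simp add: N_def matrix_mul_assoc)
  finally show ?thesis
    unfolding dV sum.distrib 1 2 using 3 4 by (simp add: W_def)
qed

text \<open>The cutoff \<open>\<phi>\<close> will be a member of a partition of unity. Having an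
  ordinary divergence on the left is what makes the formula integrable over Euclidean space.\<close>

lemma weighted_divergence_V:
  assumes x: "x \<in> U" and \<phi>: "\<phi> differentiable (at x)"
  shows "(\<Sum>j\<in>UNIV. pd j (\<lambda>y. sqrt (det (G y)) * (\<phi> y * V F y $ j)) x) =
    sqrt (det (G x)) * (\<phi> x * ((1 / 2 - 1 / real CARD('n)) * (dvec (lscal G) x \<bullet> (Gi x *v dvec F x))
       - frob2 (Gi x) (T x)) + dvec \<phi> x \<bullet> V F x)"
proof -
  have dV: "(\<lambda>y. V F y $ j) differentiable (at x)" for j
    by (rule smooth_on_differentiable[OF V_smooth[OF F] open_U x])
  have "pd j (\<lambda>y. sqrt (det (G y)) * (\<phi> y * V F y $ j)) x =
      sqrt (det (G x)) * (\<phi> x * (pd j (\<lambda>y. V F y $ j) x + (\<Sum>a\<in>UNIV. \<Gamma> a x $ a $ j) * V F x $ j)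
        + pd j \<phi> x * V F x $ j)" for j
    using pd_mult[OF smooth_on_differentiable[OF sqrt_det_smooth open_U x] differentiable_mult[OF \<phi> dV], of j j]
    unfolding pd_mult[OF \<phi> dV] pderiv_sqrt_det[OF x]
    by (simp add: algebra_simps)
  then show ?thesis
    unfolding divergence_V[OF x, symmetric]
    by (simp add: sum_distrib_left[symmetric] sum.distrib inner_vec_def dvec_def)
qed

end

end

section \<open>Change of coordinates\<close>

definition jacmat :: "(real^'n::finite \<Rightarrow> real^'m) \<Rightarrow> real^'n \<Rightarrow> real^'n^'m" where
  "jacmat \<phi> x = (\<chi> k i. pd i (\<lambda>y. \<phi> y $ k) x)"

lemma dvec_compose:
  assumes "\<And>k. (\<lambda>y. \<phi> y $ k) differentiable (at x)" "u differentiable (at (\<phi> x))"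
  shows "dvec (\<lambda>y. u (\<phi> y)) x = transpose (jacmat \<phi> x) *v dvec u (\<phi> x)"
  by (simp add: vec_eq_iff dvec_def jacmat_def matrix_vector_mult_def transpose_def
      pd_chain(1)[OF assms] del: transpose_matrix_vector)

lemma jacobian_compose:
  assumes "\<And>k. (\<lambda>y. \<phi> y $ k) differentiable (at x)" "\<And>k. (\<lambda>y. \<psi> y $ k) differentiable (at (\<phi> x))"
  shows "jacmat (\<lambda>y. \<psi> (\<phi> y)) x = jacmat \<psi> (\<phi> x) ** jacmat \<phi> x"
  by (simp add: vec_eq_iff jacmat_def matrix_mult_nth pd_chain(1)[OF assms] mult.commute)

lemma jacobian_ident:
  fixes x :: "real^'n::finite"
  shows "jacmat (\<lambda>y. y) x = mat 1"
proof -
  have "pd i (\<lambda>y::real^'n. y $ k) x = (if k = i then 1 else 0)" for i k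
    by (subst pd_eqI[where D = "\<lambda>h. h $ k"])
      (auto intro!: bounded_linear_imp_has_derivative bounded_linear_vec_nth simp: axis_def)
  then show ?thesis by (simp add: jacmat_def mat_def vec_eq_iff)
qed

lemma jacobian_cong:
  assumes "open S" "x \<in> S" "\<And>y. y \<in> S \<Longrightarrow> \<phi> y = \<psi> y"
  shows "jacmat \<phi> x = jacmat \<psi> x"
  unfolding jacmat_def using assms by (intro Cart_lambda_cong pd_cong[OF assms(1,2)]) simp

text \<open>The linear algebra of a single tangent space; \<open>J\<close> is going to be the
  Jacobian of a chart transition.\<close>

locale frame_change =
  fixes G G' J :: "real^'n^'n"
  assumes posdef_G: "posdef G" and posdef_G': "posdef G'" and J: "invertible J"
    and G_eq: "G = transpose J ** G' ** J"
begin

lemma inverse_eq: "J ** matrix_inv G ** transpose J = matrix_inv G'"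
proof -
  have t: "invertible (transpose J)" using J by (simp add: transpose_invertible)
  have "transpose J ** (G' ** (J ** matrix_inv G ** transpose J)) = G ** matrix_inv G ** transpose J"
    by (simp add: G_eq matrix_mul_assoc)
  also have "\<dots> = transpose J ** mat 1"
    by (simp add: matrix_inv_mult[OF posdef_invertible[OF posdef_G]])
  finally have "matrix_inv (transpose J) ** (transpose J ** (G' ** (J ** matrix_inv G ** transpose J)))
      = matrix_inv (transpose J) ** (transpose J ** mat 1)" by simp
  then have "G' ** (J ** matrix_inv G ** transpose J) = mat 1"
    by (simp add: matrix_mul_assoc matrix_inv_mult[OF t])
  then show ?thesis by (rule matrix_inv_eqI[symmetric])
qed

lemma trace_invariant:
  assumes "T = transpose J ** T' ** J"
  shows "trace (matrix_inv G ** T) = trace (matrix_inv G' ** T')"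
proof -
  have "trace (matrix_inv G ** T) = trace ((matrix_inv G ** transpose J ** T') ** J)"
    by (simp add: assms matrix_mul_assoc)
  also have "\<dots> = trace (J ** (matrix_inv G ** transpose J ** T'))" by (rule trace_mul_sym)
  also have "\<dots> = trace (J ** matrix_inv G ** transpose J ** T')" by (simp add: matrix_mul_assoc)
  finally show ?thesis by (simp add: inverse_eq)
qed

lemma frob2_invariant:
  assumes "T = transpose J ** T' ** J"
  shows "frob2 (matrix_inv G) T = frob2 (matrix_inv G') T'"
proof -
  have "frob2 (matrix_inv G) T =
      trace (transpose J ** (transpose T' ** (J ** matrix_inv G ** transpose J) ** T' ** J ** matrix_inv G))"
    by (simp add: frob2_def assms matrix_mul_assoc matrix_transpose_mul)
  also have "\<dots> = trace ((transpose T' ** (J ** matrix_inv G ** transpose J) ** T' ** J ** matrix_inv G) ** transpose J)"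
    by (rule trace_mul_sym)
  also have "\<dots> = trace (transpose T' ** (J ** matrix_inv G ** transpose J) ** T' ** (J ** matrix_inv G ** transpose J))"
    by (simp add: matrix_mul_assoc)
  finally show ?thesis by (simp add: inverse_eq frob2_def)
qed

lemma inner_transpose_mult: "(transpose J *v a) \<bullet> b = a \<bullet> (J *v b)" for a b :: "real^'n"
  by (metis dot_lmul_matrix inner_commute transpose_matrix_vector)

lemma inner_invariant:
  assumes "a = transpose J *v a'" "b = transpose J *v b'"
  shows "a \<bullet> (matrix_inv G *v b) = a' \<bullet> (matrix_inv G' *v b')"
  unfolding assms inner_transpose_mult inverse_eq[symmetric]
  by (simp add: matrix_vector_mul_assoc matrix_mul_assoc del: transpose_matrix_vector)

lemma bilinear_invariant:
  assumes "a = transpose J *v a'" "b = transpose J *v b'" "T = transpose J ** T' ** J"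
  shows "a \<bullet> ((matrix_inv G ** T ** matrix_inv G) *v b) = a' \<bullet> ((matrix_inv G' ** T' ** matrix_inv G') *v b')"
  unfolding assms inner_transpose_mult inverse_eq[symmetric]
  by (simp add: matrix_vector_mul_assoc matrix_mul_assoc del: transpose_matrix_vector)

text \<open>The factor is the one of the change of variables formula, so the volume density does not
  depend on the chart.\<close>

lemma sqrt_det_invariant: "sqrt (det G) = \<bar>det J\<bar> * sqrt (det G')"
proof -
  have "det G = (det J)\<^sup>2 * det G'" by (simp add: G_eq det_mul power2_eq_square)
  then show ?thesis by (simp add: real_sqrt_mult)
qed

end

lemma sum3_swap12:
  "(\<Sum>m\<in>A. \<Sum>k\<in>A. \<Sum>l\<in>A. f m k l) = (\<Sum>m\<in>A. \<Sum>k\<in>A. \<Sum>l\<in>A. f k m (l :: 'n) :: real)"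
  by (rule sum.swap)

lemma sum3_rotate:
  "(\<Sum>m\<in>A. \<Sum>k\<in>A. \<Sum>l\<in>A. f m k l) = (\<Sum>m\<in>A. \<Sum>k\<in>A. \<Sum>l\<in>A. f l m (k :: 'n) :: real)"
proof -
  have "(\<Sum>m\<in>A. \<Sum>k\<in>A. \<Sum>l\<in>A. f m k l) = (\<Sum>k\<in>A. \<Sum>m\<in>A. \<Sum>l\<in>A. f m k l)" by (rule sum.swap)
  also have "\<dots> = (\<Sum>k\<in>A. \<Sum>l\<in>A. \<Sum>m\<in>A. f m k l)" by (intro sum.cong refl sum.swap)
  finally show ?thesis .
qed

locale coordinate_change = L: local_metric U G + L': local_metric U' G'
  for U :: "(real^'n::finite) set" and G and U' :: "(real^'n) set" and G' +
  fixes \<phi> :: "real^'n \<Rightarrow> real^'n" and S :: "(real^'n) set"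
  assumes open_S: "open S" and S_U: "S \<subseteq> U" and \<phi>_U': "\<And>x. x \<in> S \<Longrightarrow> \<phi> x \<in> U'"
    and \<phi>_smooth: "\<And>k. smooth_on S (\<lambda>x. \<phi> x $ k)"
    and jac_invertible: "\<And>x. x \<in> S \<Longrightarrow> invertible (jacmat \<phi> x)"
    and metric_eq: "\<And>x. x \<in> S \<Longrightarrow> G x = transpose (jacmat \<phi> x) ** G' (\<phi> x) ** jacmat \<phi> x"
begin

lemma frame_change: "x \<in> S \<Longrightarrow> frame_change (G x) (G' (\<phi> x)) (jacmat \<phi> x)"
  using S_U by (intro frame_change.intro L.G_posdef L'.G_posdef \<phi>_U' jac_invertible metric_eq) auto

lemma \<phi>_differentiable: "x \<in> S \<Longrightarrow> (\<lambda>y. \<phi> y $ k) differentiable (at x)"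
  by (rule smooth_on_differentiable[OF \<phi>_smooth open_S])

lemma jacobian_smooth: "smooth_on S (\<lambda>x. jacmat \<phi> x $ k $ i)"
  by (simp add: jacmat_def smooth_on_pd \<phi>_smooth)

lemma jacobian_differentiable: "x \<in> S \<Longrightarrow> (\<lambda>y. jacmat \<phi> y $ k $ i) differentiable (at x)"
  by (rule smooth_on_differentiable[OF jacobian_smooth open_S])

lemma pderiv_jacobian_symmetric:
  "x \<in> S \<Longrightarrow> pd i (\<lambda>y. jacmat \<phi> y $ k $ j) x = pd j (\<lambda>y. jacmat \<phi> y $ k $ i) x"
  by (simp add: jacmat_def pd_commute[OF open_S smooth_on_Ck_on[OF \<phi>_smooth], of x i j])

section \<open>Transformation of Christoffel symbols and of the Hessian\<close>

text \<open>The product rule for \<open>J^t G' J\<close>. The two terms with second derivatives of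
  \<open>\<phi>\<close> are brought, by symmetry of \<open>G'\<close>, to one shape with
  \<open>j\<close> and \<open>a\<close> exchanged.\<close>

lemma pderiv_metric:
  assumes x: "x \<in> S"
  shows "pd i (\<lambda>y. G y $ j $ a) x =
    (\<Sum>k\<in>UNIV. \<Sum>l\<in>UNIV. pd i (\<lambda>y. jacmat \<phi> y $ k $ j) x * jacmat \<phi> x $ l $ a * G' (\<phi> x) $ k $ l)
    + (\<Sum>k\<in>UNIV. \<Sum>l\<in>UNIV. pd i (\<lambda>y. jacmat \<phi> y $ k $ a) x * jacmat \<phi> x $ l $ j * G' (\<phi> x) $ k $ l)
    + (\<Sum>m\<in>UNIV. \<Sum>k\<in>UNIV. \<Sum>l\<in>UNIV. jacmat \<phi> x $ m $ i * jacmat \<phi> x $ k $ j * jacmat \<phi> x $ l $ a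
        * pd m (\<lambda>y. G' y $ k $ l) (\<phi> x))"
proof -
  note dJ = jacobian_differentiable[OF x]
  have dG': "(\<lambda>y. G' y $ k $ l) differentiable (at (\<phi> x))" for k l
    by (rule msmooth_on_differentiable[OF L'.open_U L'.G_smooth \<phi>_U'[OF x]])
  note ch = pd_chain[OF \<phi>_differentiable[OF x] dG']
  let ?J = "jacmat \<phi> x"
  have "pd i (\<lambda>y. G y $ j $ a) x =
      pd i (\<lambda>y. \<Sum>k\<in>UNIV. \<Sum>l\<in>UNIV. jacmat \<phi> y $ k $ j * (jacmat \<phi> y $ l $ a * G' (\<phi> y) $ k $ l)) x"
  proof (rule pd_cong[OF open_S x])
    fix y assume y: "y \<in> S"
    have "G y $ j $ a = (\<Sum>l\<in>UNIV. \<Sum>k\<in>UNIV. jacmat \<phi> y $ k $ j * (jacmat \<phi> y $ l $ a * G' (\<phi> y) $ k $ l))"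
      by (simp add: metric_eq[OF y] matrix_mult_nth transpose_nth sum_distrib_left ac_simps)
    then show "G y $ j $ a = (\<Sum>k\<in>UNIV. \<Sum>l\<in>UNIV. jacmat \<phi> y $ k $ j * (jacmat \<phi> y $ l $ a * G' (\<phi> y) $ k $ l))"
      by (subst sum.swap)
  qed
  also have "\<dots> = (\<Sum>k\<in>UNIV. \<Sum>l\<in>UNIV.
      pd i (\<lambda>y. jacmat \<phi> y $ k $ j * (jacmat \<phi> y $ l $ a * G' (\<phi> y) $ k $ l)) x)"
  proof -
    have d: "(\<lambda>y. jacmat \<phi> y $ k $ j * (jacmat \<phi> y $ l $ a * G' (\<phi> y) $ k $ l)) differentiable (at x)" for k l
      by (intro differentiable_mult dJ ch(2))
    show ?thesis
      by (simp add: pd_sum d)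
  qed
  also have "\<dots> = (\<Sum>k\<in>UNIV. \<Sum>l\<in>UNIV.
      pd i (\<lambda>y. jacmat \<phi> y $ k $ j) x * ?J $ l $ a * G' (\<phi> x) $ k $ l
      + pd i (\<lambda>y. jacmat \<phi> y $ l $ a) x * ?J $ k $ j * G' (\<phi> x) $ k $ l
      + (\<Sum>m\<in>UNIV. ?J $ m $ i * ?J $ k $ j * ?J $ l $ a * pd m (\<lambda>y. G' y $ k $ l) (\<phi> x)))"
  proof (intro sum.cong refl)
    fix k l
    have "pd i (\<lambda>y. jacmat \<phi> y $ k $ j * (jacmat \<phi> y $ l $ a * G' (\<phi> y) $ k $ l)) x =
      pd i (\<lambda>y. jacmat \<phi> y $ k $ j) x * (?J $ l $ a * G' (\<phi> x) $ k $ l) + ?J $ k $ j *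
       (pd i (\<lambda>y. jacmat \<phi> y $ l $ a) x * G' (\<phi> x) $ k $ l + ?J $ l $ a *
         (\<Sum>m\<in>UNIV. ?J $ m $ i * pd m (\<lambda>y. G' y $ k $ l) (\<phi> x)))"
      by (subst pd_mult, (intro differentiable_mult dJ ch(2))+,
          subst pd_mult, (intro dJ ch(2))+) (simp add: ch(1) jacmat_def)
    then show "pd i (\<lambda>y. jacmat \<phi> y $ k $ j * (jacmat \<phi> y $ l $ a * G' (\<phi> y) $ k $ l)) x =
      pd i (\<lambda>y. jacmat \<phi> y $ k $ j) x * ?J $ l $ a * G' (\<phi> x) $ k $ l
      + pd i (\<lambda>y. jacmat \<phi> y $ l $ a) x * ?J $ k $ j * G' (\<phi> x) $ k $ l
      + (\<Sum>m\<in>UNIV. ?J $ m $ i * ?J $ k $ j * ?J $ l $ a * pd m (\<lambda>y. G' y $ k $ l) (\<phi> x))"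
      by (simp add: sum_distrib_left algebra_simps)
  qed
  also have "\<dots> = (\<Sum>k\<in>UNIV. \<Sum>l\<in>UNIV. pd i (\<lambda>y. jacmat \<phi> y $ k $ j) x * ?J $ l $ a * G' (\<phi> x) $ k $ l)
    + (\<Sum>k\<in>UNIV. \<Sum>l\<in>UNIV. pd i (\<lambda>y. jacmat \<phi> y $ l $ a) x * ?J $ k $ j * G' (\<phi> x) $ k $ l)
    + (\<Sum>k\<in>UNIV. \<Sum>l\<in>UNIV. \<Sum>m\<in>UNIV. ?J $ m $ i * ?J $ k $ j * ?J $ l $ a * pd m (\<lambda>y. G' y $ k $ l) (\<phi> x))"
    by (simp add: sum.distrib)
  also have "(\<Sum>k\<in>UNIV. \<Sum>l\<in>UNIV. \<Sum>m\<in>UNIV. ?J $ m $ i * ?J $ k $ j * ?J $ l $ a * pd m (\<lambda>y. G' y $ k $ l) (\<phi> x))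
     = (\<Sum>m\<in>UNIV. \<Sum>k\<in>UNIV. \<Sum>l\<in>UNIV. ?J $ m $ i * ?J $ k $ j * ?J $ l $ a * pd m (\<lambda>y. G' y $ k $ l) (\<phi> x))"
    by (rule sum3_rotate[symmetric])
  also have "(\<Sum>k\<in>UNIV. \<Sum>l\<in>UNIV. pd i (\<lambda>y. jacmat \<phi> y $ l $ a) x * ?J $ k $ j * G' (\<phi> x) $ k $ l)
    = (\<Sum>k\<in>UNIV. \<Sum>l\<in>UNIV. pd i (\<lambda>y. jacmat \<phi> y $ k $ a) x * ?J $ l $ j * G' (\<phi> x) $ k $ l)"
    by (subst sum.swap) (simp add: posdef_symmetric[OF L'.G_posdef[OF \<phi>_U'[OF x]]])
  finally show ?thesis .
qed

text \<open>The inhomogeneous transformation law. The second-derivative terms \<open>E\<close> are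
  symmetric in their first two indices, so of the six in the Koszul formula four cancel and two
  coincide.\<close>

lemma christoffel_lowered_transform:
  assumes x: "x \<in> S"
  shows "(G x ** L.\<Gamma> i x) $ a $ j =
    (\<Sum>k\<in>UNIV. \<Sum>l\<in>UNIV. pd i (\<lambda>y. jacmat \<phi> y $ k $ j) x * jacmat \<phi> x $ l $ a * G' (\<phi> x) $ k $ l)
    + (\<Sum>m\<in>UNIV. \<Sum>k\<in>UNIV. \<Sum>l\<in>UNIV. jacmat \<phi> x $ m $ i * jacmat \<phi> x $ k $ j * jacmat \<phi> x $ l $ a
        * (G' (\<phi> x) ** L'.\<Gamma> m (\<phi> x)) $ l $ k)"
proof -
  let ?J = "jacmat \<phi> x"
  define E where "E i j a = (\<Sum>k\<in>UNIV. \<Sum>l\<in>UNIV. pd i (\<lambda>y. jacmat \<phi> y $ k $ j) x * ?J $ l $ a * G' (\<phi> x) $ k $ l)" for i j a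
  define D where "D i j a = (\<Sum>m\<in>UNIV. \<Sum>k\<in>UNIV. \<Sum>l\<in>UNIV. ?J $ m $ i * ?J $ k $ j * ?J $ l $ a
        * pd m (\<lambda>y. G' y $ k $ l) (\<phi> x))" for i j a
  have E_sym: "E i j a = E j i a" for i j a
    unfolding E_def using pderiv_jacobian_symmetric[OF x] by metis
  have dG: "pd i (\<lambda>y. G y $ j $ a) x = E i j a + E i a j + D i j a" for i j a
    unfolding E_def D_def by (rule pderiv_metric[OF x])
  have D2: "D j i a = (\<Sum>m\<in>UNIV. \<Sum>k\<in>UNIV. \<Sum>l\<in>UNIV. ?J $ m $ i * ?J $ k $ j * ?J $ l $ a
        * pd k (\<lambda>y. G' y $ m $ l) (\<phi> x))"
    unfolding D_def by (subst sum3_swap12) (simp add: ac_simps)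
  have D3: "D a i j = (\<Sum>m\<in>UNIV. \<Sum>k\<in>UNIV. \<Sum>l\<in>UNIV. ?J $ m $ i * ?J $ k $ j * ?J $ l $ a
        * pd l (\<lambda>y. G' y $ m $ k) (\<phi> x))"
    unfolding D_def by (subst sum3_rotate) (simp add: ac_simps)
  have "(\<Sum>m\<in>UNIV. \<Sum>k\<in>UNIV. \<Sum>l\<in>UNIV. ?J $ m $ i * ?J $ k $ j * ?J $ l $ a
        * (G' (\<phi> x) ** L'.\<Gamma> m (\<phi> x)) $ l $ k) = 1 / 2 * (D i j a + D j i a - D a i j)"
    unfolding D2 D3 unfolding D_def L'.chris_lowered[OF \<phi>_U'[OF x]]
      sum.distrib[symmetric] sum_subtractf[symmetric] sum_distrib_left
    by (intro sum.cong refl) (simp add: algebra_simps)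
  then show ?thesis
    using L.chris_lowered[of x i a j] x S_U E_sym[of j i a] E_sym[of j a i] E_sym[of i a j]
    unfolding dG E_def[symmetric] by auto
qed

text \<open>The second derivatives of \<open>\<phi>\<close> enter both the iterated partial
  derivatives of \<open>u\<close> and the Christoffel term, and cancel in the difference. What is
  left is tensorial.\<close>

lemma hessian_transform:
  assumes u': "smooth_on U' u'" and u: "\<And>y. y \<in> S \<Longrightarrow> u y = u' (\<phi> y)" and x: "x \<in> S"
  shows "lhess G u x = transpose (jacmat \<phi> x) ** lhess G' u' (\<phi> x) ** jacmat \<phi> x"
proof -
  let ?J = "jacmat \<phi> x"
  interpret FC: frame_change "G x" "G' (\<phi> x)" "jacmat \<phi> x" by (rule frame_change[OF x])
  have xU: "x \<in> U" using x S_U by blast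
  have du': "u' differentiable (at (\<phi> y))" if "y \<in> S" for y
    by (rule smooth_on_differentiable[OF u' L'.open_U \<phi>_U'[OF that]])
  have ddu': "pd k u' differentiable (at (\<phi> x))" for k
    by (rule smooth_on_differentiable[OF smooth_on_pd[OF u'] L'.open_U \<phi>_U'[OF x]])
  have d1: "pd j u y = (\<Sum>k\<in>UNIV. jacmat \<phi> y $ k $ j * pd k u' (\<phi> y))" if y: "y \<in> S" for y j
    using pd_chain(1)[OF \<phi>_differentiable[OF y] du'[OF y], of j]
    by (subst pd_cong[OF open_S y u]) (simp_all add: jacmat_def)
  note ch = pd_chain[OF \<phi>_differentiable[OF x] ddu']
  have d2: "pd i (pd j u) x =
      (\<Sum>k\<in>UNIV. pd i (\<lambda>y. jacmat \<phi> y $ k $ j) x * pd k u' (\<phi> x))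
      + (\<Sum>k\<in>UNIV. ?J $ k $ j * (\<Sum>l\<in>UNIV. ?J $ l $ i * pd l (pd k u') (\<phi> x)))" for i j
  proof -
    have "pd i (pd j u) x = pd i (\<lambda>y. \<Sum>k\<in>UNIV. jacmat \<phi> y $ k $ j * pd k u' (\<phi> y)) x"
      by (rule pd_cong[OF open_S x d1])
    also have "\<dots> = (\<Sum>k\<in>UNIV. pd i (\<lambda>y. jacmat \<phi> y $ k $ j * pd k u' (\<phi> y)) x)"
      by (intro pd_sum differentiable_mult jacobian_differentiable[OF x] ch(2))
    also have "\<dots> = (\<Sum>k\<in>UNIV. pd i (\<lambda>y. jacmat \<phi> y $ k $ j) x * pd k u' (\<phi> x)
        + ?J $ k $ j * (\<Sum>l\<in>UNIV. ?J $ l $ i * pd l (pd k u') (\<phi> x)))"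
      by (subst pd_mult[OF jacobian_differentiable[OF x] ch(2)]) (simp add: ch(1) jacmat_def)
    finally show ?thesis by (simp add: sum.distrib)
  qed
  define w where "w = matrix_inv (G x) *v dvec u x"
  define w' where "w' = matrix_inv (G' (\<phi> x)) *v dvec u' (\<phi> x)"
  have dvec_u: "dvec u x = transpose ?J *v dvec u' (\<phi> x)"
    by (simp add: vec_eq_iff dvec_def d1[OF x] matrix_vector_mult_def transpose_def del: transpose_matrix_vector)
  have Jw: "?J *v w = w'"
    unfolding w_def w'_def dvec_u FC.inverse_eq[symmetric]
    by (simp add: matrix_vector_mul_assoc matrix_mul_assoc del: transpose_matrix_vector)
  \<comment> \<open>Trades the Christoffel symbols for their lowered form, paired with the gradient,
    whose components transform by \<open>J\<close> alone (\<open>Jw\<close>). It is stated for an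
    arbitrary metric because both charts use it.\<close>
  have lowered: "(\<Sum>k\<in>UNIV. lchris H i y $ k $ j * pd k v y)
      = (\<Sum>a\<in>UNIV. (H y ** lchris H i y) $ a $ j * (matrix_inv (H y) *v dvec v y) $ a)"
    if "local_metric V H" "y \<in> V" for V H v y i j
  proof -
    interpret K: local_metric V H by fact
    have "H y *v (matrix_inv (H y) *v dvec v y) = dvec v y"
      by (simp add: matrix_vector_mul_assoc K.G_inverse[OF that(2)])
    then have v: "pd k v y = (\<Sum>a\<in>UNIV. H y $ a $ k * (matrix_inv (H y) *v dvec v y) $ a)" for k
      unfolding posdef_symmetric[OF K.G_posdef[OF that(2)], of _ k]
      by (metis (no_types, lifting) dvec_def matrix_vector_mult_def sum.cong vec_lambda_beta)
    have "(\<Sum>k\<in>UNIV. lchris H i y $ k $ j * pd k v y) =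
        (\<Sum>k\<in>UNIV. \<Sum>a\<in>UNIV. H y $ a $ k * lchris H i y $ k $ j * (matrix_inv (H y) *v dvec v y) $ a)"
      unfolding v sum_distrib_left by (intro sum.cong refl) (simp add: ac_simps)
    also have "\<dots> = (\<Sum>a\<in>UNIV. (H y ** lchris H i y) $ a $ j * (matrix_inv (H y) *v dvec v y) $ a)"
      unfolding matrix_mult_nth sum_distrib_right by (rule sum.swap)
    finally show ?thesis .
  qed
  have chr: "(\<Sum>k\<in>UNIV. L.\<Gamma> i x $ k $ j * pd k u x) =
      (\<Sum>k\<in>UNIV. pd i (\<lambda>y. jacmat \<phi> y $ k $ j) x * pd k u' (\<phi> x))
      + (\<Sum>k\<in>UNIV. \<Sum>m\<in>UNIV. ?J $ k $ j * ?J $ m $ i * (\<Sum>l\<in>UNIV. L'.\<Gamma> m (\<phi> x) $ l $ k * pd l u' (\<phi> x)))" for i j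
  proof -
    have "(\<Sum>k\<in>UNIV. L.\<Gamma> i x $ k $ j * pd k u x) =
        (\<Sum>a\<in>UNIV. (\<Sum>k\<in>UNIV. \<Sum>l\<in>UNIV. pd i (\<lambda>y. jacmat \<phi> y $ k $ j) x * ?J $ l $ a * G' (\<phi> x) $ k $ l) * w $ a)
        + (\<Sum>a\<in>UNIV. (\<Sum>m\<in>UNIV. \<Sum>k\<in>UNIV. \<Sum>l\<in>UNIV. ?J $ m $ i * ?J $ k $ j * ?J $ l $ a
        * (G' (\<phi> x) ** L'.\<Gamma> m (\<phi> x)) $ l $ k) * w $ a)"
      unfolding lowered[OF L.local_metric_axioms xU] w_def[symmetric] christoffel_lowered_transform[OF x]
      by (simp add: distrib_right sum.distrib)
    also have "(\<Sum>a\<in>UNIV. (\<Sum>k\<in>UNIV. \<Sum>l\<in>UNIV. pd i (\<lambda>y. jacmat \<phi> y $ k $ j) x * ?J $ l $ a * G' (\<phi> x) $ k $ l) * w $ a)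
        = (\<Sum>k\<in>UNIV. pd i (\<lambda>y. jacmat \<phi> y $ k $ j) x * pd k u' (\<phi> x))"
    proof -
      have "(\<Sum>a\<in>UNIV. (\<Sum>k\<in>UNIV. \<Sum>l\<in>UNIV. pd i (\<lambda>y. jacmat \<phi> y $ k $ j) x * ?J $ l $ a * G' (\<phi> x) $ k $ l) * w $ a)
        = (\<Sum>a\<in>UNIV. \<Sum>k\<in>UNIV. \<Sum>l\<in>UNIV. pd i (\<lambda>y. jacmat \<phi> y $ k $ j) x * (G' (\<phi> x) $ k $ l * (?J $ l $ a * w $ a)))"
        by (simp add: sum_distrib_left ac_simps)
      also have "\<dots> = (\<Sum>k\<in>UNIV. \<Sum>l\<in>UNIV. \<Sum>a\<in>UNIV. pd i (\<lambda>y. jacmat \<phi> y $ k $ j) x * (G' (\<phi> x) $ k $ l * (?J $ l $ a * w $ a)))"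
        by (rule sum3_rotate)
      also have "\<dots> = (\<Sum>k\<in>UNIV. pd i (\<lambda>y. jacmat \<phi> y $ k $ j) x * (G' (\<phi> x) *v (?J *v w)) $ k)"
        by (simp add: matrix_vector_mult_def sum_distrib_left)
      also have "G' (\<phi> x) *v (?J *v w) = dvec u' (\<phi> x)"
        by (simp add: Jw w'_def matrix_vector_mul_assoc L'.G_inverse[OF \<phi>_U'[OF x]])
      finally show ?thesis by (simp add: dvec_def)
    qed
    also have "(\<Sum>a\<in>UNIV. (\<Sum>m\<in>UNIV. \<Sum>k\<in>UNIV. \<Sum>l\<in>UNIV. ?J $ m $ i * ?J $ k $ j * ?J $ l $ a
        * (G' (\<phi> x) ** L'.\<Gamma> m (\<phi> x)) $ l $ k) * w $ a)
       = (\<Sum>k\<in>UNIV. \<Sum>m\<in>UNIV. ?J $ k $ j * ?J $ m $ i * (\<Sum>l\<in>UNIV. L'.\<Gamma> m (\<phi> x) $ l $ k * pd l u' (\<phi> x)))"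
    proof -
      let ?f = "\<lambda>m k l a. ?J $ k $ j * ?J $ m $ i * ((G' (\<phi> x) ** L'.\<Gamma> m (\<phi> x)) $ l $ k * (?J $ l $ a * w $ a))"
      have "(\<Sum>a\<in>UNIV. (\<Sum>m\<in>UNIV. \<Sum>k\<in>UNIV. \<Sum>l\<in>UNIV. ?J $ m $ i * ?J $ k $ j * ?J $ l $ a
        * (G' (\<phi> x) ** L'.\<Gamma> m (\<phi> x)) $ l $ k) * w $ a) = (\<Sum>a\<in>UNIV. \<Sum>m\<in>UNIV. \<Sum>k\<in>UNIV. \<Sum>l\<in>UNIV. ?f m k l a)"
        by (simp add: sum_distrib_left ac_simps)
      also have "\<dots> = (\<Sum>m\<in>UNIV. \<Sum>k\<in>UNIV. \<Sum>a\<in>UNIV. \<Sum>l\<in>UNIV. ?f m k l a)"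
        by (rule sum3_rotate)
      also have "\<dots> = (\<Sum>k\<in>UNIV. \<Sum>m\<in>UNIV. \<Sum>l\<in>UNIV. \<Sum>a\<in>UNIV. ?f m k l a)"
        by (subst sum.swap) (intro sum.cong refl sum.swap)
      also have "\<dots> = (\<Sum>k\<in>UNIV. \<Sum>m\<in>UNIV. ?J $ k $ j * ?J $ m $ i * (\<Sum>l\<in>UNIV. (G' (\<phi> x) ** L'.\<Gamma> m (\<phi> x)) $ l $ k * (?J *v w) $ l))"
        by (simp add: matrix_vector_mult_def[of ?J] sum_distrib_left)
      finally show ?thesis
        unfolding lowered[OF L'.local_metric_axioms \<phi>_U'[OF x]] Jw w'_def .
    qed
    finally show ?thesis .
  qed
  have "lhess G u x $ i $ j = (transpose ?J ** lhess G' u' (\<phi> x) ** ?J) $ i $ j" for i j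
  proof -
    have "lhess G u x $ i $ j = (\<Sum>k\<in>UNIV. \<Sum>m\<in>UNIV. ?J $ k $ j * ?J $ m $ i * lhess G' u' (\<phi> x) $ m $ k)"
      unfolding lhess_def vec_lambda_beta d2 chr
      by (simp add: sum_distrib_left sum_subtractf[symmetric] right_diff_distrib ac_simps)
    then show ?thesis
      by (simp add: matrix_mult_nth transpose_nth sum_distrib_left ac_simps)
  qed
  then show ?thesis by (simp add: vec_eq_iff)
qed

end

section \<open>Riemannian manifolds\<close>

abbreviation img :: "('a, 'n) chart \<Rightarrow> (real^'n) set" where
  "img c \<equiv> coord c ` cdom c"

lemma is_chart_param:
  assumes "is_chart M c"
  shows "p \<in> cdom c \<Longrightarrow> param c (coord c p) = p"
    and "x \<in> img c \<Longrightarrow> coord c (param c x) = x"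
    and "x \<in> img c \<Longrightarrow> param c x \<in> cdom c"
  using assms unfolding is_chart_def homeomorphism_def by auto

locale riemannian_manifold =
  fixes M :: "'a::{t2_space,second_countable_topology} set"
    and A :: "('a, 'n::finite) chart set"
    and g :: "('a, 'n) tensor2"
  assumes manifold: "smooth_manifold M A" and metric: "riemannian_metric A g"
begin

lemma charts: "c \<in> A \<Longrightarrow> is_chart M c"
  using manifold by (simp add: smooth_manifold_def)

lemmas param_coord [simp] = is_chart_param(1)[OF charts]
lemmas coord_param [simp] = is_chart_param(2)[OF charts]
lemmas param_in [simp] = is_chart_param(3)[OF charts]

lemma openin_cdom: "c \<in> A \<Longrightarrow> openin (top_of_set M) (cdom c)"
  using charts is_chart_def by blast

lemma open_image: "c \<in> A \<Longrightarrow> open (img c)"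
  using charts is_chart_def by blast

lemma homeo: "c \<in> A \<Longrightarrow> homeomorphism (cdom c) (img c) (coord c) (param c)"
  using charts is_chart_def by blast

lemma cdom_subset: "c \<in> A \<Longrightarrow> cdom c \<subseteq> M"
  using openin_cdom openin_imp_subset by blast

lemma chart_at:
  assumes "p \<in> M"
  shows "chart_at A p \<in> A" "p \<in> cdom (chart_at A p)"
proof -
  have "\<exists>c. c \<in> A \<and> p \<in> cdom c"
    using manifold assms by (auto simp: smooth_manifold_def)
  then have "chart_at A p \<in> A \<and> p \<in> cdom (chart_at A p)"
    unfolding chart_at_def by (rule someI_ex)
  then show "chart_at A p \<in> A" "p \<in> cdom (chart_at A p)" by auto
qed

definition loc :: "('a, 'n) chart \<Rightarrow> real^'n \<Rightarrow> real^'n^'n" where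
  "loc c x = g c (param c x)"

lemma posdef_g:
  assumes "c \<in> A" "p \<in> cdom c"
  shows "posdef (g c p)"
proof -
  have "\<forall>i j. g c p $ i $ j = g c p $ j $ i" "\<forall>v. v \<noteq> 0 \<longrightarrow> v \<bullet> (g c p *v v) > 0"
    using metric assms unfolding riemannian_metric_def by blast+
  then show ?thesis by (auto simp: posdef_def vec_eq_iff transpose_nth)
qed

lemma local_metric_loc:
  assumes c: "c \<in> A"
  shows "local_metric (img c) (loc c)"
proof
  show "open (img c)" by (rule open_image[OF c])
  show "msmooth_on (img c) (loc c)"
    using metric c unfolding riemannian_metric_def msmooth_on_def loc_def by blast
  show "posdef (loc c x)" if "x \<in> img c" for x
    using that c by (auto simp: loc_def posdef_g)
qed

definition ovl :: "('a, 'n) chart \<Rightarrow> ('a, 'n) chart \<Rightarrow> (real^'n) set" where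
  "ovl c d = coord c ` (cdom c \<inter> cdom d)"

definition trans_map :: "('a, 'n) chart \<Rightarrow> ('a, 'n) chart \<Rightarrow> real^'n \<Rightarrow> real^'n" where
  "trans_map c d x = coord d (param c x)"

lemma ovl_subset: "ovl c d \<subseteq> img c"
  by (auto simp: ovl_def)

lemma open_ovl:
  assumes "c \<in> A" "d \<in> A"
  shows "open (ovl c d)"
proof -
  have "openin (top_of_set M) (cdom c \<inter> cdom d)"
    using openin_cdom assms by blast
  then have "openin (top_of_set (cdom c)) (cdom c \<inter> cdom d)"
    using cdom_subset[OF assms(1)] by (meson inf_le1 openin_subset_trans)
  then have "openin (top_of_set (img c)) (ovl c d)"
    unfolding ovl_def using homeomorphism_imp_open_map[OF homeo[OF assms(1)]] by blast
  then show ?thesis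
    using open_image[OF assms(1)] openin_open_trans by blast
qed

lemma trans_map_ovl:
  assumes "c \<in> A" "d \<in> A" "x \<in> ovl c d"
  shows "trans_map c d x \<in> ovl d c" "param d (trans_map c d x) = param c x"
    "trans_map d c (trans_map c d x) = x"
  using assms by (auto simp: ovl_def trans_map_def)

lemma trans_map_smooth: "c \<in> A \<Longrightarrow> d \<in> A \<Longrightarrow> smooth_on (ovl c d) (\<lambda>x. trans_map c d x $ k)"
  using manifold unfolding smooth_manifold_def ovl_def trans_map_def by blast

lemma trans_map_differentiable:
  "c \<in> A \<Longrightarrow> d \<in> A \<Longrightarrow> x \<in> ovl c d \<Longrightarrow> (\<lambda>x. trans_map c d x $ k) differentiable (at x)"
  using smooth_on_differentiable[OF trans_map_smooth open_ovl] by blast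

text \<open>Quantities evaluated in the chart selected by \<open>chart_at\<close> are carried to a
  given chart \<open>c\<close> by means of these facts about the transition.\<close>

lemma chart_at_param:
  fixes c :: "('a, 'n) chart" and x :: "real^'n"
  assumes c: "c \<in> A" and x: "x \<in> img c"
  defines "d \<equiv> chart_at A (param c x)"
  shows "param c x \<in> M" "d \<in> A" "x \<in> ovl c d" "coord d (param c x) = trans_map c d x"
    "trans_map c d x \<in> img d" "param d (trans_map c d x) = param c x"
proof -
  show p: "param c x \<in> M" using param_in[OF c x] cdom_subset[OF c] by blast
  note d = chart_at[OF p, folded d_def]
  show "d \<in> A" by (rule d(1))
  show "x \<in> ovl c d"
    unfolding ovl_def using param_in[OF c x] d(2) coord_param[OF c x] by (intro image_eqI[of _ _ "param c x"]) auto
  show "coord d (param c x) = trans_map c d x" "trans_map c d x \<in> img d"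
    "param d (trans_map c d x) = param c x"
    using d by (auto simp: trans_map_def)
qed

lemma jacmat_trans_map_inverse:
  assumes "c \<in> A" "d \<in> A" "x \<in> ovl c d"
  shows "jacmat (trans_map d c) (trans_map c d x) ** jacmat (trans_map c d) x = mat 1"
proof -
  have "jacmat (\<lambda>y. trans_map d c (trans_map c d y)) x = jacmat (\<lambda>y. y) x"
    by (rule jacobian_cong[OF open_ovl[OF assms(1,2)] assms(3)]) (rule trans_map_ovl(3)[OF assms(1,2)])
  then show ?thesis
    using jacobian_compose[of "trans_map c d" x "trans_map d c"]
      trans_map_differentiable[OF assms] trans_map_differentiable[OF assms(2,1) trans_map_ovl(1)[OF assms]]
    by (simp add: jacobian_ident)
qed

lemma covariant_tensor2_transform:
  assumes "covariant_tensor2 A T" "c \<in> A" "d \<in> A" "x \<in> ovl c d"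
  shows "T c (param c x) = transpose (jacmat (trans_map c d) x) ** T d (param c x) ** jacmat (trans_map c d) x"
proof -
  have p: "param c x \<in> cdom c \<inter> cdom d" "coord c (param c x) = x"
    using assms by (auto simp: ovl_def)
  have cd: "cderiv c i (\<lambda>q. coord d q $ k) (param c x) = jacmat (trans_map c d) x $ k $ i" for i k
    by (simp add: cderiv_def jacmat_def trans_map_def p(2))
  have "T c (param c x) $ i $ j = (\<Sum>l\<in>UNIV. \<Sum>k\<in>UNIV. jacmat (trans_map c d) x $ k $ i *
      jacmat (trans_map c d) x $ l $ j * T d (param c x) $ k $ l)" for i j
    using assms(1-3) p(1) unfolding covariant_tensor2_def cd[symmetric]
    by (subst sum.swap) blast
  then show ?thesis
    by (simp add: vec_eq_iff matrix_mult_nth transpose_nth sum_distrib_left ac_simps)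
qed

lemma coordinate_change:
  assumes "c \<in> A" "d \<in> A"
  shows "coordinate_change (img c) (loc c) (img d) (loc d) (trans_map c d) (ovl c d)"
proof (intro coordinate_change.intro coordinate_change_axioms.intro local_metric_loc assms)
  show "loc c x = transpose (jacmat (trans_map c d) x) ** loc d (trans_map c d x) ** jacmat (trans_map c d) x"
    if "x \<in> ovl c d" for x
    using covariant_tensor2_transform[OF _ assms that] metric trans_map_ovl(2)[OF assms that]
    by (simp add: riemannian_metric_def loc_def)
  show "invertible (jacmat (trans_map c d) x)" if "x \<in> ovl c d" for x
    using jacmat_trans_map_inverse[OF assms that] invertible_left_inverse by blast
  show "trans_map c d x \<in> img d" if "x \<in> ovl c d" for x
    using trans_map_ovl(1)[OF assms that] ovl_subset by blast
qed (use assms open_ovl ovl_subset trans_map_smooth in auto)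

section \<open>Coordinate expressions of the geometric quantities\<close>

lemma cderiv_param:
  "c \<in> A \<Longrightarrow> x \<in> img c \<Longrightarrow> cderiv c i u (param c x) = pd i (\<lambda>y. u (param c y)) x"
  by (simp only: cderiv_def coord_param)

lemma ginv_param: "ginv g c (param c x) = matrix_inv (loc c x)"
  by (simp add: ginv_def loc_def)

context
  fixes c x
  assumes c: "c \<in> A" and x: "x \<in> img c"
begin

text \<open>Agreement on the whole chart image is what permits a second derivative, as in the
  curvature and the Hessian.\<close>

lemma cderiv_eqI:
  assumes "\<And>y. y \<in> img c \<Longrightarrow> u (param c y) = v y"
  shows "cderiv c i u (param c x) = pd i v x"
  unfolding cderiv_param[OF c x] by (rule pd_cong[OF open_image[OF c] x assms])

lemma christoffel_param: "christoffel g c k i j (param c x) = lchris (loc c) i x $ k $ j"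
  by (simp add: christoffel_def lchris_def ginv_param cderiv_param[OF c x] loc_def)

end

lemma riemann_param:
  assumes c: "c \<in> A" and x: "x \<in> img c"
  shows "riemann g c l k i j (param c x) = lriem (loc c) i j x $ l $ k"
proof -
  have "cderiv c i (christoffel g c l j k) (param c x) = pd i (\<lambda>y. lchris (loc c) j y $ l $ k) x" for i j k l
    by (rule cderiv_eqI[OF c x]) (rule christoffel_param[OF c])
  then show ?thesis
    unfolding riemann_def lriem_def christoffel_param[OF c x]
    by (simp add: mderiv_nth matrix_mult_nth sum_subtractf)
qed

lemma ricci_param:
  assumes c: "c \<in> A" and x: "x \<in> img c"
  shows "ricci g c (param c x) = lric (loc c) x"
  by (simp add: ricci_def lric_def riemann_param[OF assms])

lemma hessian_param:
  assumes c: "c \<in> A" and x: "x \<in> img c"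
  shows "hessian g u c (param c x) = lhess (loc c) (\<lambda>y. u (param c y)) x"
proof -
  have "cderiv c i (cderiv c j u) (param c x) = pd i (pd j (\<lambda>y. u (param c y))) x" for i j
    by (rule cderiv_eqI[OF c x]) (rule cderiv_param[OF c])
  then show ?thesis
    unfolding hessian_def lhess_def christoffel_param[OF c x] by (simp add: cderiv_param[OF c x])
qed

lemma grad_param:
  assumes c: "c \<in> A" and x: "x \<in> img c"
  shows "grad g u c (param c x) = matrix_inv (loc c x) *v dvec (\<lambda>y. u (param c y)) x"
  by (simp add: grad_def vec_eq_iff matrix_vector_mult_def dvec_def ginv_param cderiv_param[OF assms])

lemma metric_inner_grad:
  assumes p: "p \<in> M"
  defines "c \<equiv> chart_at A p"
  shows "metric_inner A g (grad g u) (grad g v) p =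
    dvec (\<lambda>y. u (param c y)) (coord c p) \<bullet> (matrix_inv (loc c (coord c p)) *v dvec (\<lambda>y. v (param c y)) (coord c p))"
proof -
  note ch = chart_at[OF p, folded c_def]
  interpret L: local_metric "img c" "loc c" by (rule local_metric_loc[OF ch(1)])
  have x: "coord c p \<in> img c" using ch by blast
  let ?a = "dvec (\<lambda>y. u (param c y)) (coord c p)" and ?b = "dvec (\<lambda>y. v (param c y)) (coord c p)"
  have gr: "grad g w c p = matrix_inv (loc c (coord c p)) *v dvec (\<lambda>y. w (param c y)) (coord c p)" for w
    using grad_param[OF ch(1) x, of w] ch by simp
  have "metric_inner A g (grad g u) (grad g v) p
      = (L.Gi (coord c p) *v ?a) \<bullet> (loc c (coord c p) *v (L.Gi (coord c p) *v ?b))"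
    using ch by (simp add: metric_inner_def Let_def c_def[symmetric] gr loc_def)
  also have "\<dots> = (L.Gi (coord c p) *v ?a) \<bullet> ?b"
    by (simp add: matrix_vector_mul_assoc L.G_inverse[OF x])
  also have "\<dots> = ?a \<bullet> (L.Gi (coord c p) *v ?b)"
    by (metis L.Gi_transpose[OF x] dot_lmul_matrix inner_commute transpose_matrix_vector)
  finally show ?thesis .
qed

lemma metric_trace_eq:
  assumes "p \<in> M"
  shows "metric_trace A g T p = trace (transpose (ginv g (chart_at A p) p) ** T (chart_at A p) p)"
  by (simp add: metric_trace_def Let_def trace_def matrix_mult_nth transpose_nth) (rule sum.swap)

text \<open>Nonnegativity of \<open>frob2\<close> lets the square undo the square root.\<close>

lemma tensor_norm_square:
  assumes p: "p \<in> M"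
  shows "(tensor_norm A g T p)\<^sup>2 = frob2 (ginv g (chart_at A p) p) (T (chart_at A p) p)"
proof -
  have "posdef (ginv g (chart_at A p) p)"
    unfolding ginv_def by (intro posdef_matrix_inv posdef_g chart_at[OF p])
  then show ?thesis
    using frob2_nonneg[of "ginv g (chart_at A p) p" "T (chart_at A p) p"]
    by (simp add: tensor_norm_def Let_def frob2_sum posdef_def)
qed

end


section \<open>Gradient almost solitons\<close>

locale gradient_soliton = riemannian_manifold M A g
  for M :: "'a::{t2_space,second_countable_topology} set"
    and A :: "('a, 'n::finite) chart set"
    and g :: "('a, 'n) tensor2" +
  fixes f h :: "'a \<Rightarrow> real"
  assumes f_smooth: "smooth_fun A f"
    and soliton_eq: "\<And>c p. c \<in> A \<Longrightarrow> p \<in> cdom c \<Longrightarrow> ricci g c p + hessian g f c p = h p *\<^sub>R g c p"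
begin

abbreviation "fl c \<equiv> \<lambda>y. f (param c y)"

lemma fl_smooth: "c \<in> A \<Longrightarrow> smooth_on (img c) (fl c)"
  using f_smooth by (simp add: smooth_fun_def)

lemma local_soliton:
  assumes "c \<in> A" "x \<in> img c"
  shows "lric (loc c) x + lhess (loc c) (fl c) x = h (param c x) *\<^sub>R loc c x"
  using soliton_eq[of c "param c x"] assms
  by (simp add: ricci_param hessian_param loc_def)

lemma lric_eq:
  assumes "c \<in> A" "x \<in> img c"
  shows "lric (loc c) x = h (param c x) *\<^sub>R loc c x - lhess (loc c) (fl c) x"
  using local_soliton[OF assms] by (simp add: eq_diff_eq)

text \<open>The transformation law of the Ricci tensor is inherited from those of the Hessian and the metric
  through the soliton equation, whose factor \<open>h\<close> is a function on \<open>M\<close>.\<close>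

lemma lric_transform:
  assumes cd: "c \<in> A" "d \<in> A" and x: "x \<in> ovl c d"
  defines "J \<equiv> jacmat (trans_map c d) x"
  shows "lric (loc c) x = transpose J ** lric (loc d) (trans_map c d x) ** J"
proof -
  interpret C: coordinate_change "img c" "loc c" "img d" "loc d" "trans_map c d" "ovl c d"
    by (rule coordinate_change[OF cd])
  have "lhess (loc c) (fl c) x = transpose J ** lhess (loc d) (fl d) (trans_map c d x) ** J"
    unfolding J_def using trans_map_ovl(2)[OF cd]
    by (intro C.hessian_transform x fl_smooth[OF cd(2)]) simp
  then show ?thesis
    using x ovl_subset[of c d] C.\<phi>_U'[OF x] cd C.metric_eq[OF x] trans_map_ovl(2)[OF cd x]
    by (simp add: lric_eq subsetD J_def matrix_diff_ldistrib matrix_diff_rdistrib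
        scalar_matrix_assoc[symmetric] matrix_scalar_ac)
qed

context
  fixes c d x
  assumes cd: "c \<in> A" "d \<in> A" and x: "x \<in> ovl c d"
begin

interpretation C: coordinate_change "img c" "loc c" "img d" "loc d" "trans_map c d" "ovl c d"
  by (rule coordinate_change[OF cd])

interpretation FC: frame_change "loc c x" "loc d (trans_map c d x)" "jacmat (trans_map c d) x"
  by (rule C.frame_change[OF x])

lemma lscal_transform: "lscal (loc c) x = lscal (loc d) (trans_map c d x)"
proof -
  have tr: "lscal (loc e) y = trace (matrix_inv (loc e y) ** lric (loc e) y)" if "e \<in> A" "y \<in> img e" for e y
  proof -
    interpret local_metric "img e" "loc e" by (rule local_metric_loc[OF that(1)])
    have "lscal (loc e) y = trace (transpose (Gi y) ** lric (loc e) y)"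
      unfolding lscal_def trace_def matrix_mult_nth transpose_nth by (rule sum.swap)
    then show ?thesis by (simp add: Gi_transpose[OF that(2)])
  qed
  show ?thesis
    using tr[OF cd(1) subsetD[OF C.S_U x]] tr[OF cd(2) C.\<phi>_U'[OF x]]
      FC.trace_invariant[OF lric_transform[OF cd x]] by simp
qed

lemma T_transform:
  "local_metric.T (loc c) x = transpose (jacmat (trans_map c d) x) **
     local_metric.T (loc d) (trans_map c d x) ** jacmat (trans_map c d) x"
  unfolding C.L.T_def C.L'.T_def lric_transform[OF cd x] lscal_transform C.metric_eq[OF x]
  by (simp add: matrix_diff_ldistrib matrix_diff_rdistrib scalar_matrix_assoc[symmetric] matrix_scalar_ac)

lemma frob2_T_transform:
  "frob2 (matrix_inv (loc c x)) (local_metric.T (loc c) x) =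
   frob2 (matrix_inv (loc d (trans_map c d x))) (local_metric.T (loc d) (trans_map c d x))"
  by (rule FC.frob2_invariant[OF T_transform])

lemma dvec_transform:
  assumes "(\<lambda>y. u (param d y)) differentiable (at (trans_map c d x))"
  shows "dvec (\<lambda>y. u (param c y)) x = transpose (jacmat (trans_map c d) x) *v dvec (\<lambda>y. u (param d y)) (trans_map c d x)"
proof -
  have "dvec (\<lambda>y. u (param c y)) x = dvec (\<lambda>y. u (param d (trans_map c d y))) x"
    unfolding dvec_def using trans_map_ovl(2)[OF cd]
    by (intro Cart_lambda_cong pd_cong[OF C.open_S x]) simp
  also have "\<dots> = transpose (jacmat (trans_map c d) x) *v dvec (\<lambda>y. u (param d y)) (trans_map c d x)"
    by (rule dvec_compose[OF C.\<phi>_differentiable[OF x] assms])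
  finally show ?thesis .
qed

lemma dvec_inner_transform:
  assumes "(\<lambda>y. u (param d y)) differentiable (at (trans_map c d x))"
    "(\<lambda>y. v (param d y)) differentiable (at (trans_map c d x))"
  shows "dvec (\<lambda>y. u (param c y)) x \<bullet> (matrix_inv (loc c x) *v dvec (\<lambda>y. v (param c y)) x) =
    dvec (\<lambda>y. u (param d y)) (trans_map c d x) \<bullet>
      (matrix_inv (loc d (trans_map c d x)) *v dvec (\<lambda>y. v (param d y)) (trans_map c d x))"
  by (rule FC.inner_invariant[OF dvec_transform[of u] dvec_transform[of v]]) fact+

lemma dvec_V_transform:
  assumes "(\<lambda>y. u (param d y)) differentiable (at (trans_map c d x))"
  shows "dvec (\<lambda>y. u (param c y)) x \<bullet> local_metric.V (loc c) (fl c) x =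
    dvec (\<lambda>y. u (param d y)) (trans_map c d x) \<bullet> local_metric.V (loc d) (fl d) (trans_map c d x)"
  unfolding C.L.V_def C.L'.V_def
  by (rule FC.bilinear_invariant[OF dvec_transform[OF assms] dvec_transform T_transform])
    (rule smooth_on_differentiable[OF fl_smooth[OF cd(2)] C.L'.open_U C.\<phi>_U'[OF x]])

end

lemma scalar_curvature_param:
  assumes c: "c \<in> A" and x: "x \<in> img c"
  shows "scalar_curvature A g (param c x) = lscal (loc c) x"
proof -
  define d where "d = chart_at A (param c x)"
  note d = chart_at_param[OF c x, folded d_def]
  have "scalar_curvature A g (param c x) = lscal (loc d) (trans_map c d x)"
    unfolding scalar_curvature_def metric_trace_def Let_def d_def[symmetric] lscal_def
    using ginv_param[of d "trans_map c d x"] ricci_param[OF d(2,5)] d(6) by simp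
  then show ?thesis
    using lscal_transform[OF c d(2,3)] by simp
qed

definition Tnorm :: "'a \<Rightarrow> real" where
  "Tnorm p = (tensor_norm A g (\<lambda>c q. ricci g c q - (scalar_curvature A g q / real CARD('n)) *\<^sub>R g c q) p)\<^sup>2"

definition gradR_gradf :: "'a \<Rightarrow> real" where
  "gradR_gradf p = metric_inner A g (grad g (scalar_curvature A g)) (grad g f) p"

lemma Tnorm_param:
  assumes c: "c \<in> A" and x: "x \<in> img c"
  shows "Tnorm (param c x) = frob2 (matrix_inv (loc c x)) (local_metric.T (loc c) x)"
proof -
  define d where "d = chart_at A (param c x)"
  note d = chart_at_param[OF c x, folded d_def]
  let ?p = "param c x" and ?y = "trans_map c d x"
  interpret L: local_metric "img d" "loc d" by (rule local_metric_loc[OF d(2)])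
  have "ricci g d ?p - (scalar_curvature A g ?p / real CARD('n)) *\<^sub>R g d ?p = L.T ?y"
    using scalar_curvature_param[OF d(2,5)] ricci_param[OF d(2,5)] d(6)
    by (simp add: L.T_def loc_def)
  then have "Tnorm ?p = frob2 (matrix_inv (loc d ?y)) (L.T ?y)"
    unfolding Tnorm_def tensor_norm_square[OF d(1)] d_def[symmetric]
    using ginv_param[of d ?y] d(6) by simp
  then show ?thesis
    using frob2_T_transform[OF c d(2,3)] by simp
qed

lemma scalar_curvature_smooth:
  assumes "c \<in> A"
  shows "smooth_on (img c) (\<lambda>y. scalar_curvature A g (param c y))"
proof -
  interpret L: local_metric "img c" "loc c" by (rule local_metric_loc[OF assms])
  show ?thesis
    by (subst smooth_on_cong[OF open_image[OF assms] scalar_curvature_param[OF assms]])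
      (auto intro: L.scal_smooth)
qed

lemma gradR_gradf_param:
  assumes c: "c \<in> A" and x: "x \<in> img c"
  shows "gradR_gradf (param c x) = dvec (lscal (loc c)) x \<bullet> (matrix_inv (loc c x) *v dvec (fl c) x)"
proof -
  define d where "d = chart_at A (param c x)"
  note d = chart_at_param[OF c x, folded d_def]
  have "gradR_gradf (param c x) =
      dvec (\<lambda>y. scalar_curvature A g (param c y)) x \<bullet> (matrix_inv (loc c x) *v dvec (fl c) x)"
    unfolding gradR_gradf_def metric_inner_grad[OF d(1)] d_def[symmetric] d(4)
    using dvec_inner_transform[OF c d(2,3), of "scalar_curvature A g" f]
      smooth_on_differentiable[OF scalar_curvature_smooth[OF d(2)] open_image[OF d(2)] d(5)]
      smooth_on_differentiable[OF fl_smooth[OF d(2)] open_image[OF d(2)] d(5)]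
    by simp
  moreover have "dvec (\<lambda>y. scalar_curvature A g (param c y)) x = dvec (lscal (loc c)) x"
    unfolding dvec_def using scalar_curvature_param[OF c]
    by (intro Cart_lambda_cong pd_cong[OF open_image[OF c] x]) simp
  ultimately show ?thesis by simp
qed

text \<open>The trace of the soliton equation gives \<open>\<Delta>f = n h - R\<close>. Subtracting
  traces therefore eliminates \<open>h\<close>, and the norm does not see the sign that
  remains.\<close>

lemma hessian_norm_eq_Tnorm:
  assumes p: "p \<in> M"
  shows "(tensor_norm A g (\<lambda>c q. hessian g f c q - (laplacian A g f q / real CARD('n)) *\<^sub>R g c q) p)\<^sup>2 = Tnorm p"
proof -
  define d where "d = chart_at A p"
  note d = chart_at[OF p, folded d_def]
  let ?n = "real CARD('n)"
  have H: "hessian g f d p = h p *\<^sub>R g d p - ricci g d p"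
    using soliton_eq[OF d] by (simp add: eq_diff_eq add.commute)
  have inv: "transpose (ginv g d p) ** g d p = mat 1"
    using posdef_g[OF d] posdef_matrix_inv[OF posdef_g[OF d]] matrix_inv_mult(2)[OF posdef_invertible[OF posdef_g[OF d]]]
    by (simp add: ginv_def posdef_def)
  have "laplacian A g f p = h p * ?n - scalar_curvature A g p"
    unfolding laplacian_def scalar_curvature_def metric_trace_eq[OF p] d_def[symmetric] H
    by (simp add: matrix_diff_ldistrib matrix_scalar_ac scalar_matrix_assoc[symmetric] inv trace_sub)
      (simp add: trace_def mat_def)
  then have "hessian g f d p - (laplacian A g f p / ?n) *\<^sub>R g d p =
      - (ricci g d p - (scalar_curvature A g p / ?n) *\<^sub>R g d p)"
    unfolding H by (simp add: diff_divide_distrib scaleR_left_diff_distrib)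
  moreover have "frob2 K (- B) = frob2 K B" for K B :: "real^'n^'n"
    by (simp add: frob2_def transpose_minus matrix_minus_left matrix_minus_right)
  ultimately show ?thesis
    unfolding Tnorm_def tensor_norm_square[OF p] d_def[symmetric] by (simp only:)
qed

end

section \<open>Change of variables for arbitrary finite index types\<close>

text \<open>The library proves the change of variables formula only for vectors indexed by a well-ordered
  type. A copy of the index type with an arbitrary well-order reduces the general case to it.\<close>

datatype 'n windex = Windex (unwindex: 'n)

instance windex :: (finite) finite
proof
  have "(UNIV :: 'a windex set) = Windex ` UNIV"
    by (auto intro: image_eqI[of _ _ "unwindex _"])
  then show "finite (UNIV :: 'a windex set)" by (metis finite_imageI finite_class.finite_UNIV)
qed

definition windex_rank :: "'n::finite windex \<Rightarrow> nat" where
  "windex_rank i = (SOME r :: 'n \<Rightarrow> nat. inj r) (unwindex i)"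

lemma windex_rank_inj: "windex_rank i = windex_rank j \<Longrightarrow> i = j"
proof -
  have "\<exists>r :: 'a \<Rightarrow> nat. inj r"
    using finite_imp_inj_to_nat_seg[OF finite_class.finite_UNIV] by blast
  then have "inj (SOME r :: 'a \<Rightarrow> nat. inj r)" by (rule someI_ex)
  then show "windex_rank i = windex_rank j \<Longrightarrow> i = j"
    by (auto simp: windex_rank_def dest: injD intro: windex.expand)
qed

instantiation windex :: (finite) wellorder
begin

definition less_eq_windex :: "'a windex \<Rightarrow> 'a windex \<Rightarrow> bool" where
  "less_eq_windex i j \<longleftrightarrow> windex_rank i \<le> windex_rank j"

definition less_windex :: "'a windex \<Rightarrow> 'a windex \<Rightarrow> bool" where
  "less_windex i j \<longleftrightarrow> windex_rank i < windex_rank j"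

instance
proof
  fix P :: "'a windex \<Rightarrow> bool" and a :: "'a windex"
  assume step: "\<And>x. (\<And>y. y < x \<Longrightarrow> P y) \<Longrightarrow> P x"
  show "P a"
    by (induction a rule: measure_induct_rule[of windex_rank]) (rule step, simp add: less_windex_def)
qed (auto simp: less_eq_windex_def less_windex_def intro: windex_rank_inj)

end

text \<open>Conjugation by a bijection, here between two index types, takes transpositions to
  transpositions; the proof builds the permutation up from these.\<close>

lemma sign_conjugate:
  fixes \<sigma> :: "'m::finite \<Rightarrow> 'n::finite"
  assumes "bij \<sigma>" "p permutes UNIV"
  shows "sign (inv \<sigma> \<circ> p \<circ> \<sigma>) = sign p \<and> (inv \<sigma> \<circ> p \<circ> \<sigma>) permutes UNIV"
  using assms(2) finite_class.finite_UNIV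
proof (induction rule: permutes_induct)
  case id
  have "inv \<sigma> \<circ> id \<circ> \<sigma> = id"
    using assms(1) by (simp add: bij_is_inj)
  then show ?case by (simp only: sign_id permutes_id simp_thms)
next
  case (swap a b p)
  let ?t = "Transposition.transpose (inv \<sigma> a) (inv \<sigma> b)"
  have inv: "\<sigma> (inv \<sigma> y) = y" "inv \<sigma> (\<sigma> x) = x" for x y
    using assms(1) by (auto simp: bij_is_inj bij_is_surj surj_f_inv_f)
  have ne: "inv \<sigma> a \<noteq> inv \<sigma> b" using swap(3) inv by metis
  have eq: "inv \<sigma> \<circ> (Transposition.transpose a b \<circ> p) \<circ> \<sigma> = ?t \<circ> (inv \<sigma> \<circ> p \<circ> \<sigma>)"
    using inv by (auto simp: fun_eq_iff Transposition.transpose_def) metis+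
  have perm: "permutation q" if "q permutes UNIV" for q :: "'k::finite \<Rightarrow> 'k"
    using that permutation_permutes finite_class.finite_UNIV by blast
  have t: "?t permutes UNIV" "Transposition.transpose a b permutes UNIV"
    by (rule permutes_swap_id; simp)+
  have q: "inv \<sigma> \<circ> p \<circ> \<sigma> permutes UNIV" using swap by blast
  have "sign (?t \<circ> (inv \<sigma> \<circ> p \<circ> \<sigma>)) = sign (Transposition.transpose a b \<circ> p)"
    unfolding sign_compose[OF perm[OF t(1)] perm[OF q]] sign_compose[OF perm[OF t(2)] perm[OF swap(4)]] sign_swap_id
    using swap ne by metis
  then show ?case
    unfolding eq using permutes_compose[OF q t(1)] by blast
qed

lemma det_reindex:
  fixes A :: "real^'n::finite^'n" and \<sigma> :: "'m::finite \<Rightarrow> 'n"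
  assumes \<sigma>: "bij \<sigma>"
  shows "det (\<chi> i j. A $ \<sigma> i $ \<sigma> j) = det A"
proof -
  have inv: "\<sigma> (inv \<sigma> y) = y" "inv \<sigma> (\<sigma> x) = x" for x y
    using \<sigma> by (auto simp: bij_is_inj bij_is_surj surj_f_inv_f)
  have \<sigma>': "bij (inv \<sigma>)" "inv (inv \<sigma>) = \<sigma>" using \<sigma> by (auto simp: bij_imp_bij_inv inv_inv_eq)
  have "det A = (\<Sum>p | p permutes (UNIV :: 'm set). of_int (sign p) * (\<Prod>i\<in>UNIV. A $ \<sigma> i $ \<sigma> (p i)))"
    unfolding det_def
  proof (rule sum.reindex_bij_witness[where i = "\<lambda>p. \<sigma> \<circ> p \<circ> inv \<sigma>" and j = "\<lambda>q. inv \<sigma> \<circ> q \<circ> \<sigma>"])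
    fix q assume "q \<in> {q. q permutes (UNIV :: 'n set)}"
    then have q: "q permutes UNIV" by simp
    show "\<sigma> \<circ> (inv \<sigma> \<circ> q \<circ> \<sigma>) \<circ> inv \<sigma> = q" by (auto simp: fun_eq_iff inv)
    show "inv \<sigma> \<circ> q \<circ> \<sigma> \<in> {p. p permutes UNIV}" using sign_conjugate[OF \<sigma> q] by simp
    have "(\<Prod>i\<in>UNIV. A $ \<sigma> i $ q (\<sigma> i)) = (\<Prod>i\<in>UNIV. A $ i $ q i)"
      using prod.reindex_bij_betw[of \<sigma> UNIV UNIV "\<lambda>i. A $ i $ q i"] \<sigma> by simp
    then show "of_int (sign (inv \<sigma> \<circ> q \<circ> \<sigma>)) * (\<Prod>i\<in>UNIV. A $ \<sigma> i $ \<sigma> ((inv \<sigma> \<circ> q \<circ> \<sigma>) i)) =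
        of_int (sign q) * (\<Prod>i\<in>UNIV. A $ i $ q i)"
      using sign_conjugate[OF \<sigma> q] by (simp add: inv)
  next
    fix p assume "p \<in> {p. p permutes (UNIV :: 'm set)}"
    then have p: "p permutes UNIV" by simp
    show "inv \<sigma> \<circ> (\<sigma> \<circ> p \<circ> inv \<sigma>) \<circ> \<sigma> = p" by (auto simp: fun_eq_iff inv)
    show "\<sigma> \<circ> p \<circ> inv \<sigma> \<in> {q. q permutes UNIV}"
      using sign_conjugate[OF \<sigma>'(1) p] \<sigma>'(2) by simp
  qed
  then show ?thesis by (simp add: det_def)
qed

definition reindex :: "('m \<Rightarrow> 'n) \<Rightarrow> real^'n \<Rightarrow> real^'m" where
  "reindex \<sigma> x = (\<chi> i. x $ \<sigma> i)"

lemma reindex_nth: "reindex \<sigma> x $ i = x $ \<sigma> i"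
  by (simp add: reindex_def)

lemma linear_reindex: "bounded_linear (reindex \<sigma> :: real^'n::finite \<Rightarrow> real^'m::finite)"
  unfolding linear_conv_bounded_linear[symmetric]
  by (rule linearI) (simp_all add: reindex_def vec_eq_iff)

lemma reindex_continuous: "continuous_on S (reindex \<sigma> :: real^'n::finite \<Rightarrow> real^'m::finite)"
  by (rule linear_continuous_on[OF linear_reindex])

lemma reindex_inverse:
  "bij \<sigma> \<Longrightarrow> reindex \<sigma> (reindex (inv \<sigma>) y) = y" "bij \<sigma> \<Longrightarrow> reindex (inv \<sigma>) (reindex \<sigma> x) = x"
  by (simp_all add: reindex_def vec_eq_iff bij_is_inj bij_is_surj surj_f_inv_f)

text \<open>Lebesgue measure is determined by its values on boxes, and relabelling coordinates maps
  boxes to boxes with the same edge lengths.\<close>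

lemma reindex_lborel:
  fixes \<sigma> :: "'m::finite \<Rightarrow> 'n::finite"
  assumes "bij \<sigma>"
  shows "distr lborel borel (reindex \<sigma>) = lborel"
proof (rule lborel_eqI[symmetric])
  have meas: "reindex \<sigma> \<in> borel_measurable borel"
    by (rule borel_measurable_continuous_onI[OF reindex_continuous])
  have prod_basis: "(\<Prod>b\<in>Basis. (u - l) \<bullet> b) = (\<Prod>i\<in>UNIV. u $ i - l $ i)" for l u :: "real^'k::finite"
  proof -
    have "(Basis :: (real^'k) set) = (\<lambda>i. axis i 1) ` UNIV" by (auto simp: Basis_vec_def)
    then have "(\<Prod>b\<in>Basis. (u - l) \<bullet> b) = (\<Prod>b\<in>(\<lambda>i. axis i 1) ` UNIV. (u - l) \<bullet> b)" by metis
    also have "\<dots> = (\<Prod>i\<in>UNIV. (u - l) \<bullet> axis i 1)"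
      by (subst prod.reindex) (auto simp: inj_on_def axis_eq_axis)
    finally show ?thesis by (simp add: inner_axis)
  qed
  fix l u :: "real^'m" assume "\<And>b. b \<in> Basis \<Longrightarrow> l \<bullet> b \<le> u \<bullet> b"
  then have le: "l $ i \<le> u $ i" for i
    by (metis axis_in_Basis_iff cart_eq_inner_axis inner_axis' inner_commute one_neq_zero Basis_real_def insertI1 axis_inverse)
  let ?l = "reindex (inv \<sigma>) l" and ?u = "reindex (inv \<sigma>) u"
  have "reindex \<sigma> -` box l u = box ?l ?u"
  proof -
    have "(\<forall>i. l $ i < x $ \<sigma> i \<and> x $ \<sigma> i < u $ i) \<longleftrightarrow> (\<forall>j. l $ inv \<sigma> j < x $ j \<and> x $ j < u $ inv \<sigma> j)" for x :: "real^'n"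
      using assms by (metis bij_inv_eq_iff)
    then show ?thesis by (auto simp: mem_box_cart reindex_nth)
  qed
  then have "emeasure (distr lborel borel (reindex \<sigma>)) (box l u) = emeasure lborel (box ?l ?u)"
    using meas by (simp add: emeasure_distr)
  also have "\<dots> = ennreal (\<Prod>b\<in>Basis. (?u - ?l) \<bullet> b)"
  proof (rule emeasure_lborel_box)
    fix b :: "real^'n" assume "b \<in> Basis"
    then obtain i where "b = axis i 1" by (auto simp: Basis_vec_def)
    then show "?l \<bullet> b \<le> ?u \<bullet> b" by (simp add: inner_axis reindex_nth le)
  qed
  also have "(\<Prod>b\<in>Basis. (?u - ?l) \<bullet> b) = (\<Prod>b\<in>Basis. (u - l) \<bullet> b)"
    unfolding prod_basis reindex_nth
    using prod.reindex_bij_betw[of "inv \<sigma>" UNIV UNIV "\<lambda>i. u $ i - l $ i"] assms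
    by (simp add: bij_imp_bij_inv)
  finally show "emeasure (distr lborel borel (reindex \<sigma>)) (box l u) = ennreal (\<Prod>b\<in>Basis. (u - l) \<bullet> b)" .
qed simp

text \<open>The image under \<open>\<phi>\<close> is a preimage under the continuous
  inverse.\<close>

lemma homeomorphic_image_borel:
  assumes "homeomorphism S W \<phi> \<psi>" "W \<in> sets borel" "C \<in> sets borel"
  shows "\<phi> ` (C \<inter> S) \<in> sets borel"
proof -
  have "\<phi> ` (C \<inter> S) = \<psi> -` C \<inter> W"
    using assms(1) by (force simp: homeomorphism_def)
  moreover have "\<psi> \<in> borel_measurable (restrict_space borel W)"
    using assms(1) by (intro borel_measurable_continuous_on_restrict) (simp add: homeomorphism_def)
  then have "\<psi> -` C \<inter> W \<in> sets (restrict_space borel W)"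
    using measurable_sets[of \<psi> "restrict_space borel W" borel C] assms(3)
    by (simp add: space_restrict_space)
  ultimately show ?thesis
    using assms(2) by (simp add: sets_restrict_space_iff)
qed

text \<open>Finite measure and a bounded Jacobian determinant make the determinant integrable on
  \<open>C\<close>, which the underlying formula for Lebesgue measurable sets presupposes.\<close>

lemma emeasure_image_bounded:
  fixes \<phi> :: "real^'m::{finite,wellorder} \<Rightarrow> real^'m::_"
  assumes C: "C \<in> sets borel" "emeasure lborel C < \<infinity>" and im: "\<phi> ` C \<in> sets borel"
    and der: "\<And>x. x \<in> C \<Longrightarrow> (\<phi> has_derivative \<phi>' x) (at x)" and inj: "inj_on \<phi> C"
    and meas: "(\<lambda>x. indicator C x *\<^sub>R \<bar>det (matrix (\<phi>' x))\<bar>) \<in> borel_measurable borel"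
    and bound: "\<And>x. x \<in> C \<Longrightarrow> \<bar>det (matrix (\<phi>' x))\<bar> \<le> b"
  shows "emeasure lborel (\<phi> ` C) = (\<integral>\<^sup>+x. ennreal \<bar>det (matrix (\<phi>' x))\<bar> * indicator C x \<partial>lborel)"
proof -
  let ?D = "\<lambda>x. \<bar>det (matrix (\<phi>' x))\<bar>"
  have "integrable lborel (\<lambda>x. indicator C x *\<^sub>R ?D x)"
    by (rule integrableI_bounded_set[where A = C and B = b]) (use C meas bound in auto)
  from has_integral_integral_lborel[OF this] obtain m
    where "((\<lambda>x. indicator C x *\<^sub>R ?D x) has_integral m) UNIV" by blast
  moreover have "(\<lambda>x. indicator C x *\<^sub>R ?D x) = (\<lambda>x. if x \<in> C then ?D x else 0)"
    by (auto simp: fun_eq_iff)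
  ultimately have m: "(?D has_integral m) C"
    by (simp add: has_integral_restrict_UNIV)
  have "\<phi> ` C \<in> lmeasurable \<and> measure lebesgue (\<phi> ` C) = m"
    using has_measure_differentiable_image[of C \<phi> \<phi>' m] m C(1) der inj
    by (auto intro: has_derivative_at_withinI)
  then have "emeasure lebesgue (\<phi> ` C) = ennreal m"
    using emeasure_eq_measure2 by blast
  moreover have "emeasure lebesgue (\<phi> ` C) = emeasure lborel (\<phi> ` C)" using im by simp
  moreover have "integral\<^sup>N lborel (\<lambda>x. indicator C x * ?D x) = ennreal m"
    by (rule nn_integral_has_integral_lebesgue[OF _ m]) simp
  moreover have "(\<integral>\<^sup>+x. ennreal (?D x) * indicator C x \<partial>lborel) = integral\<^sup>N lborel (\<lambda>x. ennreal (indicator C x * ?D x))"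
    by (rule nn_integral_cong) (simp split: split_indicator)
  ultimately show ?thesis by simp
qed

text \<open>The open set is exhausted by compact sets, on which the Jacobian determinant is bounded.
  Both sides are continuous from below, the right one because it is a measure with a
  density.\<close>

lemma emeasure_image_wellorder:
  fixes \<phi> :: "real^'m::{finite,wellorder} \<Rightarrow> real^'m::_"
  assumes S: "open S" and W: "open W" and homeo: "homeomorphism S W \<phi> \<psi>"
    and der: "\<And>x. x \<in> S \<Longrightarrow> (\<phi> has_derivative \<phi>' x) (at x)"
    and cont: "continuous_on S (\<lambda>x. \<bar>det (matrix (\<phi>' x))\<bar>)"
    and C: "C \<in> sets borel" "C \<subseteq> S"
  shows "emeasure lborel (\<phi> ` C) = (\<integral>\<^sup>+x. ennreal \<bar>det (matrix (\<phi>' x))\<bar> * indicator C x \<partial>lborel)"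
proof -
  let ?D = "\<lambda>x. \<bar>det (matrix (\<phi>' x))\<bar>"
  obtain K where K: "\<And>n::nat. compact (K n)" "\<And>n. K n \<subseteq> S" "\<And>n. K n \<subseteq> interior (K (Suc n))" "\<Union>(range K) = S"
    using open_Union_compact_subsets[OF S] by metis
  have Kb: "K n \<in> sets borel" for n using K(1) by (simp add: borel_compact)
  have "K n \<subseteq> K (Suc n)" for n using K(3)[of n] interior_subset by blast
  then have incK: "incseq K" by (simp add: incseq_SucI)
  have S_borel: "S \<in> sets borel" using S by simp
  have D_meas: "(\<lambda>x. ennreal (?D x) * indicator S x) \<in> borel_measurable borel"
  proof -
    have "(\<lambda>x. indicator S x *\<^sub>R ?D x) \<in> borel_measurable borel"
      by (rule borel_measurable_continuous_on_indicator[OF S_borel cont])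
    then have "(\<lambda>x. ennreal (indicator S x *\<^sub>R ?D x)) \<in> borel_measurable borel" by measurable
    moreover have "(\<lambda>x. ennreal (indicator S x *\<^sub>R ?D x)) = (\<lambda>x. ennreal (?D x) * indicator S x)"
      by (auto simp: fun_eq_iff split: split_indicator)
    ultimately show ?thesis by (simp only:)
  qed
  let ?N = "density lborel (\<lambda>x. ennreal (?D x) * indicator S x)"
  have N: "emeasure ?N B = (\<integral>\<^sup>+x. ennreal (?D x) * indicator B x \<partial>lborel)" if "B \<in> sets borel" "B \<subseteq> S" for B
    using that D_meas by (subst emeasure_density) (auto intro!: nn_integral_cong split: split_indicator)
  have im: "\<phi> ` B \<in> sets borel" if "B \<in> sets borel" "B \<subseteq> S" for B
    using homeomorphic_image_borel[OF homeo _ that(1)] W that(2) by (simp add: Int_absorb2)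
  have piece: "emeasure lborel (\<phi> ` (C \<inter> K n)) = emeasure ?N (C \<inter> K n)" for n
  proof -
    have CK: "C \<inter> K n \<in> sets borel" "C \<inter> K n \<subseteq> S" using C Kb by auto
    have "compact (?D ` K n)"
      using compact_continuous_image[OF continuous_on_subset[OF cont K(2)] K(1)] .
    then obtain b where b: "\<And>x. x \<in> K n \<Longrightarrow> ?D x \<le> b"
      using compact_imp_bounded bounded_iff by (metis abs_le_D1 imageI real_norm_def)
    have "emeasure lborel (C \<inter> K n) \<le> emeasure lborel (K n)"
      using Kb by (intro emeasure_mono) auto
    also have "\<dots> < \<infinity>" using K(1) emeasure_compact_finite by blast
    finally have fin: "emeasure lborel (C \<inter> K n) < \<infinity>" .
    show ?thesis
      unfolding N[OF CK]
    proof (rule emeasure_image_bounded[OF CK(1) fin im[OF CK]])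
      show "inj_on \<phi> (C \<inter> K n)"
        using homeo CK(2) by (metis homeomorphism_def inj_on_inverseI subsetD)
      show "(\<lambda>x. indicator (C \<inter> K n) x *\<^sub>R ?D x) \<in> borel_measurable borel"
        by (rule borel_measurable_continuous_on_indicator[OF CK(1) continuous_on_subset[OF cont CK(2)]])
    qed (use der CK(2) b in auto)
  qed
  have UC: "(\<Union>n. C \<inter> K n) = C" using C(2) K(4) by blast
  have "emeasure lborel (\<phi> ` C) = (SUP n. emeasure lborel (\<phi> ` (C \<inter> K n)))"
  proof (subst SUP_emeasure_incseq)
    have "\<phi> ` (C \<inter> K n) \<in> sets borel" for n by (rule im) (use C Kb in auto)
    then show "range (\<lambda>n. \<phi> ` (C \<inter> K n)) \<subseteq> sets lborel" by auto
    show "incseq (\<lambda>n. \<phi> ` (C \<inter> K n))" using incK unfolding incseq_def by blast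
    show "emeasure lborel (\<phi> ` C) = emeasure lborel (\<Union>n. \<phi> ` (C \<inter> K n))"
      unfolding image_UN[symmetric] UC ..
  qed
  also have "\<dots> = (SUP n. emeasure ?N (C \<inter> K n))" by (simp add: piece)
  also have "\<dots> = emeasure ?N (\<Union>n. C \<inter> K n)"
  proof (rule SUP_emeasure_incseq)
    show "range (\<lambda>n. C \<inter> K n) \<subseteq> sets ?N" using C Kb by auto
    show "incseq (\<lambda>n. C \<inter> K n)" using incK unfolding incseq_def by blast
  qed
  also have "\<dots> = (\<integral>\<^sup>+x. ennreal (?D x) * indicator C x \<partial>lborel)"
    unfolding UC by (rule N[OF C])
  finally show ?thesis .
qed

text \<open>Conjugation with the relabelling \<open>\<rho>\<close>, which preserves Lebesgue measure
  and determinants, transports the formula from the well-ordered copy of the index type.\<close>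

lemma emeasure_image:
  fixes \<phi> :: "real^'n::finite \<Rightarrow> real^'n"
  assumes S: "open S" and W: "open W" and homeo: "homeomorphism S W \<phi> \<psi>"
    and der: "\<And>x. x \<in> S \<Longrightarrow> (\<phi> has_derivative (\<lambda>h. J x *v h)) (at x)"
    and cont: "continuous_on S (\<lambda>x. \<bar>det (J x)\<bar>)"
    and C: "C \<in> sets borel" "C \<subseteq> S"
  shows "emeasure lborel (\<phi> ` C) = (\<integral>\<^sup>+x. ennreal \<bar>det (J x)\<bar> * indicator C x \<partial>lborel)"
proof -
  define \<sigma> where "\<sigma> = (unwindex :: 'n windex \<Rightarrow> 'n)"
  have \<sigma>: "bij \<sigma>"
    unfolding \<sigma>_def by (rule bijI') (auto intro: windex.expand exI[of _ "Windex _"])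
  define \<rho> where "\<rho> = (reindex \<sigma> :: real^'n \<Rightarrow> real^'n windex)"
  define \<rho>' where "\<rho>' = (reindex (inv \<sigma>) :: real^'n windex \<Rightarrow> real^'n)"
  note inv = reindex_inverse[OF \<sigma>, folded \<rho>_def \<rho>'_def]
  have cont_\<rho>: "continuous_on T \<rho>" "continuous_on T' \<rho>'" for T T'
    unfolding \<rho>_def \<rho>'_def by (rule reindex_continuous)+
  have im_\<rho>: "\<rho> ` T = \<rho>' -` T" for T using inv by (auto intro: image_eqI[of _ _ "\<rho>' _"])
  have open_\<rho>: "open (\<rho> ` T)" if "open T" for T
    unfolding im_\<rho> using that cont_\<rho>(2)[of UNIV] by (metis open_vimage)
  have borel_\<rho>: "\<rho> ` T \<in> sets borel" if "T \<in> sets borel" for T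
    unfolding im_\<rho> using that borel_measurable_continuous_onI[OF cont_\<rho>(2)] measurable_sets[of \<rho>' borel borel T] by simp
  have lb: "distr lborel borel \<rho> = lborel"
    unfolding \<rho>_def by (rule reindex_lborel[OF \<sigma>])
  have meas: "\<rho> \<in> borel_measurable borel"
    by (rule borel_measurable_continuous_onI[OF cont_\<rho>(1)])
  have em: "emeasure lborel (\<rho> ` T) = emeasure lborel T" if "T \<in> sets borel" for T
  proof -
    have "emeasure lborel (\<rho> ` T) = emeasure lborel (\<rho> -` (\<rho> ` T))"
      by (subst lb[symmetric]) (simp add: emeasure_distr meas borel_\<rho>[OF that])
    also have "\<rho> -` (\<rho> ` T) = T" unfolding im_\<rho> using inv by auto
    finally show ?thesis .
  qed
  define J' where "J' y = (\<chi> i j. J (\<rho>' y) $ \<sigma> i $ \<sigma> j)" for y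
  have det_J': "det (J' y) = det (J (\<rho>' y))" for y
    unfolding J'_def by (rule det_reindex[OF \<sigma>])
  have J'_mult: "J' y *v h = \<rho> (J (\<rho>' y) *v \<rho>' h)" for y h
  proof -
    have "(\<Sum>j\<in>UNIV. J (\<rho>' y) $ \<sigma> i $ \<sigma> j * h $ j) = (\<Sum>j\<in>UNIV. J (\<rho>' y) $ \<sigma> i $ j * h $ inv \<sigma> j)" for i
      using sum.reindex_bij_betw[of \<sigma> UNIV UNIV "\<lambda>j. J (\<rho>' y) $ \<sigma> i $ j * h $ inv \<sigma> j"] \<sigma>
      by (simp add: bij_is_inj)
    then show ?thesis
      by (simp add: vec_eq_iff matrix_vector_mult_def J'_def \<rho>_def \<rho>'_def reindex_nth)
  qed
  have mat: "matrix (\<lambda>h. J' y *v h) = J' y" for y by simp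
  have img: "(\<lambda>y. \<rho> (\<phi> (\<rho>' y))) ` \<rho> ` T = \<rho> ` \<phi> ` T" for T
    by (simp add: image_image inv)
  have "emeasure lborel ((\<lambda>y. \<rho> (\<phi> (\<rho>' y))) ` \<rho> ` C) =
      (\<integral>\<^sup>+y. ennreal \<bar>det (matrix (\<lambda>h. J' y *v h))\<bar> * indicator (\<rho> ` C) y \<partial>lborel)"
  proof (rule emeasure_image_wellorder[of "\<rho> ` S" "\<rho> ` W"])
    show "open (\<rho> ` S)" "open (\<rho> ` W)" using S W open_\<rho> by auto
    show "homeomorphism (\<rho> ` S) (\<rho> ` W) (\<lambda>y. \<rho> (\<phi> (\<rho>' y))) (\<lambda>y. \<rho> (\<psi> (\<rho>' y)))"
    proof (rule homeomorphismI)
      show "continuous_on (\<rho> ` S) (\<lambda>y. \<rho> (\<phi> (\<rho>' y)))"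
      proof (rule continuous_on_compose2[OF cont_\<rho>(1)[of UNIV] _ subset_UNIV])
        have "continuous_on S \<phi>" using homeo by (simp add: homeomorphism_def)
        then show "continuous_on (\<rho> ` S) (\<lambda>y. \<phi> (\<rho>' y))"
          by (rule continuous_on_compose2[OF _ cont_\<rho>(2)]) (auto simp: inv)
      qed
      show "continuous_on (\<rho> ` W) (\<lambda>y. \<rho> (\<psi> (\<rho>' y)))"
      proof (rule continuous_on_compose2[OF cont_\<rho>(1)[of UNIV] _ subset_UNIV])
        have "continuous_on W \<psi>" using homeo by (simp add: homeomorphism_def)
        then show "continuous_on (\<rho> ` W) (\<lambda>y. \<psi> (\<rho>' y))"
          by (rule continuous_on_compose2[OF _ cont_\<rho>(2)]) (auto simp: inv)
      qed
    qed (use homeo in \<open>auto simp: homeomorphism_def inv\<close>)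
    show "((\<lambda>y. \<rho> (\<phi> (\<rho>' y))) has_derivative (\<lambda>h. J' y *v h)) (at y)" if "y \<in> \<rho> ` S" for y
    proof -
      have "\<rho>' y \<in> S" using that by (auto simp: inv)
      from has_derivative_compose[OF bounded_linear_imp_has_derivative[OF linear_reindex] der[OF this, unfolded \<rho>'_def], folded \<rho>'_def]
      have "((\<lambda>y. \<phi> (\<rho>' y)) has_derivative (\<lambda>h. J (\<rho>' y) *v \<rho>' h)) (at y)" .
      from bounded_linear.has_derivative[OF linear_reindex[of \<sigma>, folded \<rho>_def] this]
      show ?thesis by (simp add: J'_mult)
    qed
    show "continuous_on (\<rho> ` S) (\<lambda>y. \<bar>det (matrix (\<lambda>h. J' y *v h))\<bar>)"
      unfolding mat det_J' by (rule continuous_on_compose2[OF cont cont_\<rho>(2)]) (auto simp: inv)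
    show "\<rho> ` C \<in> sets borel" "\<rho> ` C \<subseteq> \<rho> ` S" using C borel_\<rho> by auto
  qed
  also have "\<dots> = (\<integral>\<^sup>+y. ennreal \<bar>det (J (\<rho>' y))\<bar> * indicator C (\<rho>' y) \<partial>lborel)"
    unfolding mat det_J' im_\<rho> by (simp add: indicator_vimage)
  also have "\<dots> = (\<integral>\<^sup>+y. ennreal \<bar>det (J (\<rho>' y))\<bar> * indicator C (\<rho>' y) \<partial>distr lborel borel \<rho>)"
    by (simp add: lb)
  also have "\<dots> = (\<integral>\<^sup>+x. ennreal \<bar>det (J x)\<bar> * indicator C x \<partial>lborel)"
  proof (subst nn_integral_distr)
    have "(\<lambda>x. indicator C x *\<^sub>R \<bar>det (J x)\<bar>) \<in> borel_measurable borel"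
      by (rule borel_measurable_continuous_on_indicator[OF C(1) continuous_on_subset[OF cont C(2)]])
    then have "(\<lambda>x. ennreal (indicator C x *\<^sub>R \<bar>det (J x)\<bar>)) \<in> borel_measurable borel" by measurable
    moreover have "(\<lambda>x. ennreal (indicator C x *\<^sub>R \<bar>det (J x)\<bar>)) = (\<lambda>x. ennreal \<bar>det (J x)\<bar> * indicator C x)"
      by (auto simp: fun_eq_iff split: split_indicator)
    ultimately have "(\<lambda>x. ennreal \<bar>det (J x)\<bar> * indicator C x) \<in> borel_measurable borel" by (simp only:)
    then have "(\<lambda>y. ennreal \<bar>det (J (\<rho>' y))\<bar> * indicator C (\<rho>' y)) \<in> borel_measurable borel"
      using measurable_compose[OF borel_measurable_continuous_onI[OF cont_\<rho>(2)]] by blast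
    then show "(\<lambda>y. ennreal \<bar>det (J (\<rho>' y))\<bar> * indicator C (\<rho>' y)) \<in> borel_measurable (distr lborel borel \<rho>)"
      by simp
  qed (use meas in \<open>simp_all add: inv\<close>)
  finally have "emeasure lborel (\<rho> ` \<phi> ` C) = (\<integral>\<^sup>+x. ennreal \<bar>det (J x)\<bar> * indicator C x \<partial>lborel)"
    unfolding img .
  moreover have "\<phi> ` C \<in> sets borel"
    using homeomorphic_image_borel[OF homeo _ C(1)] W C(2) by (simp add: Int_absorb2)
  ultimately show ?thesis by (simp add: em)
qed

text \<open>The formula for sets says that \<open>\<phi>\<close> pushes the measure with density
  |det J| on \<open>S\<close> forward to Lebesgue measure on \<open>W\<close>; integrating against a
  pushforward gives the rest.\<close>

lemma nn_integral_image:
  fixes \<phi> :: "real^'n::finite \<Rightarrow> real^'n"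
  assumes S: "open S" and W: "open W" and homeo: "homeomorphism S W \<phi> \<psi>"
    and der: "\<And>x. x \<in> S \<Longrightarrow> (\<phi> has_derivative (\<lambda>h. J x *v h)) (at x)"
    and cont: "continuous_on S (\<lambda>x. \<bar>det (J x)\<bar>)"
    and F: "F \<in> borel_measurable (restrict_space borel W)"
  shows "(\<integral>\<^sup>+y. F y * indicator W y \<partial>lborel) = (\<integral>\<^sup>+x. ennreal \<bar>det (J x)\<bar> * F (\<phi> x) * indicator S x \<partial>lborel)"
proof -
  let ?RS = "restrict_space lborel S" and ?RW = "restrict_space lborel W"
  have Sb: "S \<in> sets borel" "W \<in> sets borel" using S W by auto
  have \<phi>_meas: "\<phi> \<in> measurable ?RS ?RW"
  proof -
    have "\<phi> \<in> borel_measurable (restrict_space borel S)"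
      using homeo by (intro borel_measurable_continuous_on_restrict) (simp add: homeomorphism_def)
    moreover have "\<phi> \<in> S \<rightarrow> W" using homeo by (auto simp: homeomorphism_def)
    ultimately have "\<phi> \<in> measurable (restrict_space borel S) (restrict_space borel W)"
      by (intro measurable_restrict_space2) (auto simp: space_restrict_space)
    moreover have "sets ?RS = sets (restrict_space borel S)" "sets ?RW = sets (restrict_space borel W)"
      by (simp_all add: sets_restrict_space)
    ultimately show ?thesis using measurable_cong_sets by blast
  qed
  have D_meas: "(\<lambda>x. ennreal \<bar>det (J x)\<bar>) \<in> borel_measurable ?RS"
  proof -
    have "(\<lambda>x. \<bar>det (J x)\<bar>) \<in> borel_measurable (restrict_space borel S)"
      by (rule borel_measurable_continuous_on_restrict[OF cont])
    then have "(\<lambda>x. ennreal \<bar>det (J x)\<bar>) \<in> borel_measurable (restrict_space borel S)" by measurable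
    moreover have "sets ?RS = sets (restrict_space borel S)" by (simp add: sets_restrict_space)
    ultimately show ?thesis using measurable_cong_sets by blast
  qed
  let ?N = "density ?RS (\<lambda>x. ennreal \<bar>det (J x)\<bar>)"
  have eq: "distr ?N ?RW \<phi> = ?RW"
  proof (rule measure_eqI)
    fix B assume "B \<in> sets (distr ?N ?RW \<phi>)"
    then have BW: "B \<in> sets ?RW" by simp
    then have B: "B \<in> sets borel" "B \<subseteq> W" using Sb by (auto simp: sets_restrict_space_iff)
    define C where "C = \<phi> -` B \<inter> S"
    have "C \<in> sets ?RS" using measurable_sets[OF \<phi>_meas BW] by (simp add: C_def space_restrict_space)
    then have C: "C \<in> sets borel" "C \<subseteq> S" using Sb by (auto simp: sets_restrict_space_iff)
    have "emeasure (distr ?N ?RW \<phi>) B = emeasure ?N C"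
      using \<phi>_meas BW by (subst emeasure_distr) (auto simp: C_def space_restrict_space)
    also have "\<dots> = (\<integral>\<^sup>+x. ennreal \<bar>det (J x)\<bar> * indicator C x \<partial>?RS)"
      using D_meas \<open>C \<in> sets ?RS\<close> by (rule emeasure_density)
    also have "\<dots> = (\<integral>\<^sup>+x. ennreal \<bar>det (J x)\<bar> * indicator C x * indicator S x \<partial>lborel)"
      using Sb by (subst nn_integral_restrict_space) auto
    also have "\<dots> = (\<integral>\<^sup>+x. ennreal \<bar>det (J x)\<bar> * indicator C x \<partial>lborel)"
      using C(2) by (intro nn_integral_cong) (auto split: split_indicator)
    also have "\<dots> = emeasure lborel (\<phi> ` C)"
      using emeasure_image[OF S W homeo der cont C] by simp
    also have "\<phi> ` C = B"
    proof -
      have "\<phi> (\<psi> y) = y \<and> \<psi> y \<in> S" if "y \<in> B" for y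
        using homeo B(2) that by (auto simp: homeomorphism_def)
      then show ?thesis unfolding C_def by (force simp: image_iff)
    qed
    also have "emeasure lborel B = emeasure ?RW B"
      using Sb B by (subst emeasure_restrict_space) auto
    finally show "emeasure (distr ?N ?RW \<phi>) B = emeasure ?RW B" .
  qed simp
  have F': "F \<in> borel_measurable ?RW"
    using F measurable_cong_sets[of ?RW "restrict_space borel W"] by (simp add: sets_restrict_space)
  have "(\<integral>\<^sup>+y. F y * indicator W y \<partial>lborel) = (\<integral>\<^sup>+y. F y \<partial>?RW)"
    using Sb by (subst nn_integral_restrict_space) auto
  also have "\<dots> = (\<integral>\<^sup>+x. F (\<phi> x) \<partial>?N)"
    using \<phi>_meas F' by (subst eq[symmetric], subst nn_integral_distr) auto
  also have "\<dots> = (\<integral>\<^sup>+x. ennreal \<bar>det (J x)\<bar> * F (\<phi> x) \<partial>?RS)"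
    using D_meas measurable_compose[OF \<phi>_meas F'] by (rule nn_integral_density)
  also have "\<dots> = (\<integral>\<^sup>+x. ennreal \<bar>det (J x)\<bar> * F (\<phi> x) * indicator S x \<partial>lborel)"
    using Sb by (subst nn_integral_restrict_space) auto
  finally show ?thesis .
qed

section \<open>The volume measure\<close>

context riemannian_manifold
begin

definition dens :: "('a, 'n) chart \<Rightarrow> real^'n \<Rightarrow> real" where
  "dens c x = sqrt (det (loc c x))"

text \<open>The mass that a volume measure has to give to a set inside the domain of
  \<open>c\<close>.\<close>

definition vol :: "('a, 'n) chart \<Rightarrow> 'a set \<Rightarrow> ennreal" where
  "vol c B = (\<integral>\<^sup>+x\<in>coord c ` B. ennreal (dens c x) \<partial>lborel)"

abbreviation borelM :: "'a measure" where
  "borelM \<equiv> restrict_space borel M"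

lemma dens_continuous: "c \<in> A \<Longrightarrow> continuous_on (img c) (dens c)"
  unfolding dens_def by (intro smooth_on_continuous_on local_metric.sqrt_det_smooth local_metric_loc)

lemma dens_nonneg: "c \<in> A \<Longrightarrow> x \<in> img c \<Longrightarrow> 0 \<le> dens c x"
  unfolding dens_def
  using posdef_det_pos[OF local_metric.G_posdef[OF local_metric_loc]] less_imp_le real_sqrt_ge_zero by blast

lemma cdom_sets: 
  assumes "c \<in> A"
  shows "cdom c \<in> sets borelM"
proof -
  obtain T where "open T" "cdom c = M \<inter> T"
    using openin_cdom[OF assms] unfolding openin_open by blast
  then show ?thesis unfolding sets_restrict_space by (intro image_eqI[of _ _ T]) auto
qed

lemma sets_borelM_subset: "B \<in> sets borelM \<Longrightarrow> B \<subseteq> M"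
  using sets.sets_into_space by (fastforce simp: space_restrict_space)

lemma coord_image_borel:
  assumes c: "c \<in> A" and B: "B \<in> sets borelM" "B \<subseteq> cdom c"
  shows "coord c ` B \<in> sets borel"
proof -
  obtain B' where B': "B' \<in> sets borel" "B = M \<inter> B'"
    using B(1) by (auto simp: sets_restrict_space)
  have "B = B' \<inter> cdom c" using B' B(2) cdom_subset[OF c] by blast
  then show ?thesis
    using homeomorphic_image_borel[OF homeo[OF c] _ B'(1)] open_image[OF c] by simp
qed

lemma param_measurable:
  assumes c: "c \<in> A"
  shows "param c \<in> measurable (restrict_space lborel (img c)) borelM"
proof -
  have "param c \<in> borel_measurable (restrict_space borel (img c))"
    using homeo[OF c] by (intro borel_measurable_continuous_on_restrict) (simp add: homeomorphism_def)
  moreover have "param c \<in> img c \<rightarrow> M" using cdom_subset[OF c] c by auto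
  ultimately have "param c \<in> measurable (restrict_space borel (img c)) borelM"
    by (intro measurable_restrict_space2) (auto simp: space_restrict_space)
  then show ?thesis
    using measurable_cong_sets[of "restrict_space lborel (img c)" "restrict_space borel (img c)" borelM borelM]
    by (simp add: sets_restrict_space)
qed

lemma dens_measurable:
  assumes c: "c \<in> A"
  shows "dens c \<in> borel_measurable (restrict_space lborel (img c))"
  using borel_measurable_continuous_on_restrict[OF dens_continuous[OF c]]
    measurable_cong_sets[of "restrict_space lborel (img c)" "restrict_space borel (img c)" "borel :: real measure" borel]
  by (simp add: sets_restrict_space)

text \<open>Realises \<open>vol c\<close> by an actual measure in coordinates, from which additivity
  is inherited.\<close>

definition chart_measure :: "('a, 'n) chart \<Rightarrow> (real^'n) measure" where
  "chart_measure c = density (restrict_space lborel (img c)) (\<lambda>x. ennreal (dens c x))"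

lemma sets_chart_measure: "sets (chart_measure c) = sets (restrict_space lborel (img c))"
  by (simp add: chart_measure_def)

lemma coord_image_sets:
  assumes c: "c \<in> A" and B: "B \<in> sets borelM" "B \<subseteq> cdom c"
  shows "coord c ` B \<in> sets (chart_measure c)"
  using coord_image_borel[OF assms] open_image[OF c] B(2)
  by (auto simp: sets_chart_measure sets_restrict_space_iff)

lemma vol_eq_emeasure:
  assumes c: "c \<in> A" and B: "B \<in> sets borelM" "B \<subseteq> cdom c"
  shows "vol c B = emeasure (chart_measure c) (coord c ` B)"
proof -
  have "emeasure (chart_measure c) (coord c ` B) =
      (\<integral>\<^sup>+x. ennreal (dens c x) * indicator (coord c ` B) x \<partial>restrict_space lborel (img c))"
    using coord_image_sets[OF assms] dens_measurable[OF c] unfolding chart_measure_def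
    by (subst emeasure_density) auto
  also have "\<dots> = (\<integral>\<^sup>+x. ennreal (dens c x) * indicator (coord c ` B) x * indicator (img c) x \<partial>lborel)"
    using open_image[OF c] by (subst nn_integral_restrict_space) auto
  also have "\<dots> = vol c B"
    unfolding vol_def using B(2) by (intro nn_integral_cong) (auto split: split_indicator)
  finally show ?thesis by simp
qed

lemma vol_suminf:
  assumes c: "c \<in> A" and B: "\<And>n::nat. B n \<in> sets borelM" "\<And>n. B n \<subseteq> cdom c" "disjoint_family B"
  shows "(\<Sum>n. vol c (B n)) = vol c (\<Union>n. B n)"
proof -
  have "inj_on (coord c) (cdom c)" using c by (metis inj_on_inverseI param_coord)
  then have "disjoint_family (\<lambda>n. coord c ` B n)"
    using B(2,3) unfolding disjoint_family_on_def by (metis image_empty inj_on_image_Int)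
  then have "(\<Sum>n. emeasure (chart_measure c) (coord c ` B n)) = emeasure (chart_measure c) (\<Union>n. coord c ` B n)"
    using coord_image_sets[OF c B(1,2)] by (intro suminf_emeasure) auto
  moreover have "vol c (\<Union>n. B n) = emeasure (chart_measure c) (coord c ` (\<Union>n. B n))"
    using B(1,2) by (intro vol_eq_emeasure c) auto
  ultimately show ?thesis
    using vol_eq_emeasure[OF c B(1,2)] by (simp add: image_UN)
qed

lemma vol_sum:
  assumes c: "c \<in> A" and I: "finite I" and B: "\<And>n. n \<in> I \<Longrightarrow> B n \<in> sets borelM" "\<And>n. n \<in> I \<Longrightarrow> B n \<subseteq> cdom c" "disjoint_family_on B I"
  shows "(\<Sum>n\<in>I. vol c (B n)) = vol c (\<Union>n\<in>I. B n)"
proof -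
  have "inj_on (coord c) (cdom c)" using c by (metis inj_on_inverseI param_coord)
  then have "disjoint_family_on (\<lambda>n. coord c ` B n) I"
    using B(2,3) unfolding disjoint_family_on_def by (metis image_empty inj_on_image_Int)
  then have "(\<Sum>n\<in>I. emeasure (chart_measure c) (coord c ` B n)) = emeasure (chart_measure c) (\<Union>n\<in>I. coord c ` B n)"
    using coord_image_sets[OF c B(1,2)] I by (intro sum_emeasure) auto
  moreover have "vol c (\<Union>n\<in>I. B n) = emeasure (chart_measure c) (coord c ` (\<Union>n\<in>I. B n))"
    using B(1,2) I by (intro vol_eq_emeasure c) auto
  moreover have "(\<Sum>n\<in>I. vol c (B n)) = (\<Sum>n\<in>I. emeasure (chart_measure c) (coord c ` B n))"
    by (intro sum.cong refl vol_eq_emeasure[OF c B(1,2)])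
  ultimately show ?thesis by (simp add: image_UN)
qed

text \<open>Change of variables under the transition map: its Jacobian factor is exactly the
  quotient of the two densities, by \<open>sqrt_det_invariant\<close>.\<close>

lemma vol_chart_independent:
  assumes c: "c \<in> A" and d: "d \<in> A" and B: "B \<in> sets borelM" "B \<subseteq> cdom c" "B \<subseteq> cdom d"
  shows "vol c B = vol d B"
proof -
  interpret C: coordinate_change "img c" "loc c" "img d" "loc d" "trans_map c d" "ovl c d"
    by (rule coordinate_change[OF c d])
  have der: "(trans_map c d has_derivative (\<lambda>h. jacmat (trans_map c d) x *v h)) (at x)" if "x \<in> ovl c d" for x
    using has_derivative_vec_components[OF C.\<phi>_differentiable[OF that]] by (simp add: jacmat_def)
  have ct: "continuous_on (ovl c' d') (trans_map c' d')" if "c' \<in> A" "d' \<in> A" for c' d'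
    using continuous_on_vec_lambda[of "ovl c' d'" "\<lambda>k x. trans_map c' d' x $ k"]
      smooth_on_continuous_on[OF trans_map_smooth[OF that]] by simp
  have hom: "homeomorphism (ovl c d) (ovl d c) (trans_map c d) (trans_map d c)"
    by (intro homeomorphismI ct c d) (auto simp: trans_map_ovl[OF c d] trans_map_ovl[OF d c])
  have cJ: "continuous_on (ovl c d) (\<lambda>x. \<bar>det (jacmat (trans_map c d) x)\<bar>)"
    unfolding det_def
    by (intro continuous_intros smooth_on_continuous_on[OF C.jacobian_smooth])
  define F where "F y = ennreal (dens d y) * indicator (coord d ` B) y" for y
  have "F \<in> borel_measurable (restrict_space borel (ovl d c))"
  proof -
    have "dens d \<in> borel_measurable (restrict_space borel (ovl d c))"
      by (rule borel_measurable_continuous_on_restrict[OF continuous_on_subset[OF dens_continuous[OF d] ovl_subset]])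
    moreover have "indicator (coord d ` B) \<in> borel_measurable (restrict_space borel (ovl d c))"
      using coord_image_borel[OF d B(1,3)] by (intro measurable_restrict_space1) auto
    ultimately show ?thesis unfolding F_def by measurable
  qed
  then have "(\<integral>\<^sup>+y. F y * indicator (ovl d c) y \<partial>lborel) =
      (\<integral>\<^sup>+x. ennreal \<bar>det (jacmat (trans_map c d) x)\<bar> * F (trans_map c d x) * indicator (ovl c d) x \<partial>lborel)"
    using nn_integral_image[OF open_ovl[OF c d] open_ovl[OF d c] hom der cJ] by blast
  moreover have "(\<integral>\<^sup>+y. F y * indicator (ovl d c) y \<partial>lborel) = vol d B"
    unfolding vol_def F_def using B by (intro nn_integral_cong) (auto simp: ovl_def split: split_indicator)
  moreover have "(\<integral>\<^sup>+x. ennreal \<bar>det (jacmat (trans_map c d) x)\<bar> * F (trans_map c d x) * indicator (ovl c d) x \<partial>lborel) = vol c B"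
    unfolding vol_def
  proof (rule nn_integral_cong)
    fix x
    show "ennreal \<bar>det (jacmat (trans_map c d) x)\<bar> * F (trans_map c d x) * indicator (ovl c d) x =
        ennreal (dens c x) * indicator (coord c ` B) x"
    proof (cases "x \<in> ovl c d")
      case True
      interpret FC: frame_change "loc c x" "loc d (trans_map c d x)" "jacmat (trans_map c d) x"
        by (rule C.frame_change[OF True])
      have "trans_map c d x \<in> coord d ` B \<longleftrightarrow> x \<in> coord c ` B"
      proof -
        obtain p where p: "p \<in> cdom c" "p \<in> cdom d" "x = coord c p" using True by (auto simp: ovl_def)
        have tr: "trans_map c d x = coord d p" using p c by (simp add: trans_map_def)
        have "coord e p \<in> coord e ` B \<longleftrightarrow> p \<in> B" if e: "e \<in> A" "B \<subseteq> cdom e" "p \<in> cdom e" for e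
        proof
          assume "coord e p \<in> coord e ` B"
          then obtain q where "q \<in> B" "coord e p = coord e q" by blast
          then show "p \<in> B" using param_coord[OF e(1,3)] param_coord[OF e(1), of q] e(2) by auto
        qed blast
        then show ?thesis using p B c d tr by simp
      qed
      moreover have "dens c x = \<bar>det (jacmat (trans_map c d) x)\<bar> * dens d (trans_map c d x)"
        unfolding dens_def by (rule FC.sqrt_det_invariant)
      moreover have "dens d (trans_map c d x) \<ge> 0"
        using dens_nonneg[OF d C.\<phi>_U'[OF True]] .
      ultimately show ?thesis
        using True by (simp add: F_def ennreal_mult' split: split_indicator)
    next
      case False
      then have "x \<notin> coord c ` B" using B by (auto simp: ovl_def)
      with False show ?thesis by simp
    qed
  qed
  ultimately show ?thesis by simp
qed

end

section \<open>Existence and uniqueness of the volume measure\<close>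

locale compact_riemannian_manifold = riemannian_manifold M A g
  for M :: "'a::{t2_space,second_countable_topology} set"
    and A :: "('a, 'n::finite) chart set"
    and g :: "('a, 'n) tensor2" +
  assumes compact_M: "compact M"
begin

text \<open>Finitely many chart domains cover by compactness; removing the earlier ones from each
  leaves disjoint Borel pieces, so the volume can be glued as a finite sum.\<close>

lemma finite_chart_partition:
  "\<exists>(m :: nat) cs Ds. (\<forall>i<m. cs i \<in> A \<and> Ds i \<in> sets borelM \<and> Ds i \<subseteq> cdom (cs i)) \<and>
    disjoint_family_on Ds {..<m} \<and> (\<Union>i<m. Ds i) = M"
proof -
  have "(\<Union>c\<in>A. cdom c) = M" using manifold by (simp add: smooth_manifold_def)
  then have "\<exists>D\<subseteq>cdom ` A. finite D \<and> M \<subseteq> \<Union>D"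
    using compact_M[unfolded compact_eq_openin_cover, rule_format, of "cdom ` A"] openin_cdom by blast
  then obtain D where D: "D \<subseteq> cdom ` A" "finite D" "M \<subseteq> \<Union>D" by blast
  obtain C where C: "C \<subseteq> A" "finite C" "D = cdom ` C"
    using finite_subset_image[OF D(2,1)] by blast
  obtain m and cs :: "nat \<Rightarrow> ('a, 'n) chart" where cs: "C = cs ` {i. i < m}"
    using finite_imp_nat_seg_image_inj_on[OF C(2)] by blast
  have csA: "cs i \<in> A" if "i < m" for i using cs C that by blast
  define Ds where "Ds i = cdom (cs i) - (\<Union>j<i. cdom (cs j))" for i
  show ?thesis
  proof (intro exI conjI allI impI)
    show "Ds i \<in> sets borelM" if "i < m" for i
      unfolding Ds_def using that by (intro sets.Diff sets.finite_UN cdom_sets csA) auto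
    show "disjoint_family_on Ds {..<m}"
      unfolding disjoint_family_on_def
    proof (intro ballI impI)
      fix i j :: nat assume "i \<noteq> j"
      then consider "i < j" | "j < i" by linarith
      then show "Ds i \<inter> Ds j = {}" by cases (auto simp: Ds_def)
    qed
    show "(\<Union>i<m. Ds i) = M"
    proof (intro equalityI subsetI)
      fix p assume "p \<in> (\<Union>i<m. Ds i)"
      then obtain i where "i < m" "p \<in> cdom (cs i)" by (auto simp: Ds_def)
      then show "p \<in> M" using cdom_subset[OF csA] by blast
    next
      fix p assume "p \<in> M"
      then obtain i0 where "i0 < m" "p \<in> cdom (cs i0)" using D(3) C(3) cs by auto
      define i where "i = (LEAST i. p \<in> cdom (cs i))"
      have "p \<in> cdom (cs i)" "i \<le> i0" "\<And>j. j < i \<Longrightarrow> p \<notin> cdom (cs j)"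
        unfolding i_def using \<open>p \<in> cdom (cs i0)\<close> by (auto intro: LeastI Least_le dest: not_less_Least)
      then show "p \<in> (\<Union>i<m. Ds i)" using \<open>i0 < m\<close> by (auto simp: Ds_def intro!: exI[of _ i])
    qed
  qed (auto simp: Ds_def csA)
qed

lemma is_volume_measure_iff:
  "is_volume_measure M A g \<mu> \<longleftrightarrow>
     sets \<mu> = sets borelM \<and> (\<forall>c\<in>A. \<forall>B\<in>sets borelM. B \<subseteq> cdom c \<longrightarrow> emeasure \<mu> B = vol c B)"
  by (auto simp: is_volume_measure_def vol_def dens_def loc_def)

text \<open>Existence: adding up \<open>vol\<close> over the pieces gives a measure, and chart
  independence on each piece shows that it has the right value in every chart. Uniqueness: the
  pieces lie in charts, where the mass is prescribed.\<close>

lemma ex1_volume_measure: "\<exists>!\<mu>. is_volume_measure M A g \<mu>"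
proof -
  obtain m :: nat and cs Ds where cs: "\<And>i. i < m \<Longrightarrow> cs i \<in> A" "\<And>i. i < m \<Longrightarrow> Ds i \<in> sets borelM"
    "\<And>i. i < m \<Longrightarrow> Ds i \<subseteq> cdom (cs i)" "disjoint_family_on Ds {..<m}" "(\<Union>i<m. Ds i) = M"
    using finite_chart_partition by blast
  define \<mu>0 where "\<mu>0 B = (\<Sum>i<m. vol (cs i) (B \<inter> Ds i))" for B
  have DB: "B \<inter> Ds i \<in> sets borelM" "B \<inter> Ds i \<subseteq> cdom (cs i)" if "B \<in> sets borelM" "i < m" for B i
    using that cs by auto
  have BU: "B = (\<Union>i<m. B \<inter> Ds i)" if "B \<in> sets borelM" for B
    using sets_borelM_subset[OF that] cs(5) by blast
  have dis: "disjoint_family_on (\<lambda>i. B \<inter> Ds i) {..<m}" for B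
    using cs(4) by (auto simp: disjoint_family_on_def)
  have pos: "positive (sets borelM) \<mu>0"
    by (simp add: positive_def \<mu>0_def vol_def)
  have ca: "countably_additive (sets borelM) \<mu>0"
    unfolding countably_additive_def
  proof (intro allI impI)
    fix B :: "nat \<Rightarrow> 'a set"
    assume B: "range B \<subseteq> sets borelM" "disjoint_family B" "\<Union>(range B) \<in> sets borelM"
    have "(\<Sum>n. \<mu>0 (B n)) = (\<Sum>i<m. \<Sum>n. vol (cs i) (B n \<inter> Ds i))"
      unfolding \<mu>0_def by (rule suminf_sum) auto
    also have "\<dots> = (\<Sum>i<m. vol (cs i) (\<Union>n. B n \<inter> Ds i))"
    proof (intro sum.cong refl vol_suminf)
      fix i n assume i: "i \<in> {..<m}"
      show "cs i \<in> A" using cs i by auto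
      show "B n \<inter> Ds i \<in> sets borelM" "B n \<inter> Ds i \<subseteq> cdom (cs i)" using DB[of "B n" i] B i by auto
      show "disjoint_family (\<lambda>n. B n \<inter> Ds i)" using B(2) by (auto simp: disjoint_family_on_def)
    qed
    also have "\<dots> = \<mu>0 (\<Union>(range B))" by (simp add: \<mu>0_def)
    finally show "(\<Sum>n. \<mu>0 (B n)) = \<mu>0 (\<Union>(range B))" .
  qed
  define \<mu> where "\<mu> = measure_of (space borelM) (sets borelM) \<mu>0"
  have sets_\<mu>: "sets \<mu> = sets borelM" unfolding \<mu>_def by simp
  have em: "emeasure \<mu> B = \<mu>0 B" if "B \<in> sets borelM" for B
    unfolding \<mu>_def using that pos ca sets.sigma_algebra_axioms[of borelM]
    by (intro emeasure_measure_of_sigma) auto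
  have "is_volume_measure M A g \<mu>"
    unfolding is_volume_measure_iff
  proof (intro conjI ballI impI sets_\<mu>)
    fix c B assume c: "c \<in> A" and B: "B \<in> sets borelM" "B \<subseteq> cdom c"
    have "emeasure \<mu> B = (\<Sum>i<m. vol c (B \<inter> Ds i))"
      unfolding em[OF B(1)] \<mu>0_def
      by (intro sum.cong refl vol_chart_independent DB B(1) c) (use cs B in auto)
    also have "\<dots> = vol c (\<Union>i<m. B \<inter> Ds i)"
      by (rule vol_sum[OF c]) (use DB[OF B(1)] B dis in auto)
    finally show "emeasure \<mu> B = vol c B" using BU[OF B(1)] by simp
  qed
  moreover have "\<nu> = \<mu>" if "is_volume_measure M A g \<nu>" for \<nu>
  proof (rule measure_eqI)
    have \<nu>: "sets \<nu> = sets borelM" "\<And>c B. c \<in> A \<Longrightarrow> B \<in> sets borelM \<Longrightarrow> B \<subseteq> cdom c \<Longrightarrow> emeasure \<nu> B = vol c B"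
      using that unfolding is_volume_measure_iff by blast+
    show "sets \<nu> = sets \<mu>" using \<nu>(1) sets_\<mu> by simp
    fix B assume "B \<in> sets \<nu>"
    then have B: "B \<in> sets borelM" using \<nu>(1) by simp
    have "emeasure \<nu> B = emeasure \<nu> (\<Union>i<m. B \<inter> Ds i)" using BU[OF B] by simp
    also have "\<dots> = (\<Sum>i<m. emeasure \<nu> (B \<inter> Ds i))"
      using DB(1)[OF B] \<nu>(1) dis by (intro sum_emeasure[symmetric]) auto
    also have "\<dots> = \<mu>0 B"
      unfolding \<mu>0_def by (intro sum.cong refl \<nu>(2) DB B) (use cs in auto)
    finally show "emeasure \<nu> B = emeasure \<mu> B" using em[OF B] by simp
  qed
  ultimately show ?thesis by blast
qed

section \<open>Integration in a single chart\<close>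

abbreviation dv :: "'a measure" where
  "dv \<equiv> volume_measure M A g"

lemma dv_volume_measure: "is_volume_measure M A g dv"
  unfolding volume_measure_def by (rule theI'[OF ex1_volume_measure])

lemma sets_dv: "sets dv = sets borelM"
  using dv_volume_measure by (simp add: is_volume_measure_iff)

lemma space_dv: "space dv = M"
  using sets_eq_imp_space_eq[OF sets_dv] by (simp add: space_restrict_space)

lemma emeasure_dv: "c \<in> A \<Longrightarrow> B \<in> sets borelM \<Longrightarrow> B \<subseteq> cdom c \<Longrightarrow> emeasure dv B = vol c B"
  using dv_volume_measure by (simp add: is_volume_measure_iff)

lemma continuous_on_M_measurable:
  assumes "continuous_on M (s :: 'a \<Rightarrow> real)"
  shows "s \<in> borel_measurable dv"
  using borel_measurable_continuous_on_restrict[OF assms]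
    measurable_cong_sets[OF sets_dv refl, of "borel :: real measure"] by simp

context
  fixes c assumes c: "c \<in> A"
begin

lemma coord_measurable: "coord c \<in> measurable (restrict_space dv (cdom c)) (restrict_space lborel (img c))"
proof -
  have "coord c \<in> borel_measurable (restrict_space borel (cdom c))"
    using homeo[OF c] by (intro borel_measurable_continuous_on_restrict) (simp add: homeomorphism_def)
  then have "coord c \<in> measurable (restrict_space borel (cdom c)) (restrict_space borel (img c))"
    by (intro measurable_restrict_space2) (auto simp: space_restrict_space)
  moreover have "sets (restrict_space dv (cdom c)) = sets (restrict_space borel (cdom c))"
  proof -
    have "sets (restrict_space dv (cdom c)) = sets (restrict_space borelM (cdom c))"
      by (rule sets_restrict_space_cong[OF sets_dv])
    also have "\<dots> = sets (restrict_space borel (cdom c))"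
      using cdom_subset[OF c] by (simp add: restrict_restrict_space Int_absorb1 Int_commute sets_restrict_restrict_space)
    finally show ?thesis .
  qed
  moreover have "sets (restrict_space lborel (img c)) = sets (restrict_space borel (img c))"
    by (rule sets_restrict_space_cong) simp
  ultimately show ?thesis using measurable_cong_sets by blast
qed

lemma distr_coord: "distr (restrict_space dv (cdom c)) (restrict_space lborel (img c)) (coord c) = chart_measure c"
proof (rule measure_eqI)
  let ?R = "restrict_space lborel (img c)"
  show "sets (distr (restrict_space dv (cdom c)) ?R (coord c)) = sets (chart_measure c)"
    by (simp add: sets_chart_measure)
  fix B assume "B \<in> sets (distr (restrict_space dv (cdom c)) ?R (coord c))"
  then have B: "B \<in> sets ?R" by simp
  have cd: "cdom c \<in> sets dv" using cdom_sets[OF c] sets_dv by simp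
  have sp: "cdom c \<inter> space dv \<in> sets dv" using cd by (simp add: space_dv cdom_subset[OF c] Int_absorb2)
  define B' where "B' = coord c -` B \<inter> cdom c"
  have "B' \<in> sets (restrict_space dv (cdom c))"
    using measurable_sets[OF coord_measurable B] cdom_subset[OF c]
    by (simp add: B'_def space_restrict_space space_dv Int_absorb2)
  then have B': "B' \<in> sets borelM" "B' \<subseteq> cdom c"
    using sp by (auto simp: sets_restrict_space_iff sets_dv)
  have "B \<subseteq> img c"
    using B open_image[OF c] by (auto simp: sets_restrict_space_iff)
  then have im: "coord c ` B' = B" by (auto simp: B'_def)
  have "emeasure (distr (restrict_space dv (cdom c)) ?R (coord c)) B = emeasure (restrict_space dv (cdom c)) B'"
    using coord_measurable B cdom_subset[OF c]
    by (subst emeasure_distr) (auto simp: B'_def space_restrict_space space_dv Int_absorb2)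
  also have "\<dots> = emeasure dv B'"
    using sp B'(2) by (rule emeasure_restrict_space)
  also have "\<dots> = vol c B'" by (rule emeasure_dv[OF c B'])
  also have "\<dots> = emeasure (chart_measure c) B"
    using vol_eq_emeasure[OF c B'] im by simp
  finally show "emeasure (distr (restrict_space dv (cdom c)) ?R (coord c)) B = emeasure (chart_measure c) B" .
qed

text \<open>Restriction to the chart domain, pushforward to coordinates and evaluation of the
  density. Integrability is carried along because Bochner integrals are additive only for integrable
  functions.\<close>

lemma integral_in_chart:
  fixes s :: "'a \<Rightarrow> real"
  assumes s: "s \<in> borel_measurable dv" and supp: "\<And>p. p \<in> M \<Longrightarrow> p \<notin> cdom c \<Longrightarrow> s p = 0"
  shows "integral\<^sup>L dv s = (\<integral>x. indicator (img c) x * (dens c x * s (param c x)) \<partial>lborel)"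
    and "integrable dv s \<longleftrightarrow> integrable lborel (\<lambda>x. indicator (img c) x * (dens c x * s (param c x)))"
proof -
  let ?R = "restrict_space lborel (img c)" and ?S = "restrict_space dv (cdom c)"
  have sp: "cdom c \<inter> space dv \<in> sets dv"
    using cdom_sets[OF c] sets_dv by (simp add: space_dv cdom_subset[OF c] Int_absorb2)
  have spR: "img c \<inter> space lborel \<in> sets lborel" using open_image[OF c] by simp
  have s': "s \<in> borel_measurable borelM" using s measurable_cong_sets[OF sets_dv refl] by blast
  have sp_meas: "(\<lambda>x. s (param c x)) \<in> borel_measurable ?R"
    using measurable_compose[OF param_measurable[OF c] s'] .
  have dn: "AE x in ?R. 0 \<le> dens c x"
    by (rule AE_I2) (auto simp: space_restrict_space intro: dens_nonneg[OF c])
  have ind: "indicator (cdom c) p *\<^sub>R s p = s p" if "p \<in> space dv" for p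
    using supp that by (auto simp: space_dv split: split_indicator)
  have chart_cancel: "s (param c (coord c p)) = s p" if "p \<in> space ?S" for p
    using that c by (simp add: space_restrict_space)
  have "integral\<^sup>L dv s = integral\<^sup>L dv (\<lambda>p. indicator (cdom c) p *\<^sub>R s p)"
    by (rule Bochner_Integration.integral_cong) (simp_all only: ind)
  also have "\<dots> = integral\<^sup>L ?S s" by (rule integral_restrict_space[OF sp, symmetric])
  also have "\<dots> = integral\<^sup>L ?S (\<lambda>p. s (param c (coord c p)))"
    by (rule Bochner_Integration.integral_cong) (simp_all only: chart_cancel)
  also have "\<dots> = integral\<^sup>L (chart_measure c) (\<lambda>x. s (param c x))"
    unfolding distr_coord[symmetric] by (rule integral_distr[OF coord_measurable sp_meas, symmetric])
  also have "\<dots> = integral\<^sup>L ?R (\<lambda>x. dens c x *\<^sub>R s (param c x))"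
    unfolding chart_measure_def by (rule integral_density[OF sp_meas dens_measurable[OF c] dn])
  also have "\<dots> = integral\<^sup>L lborel (\<lambda>x. indicator (img c) x *\<^sub>R (dens c x *\<^sub>R s (param c x)))"
    by (rule integral_restrict_space[OF spR])
  finally show "integral\<^sup>L dv s = (\<integral>x. indicator (img c) x * (dens c x * s (param c x)) \<partial>lborel)" by simp
  have "integrable dv s \<longleftrightarrow> integrable dv (\<lambda>p. indicator (cdom c) p *\<^sub>R s p)"
    by (rule Bochner_Integration.integrable_cong) (simp_all only: ind)
  also have "\<dots> \<longleftrightarrow> integrable ?S s" by (rule integrable_restrict_space[OF sp, symmetric])
  also have "\<dots> \<longleftrightarrow> integrable ?S (\<lambda>p. s (param c (coord c p)))"
    by (rule Bochner_Integration.integrable_cong) (simp_all only: chart_cancel)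
  also have "\<dots> \<longleftrightarrow> integrable (chart_measure c) (\<lambda>x. s (param c x))"
    unfolding distr_coord[symmetric] by (rule integrable_distr_eq[OF coord_measurable sp_meas, symmetric])
  also have "\<dots> \<longleftrightarrow> integrable ?R (\<lambda>x. dens c x *\<^sub>R s (param c x))"
    unfolding chart_measure_def by (rule integrable_density[OF sp_meas dens_measurable[OF c] dn])
  also have "\<dots> \<longleftrightarrow> integrable lborel (\<lambda>x. indicator (img c) x *\<^sub>R (dens c x *\<^sub>R s (param c x)))"
    by (rule integrable_restrict_space[OF spR])
  finally show "integrable dv s \<longleftrightarrow> integrable lborel (\<lambda>x. indicator (img c) x * (dens c x * s (param c x)))" by simp
qed

end

end

section \<open>Compactly supported functions of class \<open>C\<^sup>1\<close>\<close>

text \<open>Being of class C^k is local. This glues a function given in coordinates to its extension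
  by zero.\<close>

lemma Ck_on_open_Un:
  assumes "open S" "open T" "Ck_on k S u" "Ck_on k T u"
  shows "Ck_on k (S \<union> T) u"
  using assms(3,4)
proof (induction k arbitrary: u)
  case 0
  then show ?case using assms(1,2) by (simp add: continuous_on_open_Un)
next
  case (Suc k)
  then show ?case
    using assms(1,2) by (auto simp: differentiable_on_eq_differentiable_at open_Un)
qed

lemma pd_eq_0_outside:
  assumes "closed K" "\<And>x. x \<notin> K \<Longrightarrow> w x = 0" "x \<notin> K"
  shows "pd j w x = 0"
  using pd_cong[of "- K" x w "\<lambda>_. 0" j] assms by (auto simp: open_Compl)

lemma integrable_compact_support:
  fixes w :: "'b::euclidean_space \<Rightarrow> real"
  assumes "compact K" "continuous_on K w" "\<And>x. x \<notin> K \<Longrightarrow> w x = 0"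
  shows "integrable lborel w"
proof -
  have "integrable lborel (\<lambda>x. indicator K x *\<^sub>R w x)"
    by (rule borel_integrable_compact[OF assms(1,2)])
  moreover have "(\<lambda>x. indicator K x *\<^sub>R w x) = w"
    using assms(3) by (auto simp: fun_eq_iff split: split_indicator)
  ultimately show ?thesis by (simp only:)
qed

text \<open>The integral of a derivative is the limit of difference quotients, whose integrals vanish by
  translation invariance.\<close>

lemma integral_pd_compact_support:
  fixes w :: "real^'n::finite \<Rightarrow> real"
  assumes K: "compact K" and w: "Ck_on 1 UNIV w" and supp: "\<And>x. x \<notin> K \<Longrightarrow> w x = 0"
  shows "(\<integral>x. pd j w x \<partial>lborel) = 0"
proof -
  define e where "e = (axis j 1 :: real^'n)"
  have diff: "w differentiable (at x)" for x
    using Ck_on_differentiable[of 0 UNIV w x] w by (simp del: Ck_on.simps)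
  have cw: "continuous_on UNIV w" using w Ck_on_continuous_on by blast
  have cpd: "continuous_on UNIV (pd j w)" using w by simp
  have supp': "pd j w x = 0" if "x \<notin> K" for x
    using pd_eq_0_outside[OF compact_imp_closed[OF K] supp that] .
  obtain B where B: "\<And>x. \<bar>pd j w x\<bar> \<le> B"
  proof -
    have "bounded (pd j w ` K)"
      using compact_continuous_image[OF continuous_on_subset[OF cpd] K] compact_imp_bounded by blast
    then obtain b where "\<And>x. x \<in> K \<Longrightarrow> \<bar>pd j w x\<bar> \<le> b" "b > 0"
      unfolding bounded_pos by auto
    then have "\<bar>pd j w x\<bar> \<le> b" for x using supp'[of x] by (cases "x \<in> K") auto
    then show ?thesis by (rule that)
  qed
  obtain \<rho> where \<rho>: "\<And>x. x \<in> K \<Longrightarrow> norm x \<le> \<rho>"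
    using compact_imp_bounded[OF K] bounded_iff by blast
  \<comment> \<open>The support ball enlarged by 1, the largest step \<open>\<delta> k\<close>:
    outside \<open>C\<close> neither \<open>x\<close> nor the shifted point can lie in
    \<open>K\<close>.\<close>
  define C where "C = cball (0::real^'n) (\<rho> + 1)"
  define \<delta> where "\<delta> k = inverse (real (Suc k))" for k
  have \<delta>: "0 < \<delta> k" "\<delta> k \<le> 1" for k by (auto simp: \<delta>_def field_simps)
  have \<delta>0: "\<delta> \<longlonglongrightarrow> 0" unfolding \<delta>_def by (rule LIMSEQ_inverse_real_of_nat)
  define s where "s k x = (w (x + \<delta> k *\<^sub>R e) - w x) / \<delta> k" for k x
  have line: "((\<lambda>t. w (x + t *\<^sub>R e)) has_real_derivative pd j w (x + t *\<^sub>R e)) (at t)" for x t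
    unfolding e_def by (rule has_real_derivative_along_axis[OF diff])
  have int_w: "integrable lborel w"
    by (rule integrable_compact_support[OF K continuous_on_subset[OF cw] supp]) auto
  have int_shift: "integrable lborel (\<lambda>x. w (x + v))" and int_shift_eq: "(\<integral>x. w (x + v) \<partial>lborel) = (\<integral>x. w x \<partial>lborel)" for v
  proof -
    have wm: "w \<in> borel_measurable borel" using cw by (rule borel_measurable_continuous_onI)
    have "integrable (distr lborel borel ((+) v)) w" using int_w by (simp add: lborel_distr_plus)
    then show "integrable lborel (\<lambda>x. w (x + v))"
      using wm by (subst (asm) integrable_distr_eq) (auto simp: add.commute)
    have "(\<integral>x. w x \<partial>lborel) = (\<integral>x. w x \<partial>distr lborel borel ((+) v))" by (simp add: lborel_distr_plus)
    also have "\<dots> = (\<integral>x. w (v + x) \<partial>lborel)" using wm by (intro integral_distr) auto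
    finally show "(\<integral>x. w (x + v) \<partial>lborel) = (\<integral>x. w x \<partial>lborel)" by (simp add: add.commute)
  qed
  have s0: "integral\<^sup>L lborel (s k) = 0" for k
    unfolding s_def using int_shift[of "\<delta> k *\<^sub>R e"] int_w int_shift_eq[of "\<delta> k *\<^sub>R e"] by simp
  \<comment> \<open>By the mean value theorem each difference quotient is a value of the derivative,
    which provides the dominating function.\<close>
  have bound: "norm (s k x) \<le> B * indicator C x" for k x
  proof (cases "x \<in> C")
    case True
    have "\<exists>z. 0 < z \<and> z < \<delta> k \<and> w (x + \<delta> k *\<^sub>R e) - w (x + 0 *\<^sub>R e) = (\<delta> k - 0) * pd j w (x + z *\<^sub>R e)"
      by (rule MVT2[OF \<delta>(1)]) (rule line)
    then obtain z where "w (x + \<delta> k *\<^sub>R e) - w x = \<delta> k * pd j w (x + z *\<^sub>R e)" by auto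
    then have "s k x = pd j w (x + z *\<^sub>R e)" using \<delta>(1)[of k] by (simp add: s_def)
    then show ?thesis using True B by simp
  next
    case False
    then have nx: "norm x > \<rho> + 1" by (simp add: C_def)
    have "x \<notin> K" using nx \<rho> by fastforce
    moreover have "x + \<delta> k *\<^sub>R e \<notin> K"
    proof
      assume "x + \<delta> k *\<^sub>R e \<in> K"
      then have "norm (x + \<delta> k *\<^sub>R e) \<le> \<rho>" by (rule \<rho>)
      moreover have "norm x \<le> norm (x + \<delta> k *\<^sub>R e) + norm (\<delta> k *\<^sub>R e)"
        using norm_triangle_ineq4[of "x + \<delta> k *\<^sub>R e" "\<delta> k *\<^sub>R e"] by simp
      moreover have "norm (\<delta> k *\<^sub>R e) \<le> 1" using \<delta>[of k] by (simp add: e_def norm_axis_1)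
      ultimately show False using nx by linarith
    qed
    ultimately show ?thesis using False supp by (simp add: s_def)
  qed
  have lim: "(\<lambda>k. s k x) \<longlonglongrightarrow> pd j w x" for x
  proof -
    have "((\<lambda>t. (w (x + t *\<^sub>R e) - w x) / t) \<longlongrightarrow> pd j w x) (at 0)"
      using line[of x 0] by (simp add: has_field_derivative_iff)
    moreover have "filterlim \<delta> (at 0) sequentially"
      using \<delta>0 \<delta>(1) by (simp add: filterlim_at eventually_sequentially less_imp_neq[symmetric])
    ultimately show ?thesis
      unfolding s_def by (rule filterlim_compose)
  qed
  have "(\<lambda>k. integral\<^sup>L lborel (s k)) \<longlonglongrightarrow> integral\<^sup>L lborel (pd j w)"
  proof (rule integral_dominated_convergence[where w = "\<lambda>x. B * indicator C x"])
    show "pd j w \<in> borel_measurable lborel"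
      using borel_measurable_continuous_onI[OF cpd] by simp
    show "s k \<in> borel_measurable lborel" for k
      unfolding s_def using borel_measurable_integrable[OF int_shift] borel_measurable_integrable[OF int_w]
      by (intro borel_measurable_divide borel_measurable_diff) auto
    show "integrable lborel (\<lambda>x. B * indicator C x :: real)"
      unfolding C_def by (intro integrable_mult_right integrable_real_indicator)
        (use emeasure_bounded_finite[OF bounded_cball] in auto)
  qed (use lim bound in auto)
  then show ?thesis
    unfolding s0 using LIMSEQ_unique tendsto_const by blast
qed

section \<open>Bump functions\<close>

text \<open>Squaring removes the kink of the positive part: at 0 the difference quotient is at most
  |h|.\<close>

lemma has_real_derivative_max_0_squared: "((\<lambda>t. (max 0 t)\<^sup>2) has_real_derivative 2 * max 0 t) (at (t::real))"
proof -
  consider "t > 0" | "t < 0" | "t = 0" by linarith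
  then show ?thesis
  proof cases
    case 1
    have "((\<lambda>t. t\<^sup>2) has_real_derivative 2 * t) (at t)" by (auto intro!: derivative_eq_intros)
    moreover have "eventually (\<lambda>y. y\<^sup>2 = (max 0 y)\<^sup>2) (nhds t)"
      using eventually_nhds_in_open[of "{0<..}" t] 1 by (auto elim!: eventually_mono simp: max_def)
    ultimately show ?thesis using 1 DERIV_cong_ev[OF refl _ refl, of "\<lambda>y. y\<^sup>2" "\<lambda>y. (max 0 y)\<^sup>2" t "2 * t"] by simp
  next
    case 2
    have "((\<lambda>t. 0) has_real_derivative 0) (at t)" by auto
    moreover have "eventually (\<lambda>y. 0 = (max 0 y)\<^sup>2) (nhds t)"
      using eventually_nhds_in_open[of "{..<0}" t] 2 by (auto elim!: eventually_mono simp: max_def)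
    ultimately show ?thesis using 2 DERIV_cong_ev[OF refl _ refl, of "\<lambda>y. 0" "\<lambda>y. (max 0 y)\<^sup>2" t 0] by simp
  next
    case 3
    have "((\<lambda>h::real. (max 0 h)\<^sup>2 / h) \<longlongrightarrow> 0) (at 0)"
    proof (rule Lim_null_comparison)
      show "eventually (\<lambda>h::real. norm ((max 0 h)\<^sup>2 / h) \<le> \<bar>h\<bar>) (at 0)"
        by (rule always_eventually) (auto simp: max_def power2_eq_square)
      show "((\<lambda>h::real. \<bar>h\<bar>) \<longlongrightarrow> 0) (at 0)" by (auto intro!: tendsto_eq_intros)
    qed
    then show ?thesis using 3 by (simp add: has_field_derivative_iff)
  qed
qed

text \<open>For \<open>r > 0\<close> it is positive exactly on the open ball. The squared distance
  is written out in coordinates so that its smoothness is that of a polynomial.\<close>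

definition bump :: "real^'n::finite \<Rightarrow> real \<Rightarrow> real^'n \<Rightarrow> real" where
  "bump a r x = (max 0 (r\<^sup>2 - (\<Sum>k\<in>UNIV. (x $ k - a $ k) * (x $ k - a $ k))))\<^sup>2"

lemma bump_nonneg: "0 \<le> bump a r x"
  by (simp add: bump_def)

lemma sum_square_eq_dist: "(\<Sum>k\<in>UNIV. (x $ k - a $ k) * (x $ k - a $ k)) = (dist x a)\<^sup>2" for x a :: "real^'n::finite"
  by (simp add: dist_norm power2_norm_eq_inner inner_vec_def)

lemma bump_eq_0: "r > 0 \<Longrightarrow> x \<notin> cball a r \<Longrightarrow> bump a r x = 0"
  using power_strict_mono[of r "dist x a" 2]
  by (simp add: bump_def sum_square_eq_dist dist_commute max_def)

lemma bump_pos: "r > 0 \<Longrightarrow> x \<in> ball a r \<Longrightarrow> bump a r x > 0"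
  using power_strict_mono[of "dist x a" r 2]
  by (simp add: bump_def sum_square_eq_dist dist_commute)

lemma smooth_on_component: "open S \<Longrightarrow> smooth_on S (\<lambda>x::real^'n::finite. x $ k)"
proof -
  assume S: "open S"
  have d: "(\<lambda>x::real^'n. x $ k) differentiable (at x)" for x
    by (intro bounded_linear_imp_differentiable bounded_linear_vec_nth)
  have "pd i (\<lambda>x::real^'n. x $ k) = (\<lambda>x. axis i 1 $ k)" for i
    by (rule ext, rule pd_eqI)
      (intro bounded_linear_imp_has_derivative bounded_linear_vec_nth)
  then have "Ck_on n S (\<lambda>x::real^'n. x $ k)" for n
    using d by (cases n) (auto simp: continuous_on_component differentiable_at_imp_differentiable_on
        intro: continuous_intros)
  then show ?thesis by (simp add: smooth_on_def)
qed

lemma C1_bump: "Ck_on 1 UNIV (bump a r)"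
proof -
  define u where "u x = r\<^sup>2 - (\<Sum>k\<in>UNIV. (x $ k - a $ k) * (x $ k - a $ k))" for x
  have u: "smooth_on UNIV u"
    unfolding u_def by (intro smooth_on_diff smooth_on_sum smooth_on_mult smooth_on_const smooth_on_component open_UNIV)
  have du: "u differentiable (at x)" for x using smooth_on_differentiable[OF u open_UNIV] by simp
  note chain = pd_real_compose[OF du has_real_derivative_max_0_squared]
  have eq: "bump a r = (\<lambda>x. (max 0 (u x))\<^sup>2)" by (simp add: bump_def u_def fun_eq_iff)
  have "continuous_on UNIV (\<lambda>x. 2 * max 0 (u x) * pd i u x)" for i
    using smooth_on_continuous_on[OF u] smooth_on_continuous_on[OF smooth_on_pd[OF u]]
    by (intro continuous_intros continuous_on_max) auto
  then show ?thesis
    unfolding eq using chain by (auto simp: differentiable_on_def)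
qed


section \<open>Integration by parts on the manifold\<close>

context riemannian_manifold
begin

definition C1_fun :: "('a \<Rightarrow> real) \<Rightarrow> bool" where
  "C1_fun u \<longleftrightarrow> (\<forall>c\<in>A. Ck_on 1 (img c) (\<lambda>x. u (param c x)))"

definition chart_continuous :: "('a \<Rightarrow> real) \<Rightarrow> bool" where
  "chart_continuous u \<longleftrightarrow> (\<forall>c\<in>A. continuous_on (img c) (\<lambda>x. u (param c x)))"

lemma C1_fun_chart_continuous: "C1_fun u \<Longrightarrow> chart_continuous u"
  unfolding C1_fun_def chart_continuous_def using Ck_on_continuous_on by blast

lemma chart_continuous_on_M:
  assumes "chart_continuous u"
  shows "continuous_on M u"
  unfolding continuous_on_eq_continuous_within
proof
  fix p assume p: "p \<in> M"
  define c where "c = chart_at A p"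
  note c = chart_at[OF p, folded c_def]
  have "continuous_on (img c) (\<lambda>x. u (param c x))" "continuous_on (cdom c) (coord c)"
    using assms c(1) homeo[OF c(1)] by (simp_all add: chart_continuous_def homeomorphism_def)
  then have "continuous_on (cdom c) (\<lambda>q. u (param c (coord c q)))"
    by (rule continuous_on_compose2[OF _ _ subset_refl])
  then have "continuous_on (cdom c) u"
    using c(1) by (subst (asm) continuous_on_cong[OF refl, where g = u]) auto
  then have "continuous (at p within cdom c) u"
    using c(2) by (simp add: continuous_on_eq_continuous_within)
  moreover obtain T where T: "open T" "cdom c = M \<inter> T"
    using openin_cdom[OF c(1)] unfolding openin_open by blast
  have "at p within cdom c = at p within M"
    by (rule at_within_nhd[of p T]) (use T c(2) in auto)
  ultimately show "continuous (at p within M) u" by simp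
qed

definition chart_bump :: "('a, 'n) chart \<Rightarrow> real^'n \<Rightarrow> real \<Rightarrow> 'a \<Rightarrow> real" where
  "chart_bump c a r p = (if p \<in> cdom c then bump a r (coord c p) else 0)"

text \<open>The region of chart \<open>d\<close>, in coordinates, where a function supported in the
  ball of chart \<open>c\<close> is zero.\<close>

definition off_ball :: "('a, 'n) chart \<Rightarrow> ('a, 'n) chart \<Rightarrow> real^'n \<Rightarrow> real \<Rightarrow> (real^'n) set" where
  "off_ball d c a r = img d \<inter> param d -` (- (param c ` cball a r))"

text \<open>The coordinate ball is compact in the manifold and hence closed, the ambient space being
  Hausdorff. Openness of its complement is what makes extension by zero differentiable.\<close>

lemma open_off_ball:
  assumes c: "c \<in> A" and d: "d \<in> A" and sub: "cball a r \<subseteq> img c"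
  shows "open (off_ball d c a r)"
proof -
  have cont: "continuous_on (img e) (param e)" if "e \<in> A" for e
    using homeo[OF that] by (simp add: homeomorphism_def)
  have "compact (param c ` cball a r)"
    by (rule compact_continuous_image[OF continuous_on_subset[OF cont[OF c] sub] compact_cball])
  then have "open (- (param c ` cball a r))"
    by (intro open_Compl compact_imp_closed)
  then show ?thesis
    unfolding off_ball_def using continuous_open_preimage[OF cont[OF d] open_image[OF d]] by blast
qed

lemma ovl_Un_off_ball:
  assumes c: "c \<in> A" and d: "d \<in> A" and sub: "cball a r \<subseteq> img c"
  shows "ovl d c \<union> off_ball d c a r = img d"
proof (intro equalityI subsetI)
  fix x assume x: "x \<in> img d"
  show "x \<in> ovl d c \<union> off_ball d c a r"
  proof (cases "param d x \<in> param c ` cball a r")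
    case True
    then have "param d x \<in> cdom d \<inter> cdom c" using sub c x d by auto
    moreover have "x = coord d (param d x)" using x d by simp
    ultimately show ?thesis unfolding ovl_def by blast
  next
    case False
    then show ?thesis using x by (simp add: off_ball_def)
  qed
next
  fix x assume "x \<in> ovl d c \<union> off_ball d c a r"
  then show "x \<in> img d" using ovl_subset[of d c] by (auto simp: off_ball_def)
qed

lemma off_ball_coord:
  assumes "c \<in> A" "x \<in> off_ball d c a r" "param d x \<in> cdom c"
  shows "coord c (param d x) \<notin> cball a r"
proof
  assume "coord c (param d x) \<in> cball a r"
  then have "param c (coord c (param d x)) \<in> param c ` cball a r" by blast
  then show False using assms by (simp add: off_ball_def)
qed

text \<open>In another chart \<open>d\<close> the function is a composition with the transition map
  on the overlap and zero off the ball; these two open sets cover the image of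
  \<open>d\<close>.\<close>

lemma C1_fun_chart_bump:
  assumes c: "c \<in> A" and r: "r > 0" and sub: "cball a r \<subseteq> img c"
  shows "C1_fun (chart_bump c a r)"
  unfolding C1_fun_def
proof
  fix d assume d: "d \<in> A"
  have b: "Ck_on 1 (ovl d c) (\<lambda>x. bump a r (trans_map d c x))"
    by (rule C1_on_compose[OF open_ovl[OF d c] open_UNIV C1_bump smooth_on_Ck_on[OF trans_map_smooth[OF d c]]]) simp
  have e: "bump a r (trans_map d c x) = chart_bump c a r (param d x)" if "x \<in> ovl d c" for x
    using that d by (auto simp: ovl_def chart_bump_def trans_map_def)
  have 1: "Ck_on 1 (ovl d c) (\<lambda>x. chart_bump c a r (param d x))"
    by (rule iffD1[OF Ck_on_cong[OF open_ovl[OF d c] e] b])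
  have z: "chart_bump c a r (param d x) = 0" if "x \<in> off_ball d c a r" for x
    using bump_eq_0[OF r off_ball_coord[OF c that]] by (simp add: chart_bump_def)
  have 2: "Ck_on 1 (off_ball d c a r) (\<lambda>x. chart_bump c a r (param d x))"
    by (rule iffD2[OF Ck_on_cong[OF open_off_ball[OF c d sub] z] Ck_on_const])
  show "Ck_on 1 (img d) (\<lambda>x. chart_bump c a r (param d x))"
    unfolding ovl_Un_off_ball[OF c d sub, symmetric]
    by (rule Ck_on_open_Un[OF open_ovl[OF d c] open_off_ball[OF c d sub] 1 2])
qed

text \<open>The support is confined to a closed coordinate ball, so that the coordinate expression
  extended by zero has compact support in Euclidean space.\<close>

definition ball_supported :: "('a, 'n) chart \<Rightarrow> real^'n \<Rightarrow> real \<Rightarrow> ('a \<Rightarrow> real) \<Rightarrow> bool" where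
  "ball_supported c a r u \<longleftrightarrow> c \<in> A \<and> cball a r \<subseteq> img c \<and>
     (\<forall>p\<in>M. p \<notin> cdom c \<longrightarrow> u p = 0) \<and> (\<forall>x\<in>img c. x \<notin> cball a r \<longrightarrow> u (param c x) = 0)"

end

section \<open>A partition of unity and integrability\<close>

context compact_riemannian_manifold
begin

text \<open>Finitely many bumps, indexed by chart, centre and radius, are divided by their sum,
  which is positive because the open balls cover.\<close>

lemma C1_partition_of_unity:
  "\<exists>(I :: (('a, 'n) chart \<times> (real^'n) \<times> real) set) \<phi>. finite I \<and>
     (\<forall>i\<in>I. C1_fun (\<phi> i) \<and> ball_supported (fst i) (fst (snd i)) (snd (snd i)) (\<phi> i)) \<and>
     (\<forall>p\<in>M. (\<Sum>i\<in>I. \<phi> i p) = 1)"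
proof -
  define J :: "(('a, 'n) chart \<times> (real^'n) \<times> real) set"
    where "J = {(c, a, r). c \<in> A \<and> r > 0 \<and> cball a r \<subseteq> img c}"
  \<comment> \<open>The covering uses open balls, where bumps are positive, while \<open>J\<close>
    requires the closed ball to fit into the chart image, as the support condition demands.\<close>
  define N :: "('a, 'n) chart \<times> (real^'n) \<times> real \<Rightarrow> 'a set"
    where "N = (\<lambda>(c, a, r). cdom c \<inter> coord c -` ball a r)"
  have oN: "openin (top_of_set M) (N j)" if "j \<in> J" for j
  proof -
    obtain c a r where j: "j = (c, a, r)" by (cases j)
    then have cA: "c \<in> A" using that by (simp add: J_def)
    have "openin (top_of_set (cdom c)) (N j)"
      using homeo[OF cA] unfolding j N_def homeomorphism_def
      by (auto intro!: continuous_openin_preimage_gen)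
    then show ?thesis using openin_cdom[OF cA] openin_trans by blast
  qed
  have cov: "M \<subseteq> (\<Union>j\<in>J. N j)"
  proof
    fix p assume p: "p \<in> M"
    define c where "c = chart_at A p"
    note c = chart_at[OF p, folded c_def]
    obtain r where r: "r > 0" "cball (coord c p) r \<subseteq> img c"
      using open_contains_cball[of "img c"] open_image[OF c(1)] c(2) by blast
    then have "(c, coord c p, r) \<in> J" "p \<in> N (c, coord c p, r)"
      using c by (auto simp: J_def N_def)
    then show "p \<in> (\<Union>j\<in>J. N j)" by blast
  qed
  have "\<exists>D\<subseteq>N ` J. finite D \<and> M \<subseteq> \<Union>D"
    using compact_M[unfolded compact_eq_openin_cover, rule_format, of "N ` J"] oN cov by blast
  then obtain D where D: "D \<subseteq> N ` J" "finite D" "M \<subseteq> \<Union>D" by blast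
  obtain I where I: "I \<subseteq> J" "finite I" "D = N ` I"
    using finite_subset_image[OF D(2,1)] by blast
  define \<psi> where "\<psi> = (\<lambda>(c, a, r). chart_bump c a r)"
  define \<Psi> where "\<Psi> p = (\<Sum>i\<in>I. \<psi> i p)" for p
  have \<psi>_nonneg: "\<psi> i p \<ge> 0" for i p
    by (cases i) (simp add: \<psi>_def chart_bump_def bump_nonneg)
  have \<Psi>_pos: "\<Psi> p > 0" if "p \<in> M" for p
  proof -
    have "p \<in> (\<Union>i\<in>I. N i)" using D(3) that unfolding I(3) by (rule subsetD)
    then obtain i where i: "i \<in> I" "p \<in> N i" by blast
    obtain c a r where ic: "i = (c, a, r)" by (cases i)
    have "r > 0" using i(1) I(1) ic by (auto simp: J_def)
    then have "\<psi> i p > 0" using i(2) bump_pos[of r "coord c p" a] by (simp add: ic \<psi>_def N_def chart_bump_def)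
    then show ?thesis unfolding \<Psi>_def using I(2) i(1) \<psi>_nonneg by (meson sum_pos2)
  qed
  have \<psi>_C1: "C1_fun (\<psi> i)" if "i \<in> I" for i
    using that I(1) by (cases i) (auto simp: \<psi>_def J_def intro: C1_fun_chart_bump)
  define \<phi> where "\<phi> i p = \<psi> i p * inverse (\<Psi> p)" for i p
  have \<phi>_C1: "C1_fun (\<phi> i)" if i: "i \<in> I" for i
    unfolding C1_fun_def
  proof
    fix c assume c: "c \<in> A"
    have 1: "Ck_on 1 (img c) (\<lambda>x. \<psi> j (param c x))" if "j \<in> I" for j
      using \<psi>_C1[OF that] c unfolding C1_fun_def by blast
    have "\<Psi> (param c x) \<noteq> 0" if "x \<in> img c" for x
      using \<Psi>_pos[of "param c x"] cdom_subset[OF c] param_in[OF c that] by fastforce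
    then show "Ck_on 1 (img c) (\<lambda>x. \<phi> i (param c x))"
      unfolding \<phi>_def \<Psi>_def
      by (intro Ck_on_mult Ck_on_inverse Ck_on_sum open_image[OF c] 1 i) auto
  qed
  moreover have "ball_supported (fst i) (fst (snd i)) (snd (snd i)) (\<phi> i)" if "i \<in> I" for i
  proof -
    obtain c a r where ic: "i = (c, a, r)" by (cases i)
    have "c \<in> A" "r > 0" "cball a r \<subseteq> img c" using that I(1) by (auto simp: ic J_def)
    then show ?thesis
      using bump_eq_0[of r _ a] by (auto simp: ball_supported_def ic \<phi>_def \<psi>_def chart_bump_def)
  qed
  moreover have "(\<Sum>i\<in>I. \<phi> i p) = 1" if "p \<in> M" for p
    unfolding \<phi>_def sum_distrib_right[symmetric] \<Psi>_def[symmetric] using \<Psi>_pos[OF that] by simp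
  ultimately show ?thesis using I(2) by blast
qed

lemma integrable_ball_supported:
  assumes s: "chart_continuous s" and supp: "ball_supported c a r s"
  shows "integrable dv s"
proof -
  note S = supp[unfolded ball_supported_def]
  have c: "c \<in> A" using S by simp
  have "integrable lborel (\<lambda>x. indicator (img c) x * (dens c x * s (param c x)))"
  proof (rule integrable_compact_support[OF compact_cball[of a r]])
    have "continuous_on (img c) (\<lambda>x. dens c x * s (param c x))"
      using s c by (intro continuous_on_mult dens_continuous) (auto simp: chart_continuous_def)
    then have "continuous_on (cball a r) (\<lambda>x. dens c x * s (param c x))"
      using S continuous_on_subset by blast
    then show "continuous_on (cball a r) (\<lambda>x. indicator (img c) x * (dens c x * s (param c x)))"
      using S by (subst continuous_on_cong[OF refl, where g = "\<lambda>x. dens c x * s (param c x)"])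
        (auto split: split_indicator)
  qed (use S in \<open>auto split: split_indicator\<close>)
  then show ?thesis
    using integral_in_chart(2)[OF c continuous_on_M_measurable[OF chart_continuous_on_M[OF s]]] S by simp
qed

text \<open>The partition of unity splits the function into pieces with compact support in one chart
  each.\<close>

lemma integrable_chart_continuous:
  assumes s: "chart_continuous s"
  shows "integrable dv s"
proof -
  obtain I :: "(('a, 'n) chart \<times> (real^'n) \<times> real) set" and \<phi> where I: "finite I"
    "\<And>i. i \<in> I \<Longrightarrow> C1_fun (\<phi> i)" "\<And>i. i \<in> I \<Longrightarrow> ball_supported (fst i) (fst (snd i)) (snd (snd i)) (\<phi> i)"
    "\<And>p. p \<in> M \<Longrightarrow> (\<Sum>i\<in>I. \<phi> i p) = 1"
    using C1_partition_of_unity by blast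
  have "integrable dv (\<lambda>p. \<phi> i p * s p)" if i: "i \<in> I" for i
  proof (rule integrable_ball_supported)
    show "chart_continuous (\<lambda>p. \<phi> i p * s p)"
      using s C1_fun_chart_continuous[OF I(2)[OF i]]
      by (auto simp: chart_continuous_def intro: continuous_on_mult)
    show "ball_supported (fst i) (fst (snd i)) (snd (snd i)) (\<lambda>p. \<phi> i p * s p)"
      using I(3)[OF i] unfolding ball_supported_def by (metis (no_types, lifting) mult_zero_left)
  qed
  then have "integrable dv (\<lambda>p. \<Sum>i\<in>I. \<phi> i p * s p)" by (intro Bochner_Integration.integrable_sum)
  then show ?thesis
  proof (subst Bochner_Integration.integrable_cong[OF refl, where g = "\<lambda>p. \<Sum>i\<in>I. \<phi> i p * s p"])
    fix p assume "p \<in> space dv"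
    then show "s p = (\<Sum>i\<in>I. \<phi> i p * s p)"
      using I(4) by (simp add: sum_distrib_right[symmetric] space_dv)
  qed
qed

end

section \<open>The divergence theorem and the integral identity\<close>

locale compact_gradient_soliton = gradient_soliton M A g f h + compact_riemannian_manifold M A g
  for M :: "'a::{t2_space,second_countable_topology} set"
    and A :: "('a, 'n::finite) chart set"
    and g :: "('a, 'n) tensor2" and f h :: "'a \<Rightarrow> real"
begin

text \<open>The derivative of \<open>u\<close> along the vector field \<open>T(\<nabla>f)\<close>, where \<open>T\<close> is the trace-free Ricci tensor.\<close>

definition deriv_V :: "('a \<Rightarrow> real) \<Rightarrow> 'a \<Rightarrow> real" where
  "deriv_V u p = (let c = chart_at A p in
     dvec (\<lambda>y. u (param c y)) (coord c p) \<bullet> local_metric.V (loc c) (fl c) (coord c p))"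

lemma deriv_V_param:
  assumes u: "C1_fun u" and c: "c \<in> A" and x: "x \<in> img c"
  shows "deriv_V u (param c x) = dvec (\<lambda>y. u (param c y)) x \<bullet> local_metric.V (loc c) (fl c) x"
proof -
  define d where "d = chart_at A (param c x)"
  note d = chart_at_param[OF c x, folded d_def]
  have "(\<lambda>y. u (param d y)) differentiable (at (trans_map c d x))"
    using u d(2,5) Ck_on_differentiable[of 0 "img d" "\<lambda>y. u (param d y)"] open_image[OF d(2)]
    by (simp add: C1_fun_def del: Ck_on.simps)
  from dvec_V_transform[OF c d(2,3) this] show ?thesis
    by (simp add: deriv_V_def Let_def d_def[symmetric] d(4))
qed

lemma deriv_V_chart_continuous:
  assumes u: "C1_fun u"
  shows "chart_continuous (deriv_V u)"
  unfolding chart_continuous_def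
proof
  fix c assume c: "c \<in> A"
  interpret L: local_metric "img c" "loc c" by (rule local_metric_loc[OF c])
  have "continuous_on (img c) (pd i (\<lambda>y. u (param c y)))" for i
    using u c by (simp add: C1_fun_def)
  then have "continuous_on (img c) (\<lambda>x. dvec (\<lambda>y. u (param c y)) x \<bullet> L.V (fl c) x)"
    unfolding inner_vec_def dvec_def vec_lambda_beta inner_real_def
    by (intro continuous_on_sum continuous_on_mult smooth_on_continuous_on[OF L.V_smooth[OF fl_smooth[OF c]]])
  then show "continuous_on (img c) (\<lambda>x. deriv_V u (param c x))"
    using deriv_V_param[OF u c] by (simp cong: continuous_on_cong)
qed

text \<open>The divergence of \<open>T(grad f)\<close> in the form computed by
  \<open>divergence_V\<close>, written with functions on the manifold.\<close>

definition div_V :: "'a \<Rightarrow> real" where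
  "div_V p = (1 / 2 - 1 / real CARD('n)) * gradR_gradf p - Tnorm p"

lemma gradR_gradf_chart_continuous: "chart_continuous gradR_gradf"
  unfolding chart_continuous_def
proof
  fix c assume c: "c \<in> A"
  interpret L: local_metric "img c" "loc c" by (rule local_metric_loc[OF c])
  have "smooth_on (img c) (\<lambda>x. dvec (lscal (loc c)) x \<bullet> (L.Gi x *v dvec (fl c) x))"
    unfolding inner_vec_def dvec_def matrix_vector_mult_def vec_lambda_beta inner_real_def
    using L.Gi_smooth fl_smooth[OF c] L.scal_smooth
    by (intro smooth_on_sum smooth_on_mult smooth_on_pd L.open_U) (auto simp: msmooth_on_def)
  then show "continuous_on (img c) (\<lambda>x. gradR_gradf (param c x))"
    using gradR_gradf_param[OF c] smooth_on_continuous_on by (simp cong: continuous_on_cong)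
qed

lemma Tnorm_chart_continuous: "chart_continuous Tnorm"
  unfolding chart_continuous_def
proof
  fix c assume c: "c \<in> A"
  interpret L: local_metric "img c" "loc c" by (rule local_metric_loc[OF c])
  have "msmooth_on (img c) (\<lambda>x. transpose (L.T x) ** L.Gi x ** L.T x ** L.Gi x)"
    by (intro L.ms_intros L.T_smooth L.Gi_smooth)
  then have "smooth_on (img c) (\<lambda>x. frob2 (L.Gi x) (L.T x))"
    unfolding frob2_def trace_def by (intro smooth_on_sum L.open_U) (auto simp: msmooth_on_def)
  then show "continuous_on (img c) (\<lambda>x. Tnorm (param c x))"
    using Tnorm_param[OF c] smooth_on_continuous_on by (simp cong: continuous_on_cong)
qed

text \<open>The integrand is the divergence of \<open>u V\<close>. In coordinates, times the
  density, it is a sum of partial derivatives of compactly supported C^1 functions.\<close>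

lemma integral_divergence_ball_supported:
  assumes u: "C1_fun u" and supp: "ball_supported c a r u"
  shows "(\<integral>p. u p * div_V p + deriv_V u p \<partial>dv) = 0"
proof -
  note S = supp[unfolded ball_supported_def]
  have c: "c \<in> A" and sub: "cball a r \<subseteq> img c" using S by auto
  let ?U = "img c"
  interpret L: local_metric ?U "loc c" by (rule local_metric_loc[OF c])
  let ?u = "\<lambda>x. u (param c x)"
  have u1: "Ck_on 1 ?U ?u" using u c by (simp add: C1_fun_def)
  have oC: "open (- cball a r)" by (rule open_Compl[OF closed_cball])
  have cov: "?U \<union> - cball a r = UNIV" using sub by auto
  \<comment> \<open>The components of \<open>sqrt (det g) u V\<close>, extended by zero. The
    extension is C^1 because the open chart image and the complement of the closed ball cover the
    whole space.\<close>
  define w where "w j x = (if x \<in> ?U then dens c x * (?u x * L.V (fl c) x $ j) else 0)" for j x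
  have w_U: "w j x = sqrt (det (loc c x)) * (?u x * L.V (fl c) x $ j)" if "x \<in> ?U" for j x
    using that by (simp add: w_def dens_def)
  have w_0: "w j x = 0" if "x \<notin> cball a r" for j x
    using that S by (auto simp: w_def)
  have w_C1: "Ck_on 1 UNIV (w j)" for j
    unfolding cov[symmetric]
  proof (rule Ck_on_open_Un[OF L.open_U oC])
    show "Ck_on 1 ?U (w j)"
      by (rule iffD2[OF Ck_on_cong[OF L.open_U w_U]], assumption)
        (intro Ck_on_mult L.open_U u1 smooth_on_Ck_on L.sqrt_det_smooth L.V_smooth fl_smooth c)
    show "Ck_on 1 (- cball a r) (w j)"
      by (rule iffD2[OF Ck_on_cong[OF oC w_0] Ck_on_const]) simp
  qed
  have int_0: "(\<integral>x. pd j (w j) x \<partial>lborel) = 0" for j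
    by (rule integral_pd_compact_support[OF compact_cball w_C1 w_0])
  have pd_0: "pd j (w j) x = 0" if "x \<notin> cball a r" for j x
    by (rule pd_eq_0_outside[OF closed_cball w_0 that])
  have int_ok: "integrable lborel (pd j (w j))" for j
    by (rule integrable_compact_support[OF compact_cball[of a r] continuous_on_subset[OF _ subset_UNIV] pd_0])
      (use w_C1[of j] in simp)
  let ?s = "\<lambda>p. u p * div_V p + deriv_V u p"
  have div: "(\<Sum>j\<in>UNIV. pd j (w j) x) = indicator ?U x * (dens c x * ?s (param c x))" for x
  proof (cases "x \<in> ?U")
    case True
    have "pd j (w j) x = pd j (\<lambda>x. sqrt (det (loc c x)) * (?u x * L.V (fl c) x $ j)) x" for j
      by (rule pd_cong[OF L.open_U True w_U])
    moreover have "?u differentiable (at x)"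
      using Ck_on_differentiable[of 0 ?U ?u x] u1 L.open_U True by (simp del: Ck_on.simps)
    ultimately show ?thesis
      using L.weighted_divergence_V[OF fl_smooth[OF c] local_soliton[OF c] True, of ?u] True
      by (simp add: dens_def div_V_def gradR_gradf_param[OF c True] Tnorm_param[OF c True] deriv_V_param[OF u c True])
  next
    case False
    then have "x \<notin> cball a r" using sub by blast
    then show ?thesis using False pd_0 by simp
  qed
  have s_cont: "chart_continuous ?s"
    using C1_fun_chart_continuous[OF u] deriv_V_chart_continuous[OF u] gradR_gradf_chart_continuous Tnorm_chart_continuous
    unfolding chart_continuous_def div_V_def by (auto intro!: continuous_intros)
  \<comment> \<open>\<open>deriv_V u p\<close> is evaluated in some other chart. That
    \<open>u\<close> vanishes at \<open>p\<close> does not suffice for the derivative; it vanishes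
    on the open set \<open>off_ball\<close> around the point.\<close>
  have s_supp: "?s p = 0" if "p \<in> M" "p \<notin> cdom c" for p
  proof -
    define d where "d = chart_at A p"
    note d = chart_at[OF that(1), folded d_def]
    have y: "coord d p \<in> img d" "param d (coord d p) = p" using d by auto
    have "coord d p \<notin> ovl d c" using that(2) y(2) d(1) by (auto simp: ovl_def)
    then have yO: "coord d p \<in> off_ball d c a r" using ovl_Un_off_ball[OF c d(1) sub] y(1) by blast
    have z: "u (param d x) = 0" if x: "x \<in> off_ball d c a r" for x
    proof (cases "param d x \<in> cdom c")
      case True
      then have "u (param c (coord c (param d x))) = 0" using S off_ball_coord[OF c x True] by blast
      then show ?thesis using True c by simp
    next
      case False
      have "param d x \<in> M"
        using x cdom_subset[OF d(1)] param_in[OF d(1), of x] unfolding off_ball_def by blast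
      then show ?thesis using False S by blast
    qed
    have "dvec (\<lambda>y. u (param d y)) (coord d p) = 0"
      using pd_cong[OF open_off_ball[OF c d(1) sub] yO z] by (simp add: dvec_def vec_eq_iff)
    moreover have "u p = 0" using S that by blast
    ultimately show ?thesis by (simp add: deriv_V_def Let_def d_def[symmetric])
  qed
  have "integral\<^sup>L dv ?s = (\<integral>x. indicator ?U x * (dens c x * ?s (param c x)) \<partial>lborel)"
    by (rule integral_in_chart(1)[OF c continuous_on_M_measurable[OF chart_continuous_on_M[OF s_cont]] s_supp])
  also have "\<dots> = (\<integral>x. (\<Sum>j\<in>UNIV. pd j (w j) x) \<partial>lborel)" by (simp only: div)
  also have "\<dots> = 0" using int_ok int_0 by (simp add: Bochner_Integration.integral_sum)
  finally show ?thesis .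
qed

text \<open>Summing over the partition of unity, the functions add up to 1, so the first terms give
  \<open>div_V\<close> and the derivatives along \<open>V\<close> give the derivative of a
  constant.\<close>

lemma integral_div_V: "(\<integral>p. div_V p \<partial>dv) = 0"
proof -
  obtain I :: "(('a, 'n) chart \<times> (real^'n) \<times> real) set" and \<phi> where I: "finite I"
    "\<And>i. i \<in> I \<Longrightarrow> C1_fun (\<phi> i)" "\<And>i. i \<in> I \<Longrightarrow> ball_supported (fst i) (fst (snd i)) (snd (snd i)) (\<phi> i)"
    "\<And>p. p \<in> M \<Longrightarrow> (\<Sum>i\<in>I. \<phi> i p) = 1"
    using C1_partition_of_unity by blast
  let ?s = "\<lambda>i p. \<phi> i p * div_V p + deriv_V (\<phi> i) p"
  have int: "integrable dv (?s i)" if i: "i \<in> I" for i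
  proof (rule integrable_chart_continuous)
    show "chart_continuous (?s i)"
      using C1_fun_chart_continuous[OF I(2)[OF i]] deriv_V_chart_continuous[OF I(2)[OF i]]
        gradR_gradf_chart_continuous Tnorm_chart_continuous
      unfolding chart_continuous_def div_V_def by (auto intro!: continuous_intros)
  qed
  have sum_s: "(\<Sum>i\<in>I. ?s i p) = div_V p" if p: "p \<in> M" for p
  proof -
    define c where "c = chart_at A p"
    note c = chart_at[OF p, folded c_def]
    have x: "coord c p \<in> img c" using c by blast
    have d: "(\<lambda>y. \<phi> i (param c y)) differentiable (at (coord c p))" if "i \<in> I" for i
      using I(2)[OF that] c(1) x Ck_on_differentiable[of 0 "img c" "\<lambda>y. \<phi> i (param c y)"] open_image[OF c(1)]
      by (simp add: C1_fun_def del: Ck_on.simps)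
    have "(\<Sum>i\<in>I. pd k (\<lambda>y. \<phi> i (param c y)) (coord c p)) = 0" for k
    proof -
      have "(\<Sum>i\<in>I. pd k (\<lambda>y. \<phi> i (param c y)) (coord c p)) = pd k (\<lambda>y. \<Sum>i\<in>I. \<phi> i (param c y)) (coord c p)"
        using d by (rule pd_sum[symmetric])
      also have "\<dots> = pd k (\<lambda>y. 1) (coord c p)"
      proof (rule pd_cong[OF open_image[OF c(1)] x])
        fix y assume "y \<in> img c"
        then have "param c y \<in> M" using cdom_subset[OF c(1)] c(1) by auto
        then show "(\<Sum>i\<in>I. \<phi> i (param c y)) = 1" by (rule I(4))
      qed
      finally show ?thesis by simp
    qed
    then have "(\<Sum>i\<in>I. dvec (\<lambda>y. \<phi> i (param c y)) (coord c p)) = 0"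
      by (simp add: vec_eq_iff dvec_def)
    then have "(\<Sum>i\<in>I. deriv_V (\<phi> i) p) = 0"
      by (simp add: deriv_V_def Let_def c_def[symmetric] inner_sum_left[symmetric])
    then show ?thesis
      using I(4)[OF p] by (simp add: sum.distrib sum_distrib_right[symmetric])
  qed
  have "(\<integral>p. div_V p \<partial>dv) = (\<integral>p. (\<Sum>i\<in>I. ?s i p) \<partial>dv)"
    by (rule Bochner_Integration.integral_cong[OF refl]) (simp only: sum_s space_dv)
  also have "\<dots> = (\<Sum>i\<in>I. \<integral>p. ?s i p \<partial>dv)"
    using int by (rule Bochner_Integration.integral_sum)
  also have "\<dots> = 0"
    using integral_divergence_ball_supported[OF I(2,3)] by (intro sum.neutral) auto
  finally show ?thesis .
qed

lemma integral_Tnorm: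
  "(\<integral>p. Tnorm p \<partial>dv) = (real CARD('n) - 2) / (2 * real CARD('n)) * (\<integral>p. gradR_gradf p \<partial>dv)"
proof -
  have "(\<integral>p. div_V p \<partial>dv) = (1 / 2 - 1 / real CARD('n)) * (\<integral>p. gradR_gradf p \<partial>dv) - (\<integral>p. Tnorm p \<partial>dv)"
    unfolding div_V_def using integrable_chart_continuous[OF gradR_gradf_chart_continuous]
      integrable_chart_continuous[OF Tnorm_chart_continuous]
    by (subst Bochner_Integration.integral_diff) auto
  moreover have "1 / 2 - 1 / real CARD('n) = (real CARD('n) - 2) / (2 * real CARD('n))"
    by (simp add: field_simps)
  ultimately show ?thesis using integral_div_V by simp
qed

end

theorem theorem1p11:
  fixes M :: "'a::{t2_space,second_countable_topology} set"
    and A :: "('a, 'n::finite) chart set"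
    and g :: "('a, 'n) tensor2"
    and f lam :: "'a \<Rightarrow> real"
    and \<rho> :: real
  assumes "compact M"
    and "gradient_RB_almost_soliton M A g f lam \<rho>"
  shows
    "(\<integral>p. (tensor_norm A g
            (\<lambda>c q. hessian g f c q - (laplacian A g f q / real CARD('n)) *\<^sub>R g c q) p)\<^sup>2
        \<partial>volume_measure M A g)
     = (real CARD('n) - 2) / (2 * real CARD('n)) *
       (\<integral>p. metric_inner A g (grad g (scalar_curvature A g)) (grad g f) p
          \<partial>volume_measure M A g)
     \<and>
     (\<integral>p. (tensor_norm A g
            (\<lambda>c q. ricci g c q - (scalar_curvature A g q / real CARD('n)) *\<^sub>R g c q) p)\<^sup>2
        \<partial>volume_measure M A g)
     = (real CARD('n) - 2) / (2 * real CARD('n)) *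
       (\<integral>p. metric_inner A g (grad g (scalar_curvature A g)) (grad g f) p
          \<partial>volume_measure M A g)"
proof -
  note sol = assms(2)[unfolded gradient_RB_almost_soliton_def]
  \<comment> \<open>The whole factor of \<open>g\<close> in the soliton equation becomes the single
    function \<open>h\<close>; \<open>\<lambda>\<close> and \<open>\<rho>\<close> enter nowhere
    else.\<close>
  interpret compact_gradient_soliton M A g f "\<lambda>p. lam p + \<rho> * scalar_curvature A g p"
    by unfold_locales (use assms(1) sol in \<open>auto simp: scaleR_left_distrib\<close>)
  have "(\<integral>p. (tensor_norm A g
            (\<lambda>c q. hessian g f c q - (laplacian A g f q / real CARD('n)) *\<^sub>R g c q) p)\<^sup>2 \<partial>dv) = (\<integral>p. Tnorm p \<partial>dv)"
    by (rule Bochner_Integration.integral_cong[OF refl]) (simp only: hessian_norm_eq_Tnorm space_dv)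
  then show ?thesis
    using integral_Tnorm unfolding gradR_gradf_def Tnorm_def by simp
qed

end
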